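(* Let $G\le\mathrm{Sym}(\Omega)$ be a primitive solvable permutation group and $\mathcal X=\mathrm{Inv}(G)$. Then $\mathcal X$ has a (possibly equal to $\mathcal X$) fusion isomorphic to $\mathcal Y\uparrow L$, where $\mathcal Y$ is a linearly primitive scheme and $L$ is a transitive permutation group. Moreover, if $\mathcal X$ is antisymmetric, then $\mathcal Y$ is antisymmetric and $L$ has odd order.
   Context: A coherent configuration on a finite set $\Omega$ is $\mathcal X=(\Omega,S)$ with $S$ a partition of $\Omega\times\Omega$ such that $1_\Omega$ is a union of elements of $S$, $s^*=\{(\beta,\alpha):(\alpha,\beta)\in s\}\in S$ for $s\in S$, and for $r,s,t\in S$ the number $|\{\gamma:(\alpha,\gamma)\in r,(\gamma,\beta)\in s\}|$ is independent of $(\alpha,\beta)\in t$; it is a scheme if $1_\Omega\in S$, antisymmetric if every $s\in S$ with $s=s^*$ lies in $1_\Omega$. $\mathcal X'$ is a fusion of $\mathcal X$ if every union of elements of $S'$ is a union of elements of $S$. $\mathrm{Inv}(G)=(\Omega,\text{orbits of }G\text{ on }\Omega\times\Omega)$. If $G$ is a primitive solvable permutation group on $\Omega$, then $\Omega$ can be identified with a vector space $\mathbb F_p^d$ so that $G\le\mathrm{AGL}(d,p)$ contains all translations and the stabilizer $K\le \mathrm{GL}(d,p)$ of the zero vector is irreducible; the scheme $\mathrm{Inv}(G)$ is called linearly primitive if $K$ is a primitive linear group (does not permute the summands of any decomposition $\mathbb F_p^d=V_1\oplus\dots\oplus V_t$, $t>1$, of nonzero subspaces). Exponentiation: for a coherent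 configuration $\mathcal Y=(\Gamma,T)$ and $L\le\mathrm{Sym}(\{1,\dots,m\})$, for $t_1,\dots,t_m\in T$ put $t_1\otimes\dots\otimes t_m=\{(\alpha,\beta)\in\Gamma^m\times\Gamma^m:(\alpha_i,\beta_i)\in t_i\ \forall i\}$; $L$ acts on $\Gamma^m$ by permuting coordinates and hence on such relations; $\mathcal Y\uparrow L=(\Gamma^m,\{\bigcup_{l\in L}t^l: t=t_1\otimes\dots\otimes t_m,\ t_i\in T\})$, a coherent configuration. *)

theory Defs
  imports "HOL-Algebra.Solvable_Groups" "HOL-Library.FuncSet" "HOL-Computational_Algebra.Primes"
begin

definition coherent_config :: "'a set \<Rightarrow> ('a \<times> 'a) set set \<Rightarrow> bool" where
  "coherent_config \<Omega> S \<longleftrightarrow>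
     finite \<Omega> \<and>
     (\<forall>s\<in>S. s \<noteq> {}) \<and> \<Union>S = \<Omega> \<times> \<Omega> \<and>
     (\<forall>s\<in>S. \<forall>s'\<in>S. s \<noteq> s' \<longrightarrow> s \<inter> s' = {}) \<and>
     (\<exists>S0\<subseteq>S. \<Union>S0 = Id_on \<Omega>) \<and>
     (\<forall>s\<in>S. converse s \<in> S) \<and>
     (\<forall>r\<in>S. \<forall>s\<in>S. \<forall>t\<in>S. \<forall>x\<in>t. \<forall>y\<in>t.
        card {c. (fst x, c) \<in> r \<and> (c, snd x) \<in> s} =
        card {c. (fst y, c) \<in> r \<and> (c, snd y) \<in> s})"

definition is_scheme :: "'a set \<Rightarrow> ('a \<times> 'a) set set \<Rightarrow> bool" where
  "is_scheme \<Omega> S \<longleftrightarrow> coherent_config \<Omega> S \<and> Id_on \<Omega> \<in> S"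

definition antisymmetric_cc :: "'a set \<Rightarrow> ('a \<times> 'a) set set \<Rightarrow> bool" where
  "antisymmetric_cc \<Omega> S \<longleftrightarrow> (\<forall>s\<in>S. converse s = s \<longrightarrow> s \<subseteq> Id_on \<Omega>)"

definition is_fusion :: "'a set \<Rightarrow> ('a \<times> 'a) set set \<Rightarrow> ('a \<times> 'a) set set \<Rightarrow> bool" where
  "is_fusion \<Omega> S' S \<longleftrightarrow> coherent_config \<Omega> S' \<and>
     (\<forall>s'\<in>S'. \<exists>S0\<subseteq>S. \<Union>S0 = s')"

definition cc_isomorphic ::
  "'a set \<Rightarrow> ('a \<times> 'a) set set \<Rightarrow> 'b set \<Rightarrow> ('b \<times> 'b) set set \<Rightarrow> bool" where
  "cc_isomorphic \<Omega> S \<Omega>' S' \<longleftrightarrow>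
     (\<exists>f. bij_betw f \<Omega> \<Omega>' \<and> (\<lambda>s. (\<lambda>(a, b). (f a, f b)) ` s) ` S = S')"

definition perm_group :: "'a set \<Rightarrow> ('a \<Rightarrow> 'a) set \<Rightarrow> bool" where
  "perm_group \<Omega> G \<longleftrightarrow>
     (\<forall>g\<in>G. bij_betw g \<Omega> \<Omega> \<and> (\<forall>x. x \<notin> \<Omega> \<longrightarrow> g x = x)) \<and>
     id \<in> G \<and> (\<forall>g\<in>G. \<forall>h\<in>G. g \<circ> h \<in> G) \<and> (\<forall>g\<in>G. inv_into UNIV g \<in> G)"

definition perm_group_monoid :: "('a \<Rightarrow> 'a) set \<Rightarrow> ('a \<Rightarrow> 'a) monoid" where
  "perm_group_monoid G = \<lparr>carrier = G, monoid.mult = (\<circ>), one = id\<rparr>"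

definition solvable_perm_group :: "('a \<Rightarrow> 'a) set \<Rightarrow> bool" where
  "solvable_perm_group G \<longleftrightarrow> solvable (perm_group_monoid G)"

definition transitive_group :: "'a set \<Rightarrow> ('a \<Rightarrow> 'a) set \<Rightarrow> bool" where
  "transitive_group \<Omega> G \<longleftrightarrow> \<Omega> \<noteq> {} \<and> (\<forall>x\<in>\<Omega>. \<forall>y\<in>\<Omega>. \<exists>g\<in>G. g x = y)"

definition primitive_group :: "'a set \<Rightarrow> ('a \<Rightarrow> 'a) set \<Rightarrow> bool" where
  "primitive_group \<Omega> G \<longleftrightarrow> transitive_group \<Omega> G \<and>
     (\<forall>B. B \<subseteq> \<Omega> \<and> B \<noteq> {} \<and> (\<forall>g\<in>G. g ` B = B \<or> g ` B \<inter> B = {})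
          \<longrightarrow> card B = 1 \<or> B = \<Omega>)"

definition Inv :: "'a set \<Rightarrow> ('a \<Rightarrow> 'a) set \<Rightarrow> ('a \<times> 'a) set set" where
  "Inv \<Omega> G = (\<lambda>(a, b). {(g a, g b) | g. g \<in> G}) ` (\<Omega> \<times> \<Omega>)"

text \<open>Vectors of F_p^d are functions nat => nat with entries in {0..<p} at coordinates
  below d and 0 elsewhere; arithmetic modulo p.\<close>

definition vecs :: "nat \<Rightarrow> nat \<Rightarrow> (nat \<Rightarrow> nat) set" where
  "vecs p d = {v. (\<forall>i<d. v i < p) \<and> (\<forall>i\<ge>d. v i = 0)}"

definition vzero :: "nat \<Rightarrow> nat" where
  "vzero = (\<lambda>i. 0)"

definition vadd :: "nat \<Rightarrow> (nat \<Rightarrow> nat) \<Rightarrow> (nat \<Rightarrow> nat) \<Rightarrow> (nat \<Rightarrow> nat)" where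
  "vadd p u v = (\<lambda>i. (u i + v i) mod p)"

definition vsmul :: "nat \<Rightarrow> nat \<Rightarrow> (nat \<Rightarrow> nat) \<Rightarrow> (nat \<Rightarrow> nat)" where
  "vsmul p c v = (\<lambda>i. (c * v i) mod p)"

primrec vsum :: "nat \<Rightarrow> (nat \<Rightarrow> nat \<Rightarrow> nat) \<Rightarrow> nat \<Rightarrow> (nat \<Rightarrow> nat)" where
  "vsum p w 0 = vzero"
| "vsum p w (Suc n) = vadd p (vsum p w n) (w n)"

definition subspace_Fp :: "nat \<Rightarrow> nat \<Rightarrow> (nat \<Rightarrow> nat) set \<Rightarrow> bool" where
  "subspace_Fp p d W \<longleftrightarrow> W \<subseteq> vecs p d \<and> vzero \<in> W \<and>
     (\<forall>u\<in>W. \<forall>v\<in>W. vadd p u v \<in> W) \<and> (\<forall>c<p. \<forall>v\<in>W. vsmul p c v \<in> W)"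

definition linear_Fp :: "nat \<Rightarrow> nat \<Rightarrow> ((nat \<Rightarrow> nat) \<Rightarrow> (nat \<Rightarrow> nat)) \<Rightarrow> bool" where
  "linear_Fp p d A \<longleftrightarrow> A ` vecs p d \<subseteq> vecs p d \<and>
     (\<forall>u\<in>vecs p d. \<forall>v\<in>vecs p d. A (vadd p u v) = vadd p (A u) (A v)) \<and>
     (\<forall>c<p. \<forall>v\<in>vecs p d. A (vsmul p c v) = vsmul p c (A v))"

definition affine_Fp :: "nat \<Rightarrow> nat \<Rightarrow> ((nat \<Rightarrow> nat) \<Rightarrow> (nat \<Rightarrow> nat)) \<Rightarrow> bool" where
  "affine_Fp p d f \<longleftrightarrow> (\<exists>A b. linear_Fp p d A \<and> bij_betw A (vecs p d) (vecs p d) \<and>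
     b \<in> vecs p d \<and> (\<forall>v\<in>vecs p d. f v = vadd p (A v) b))"

definition direct_decomp :: "nat \<Rightarrow> nat \<Rightarrow> nat \<Rightarrow> (nat \<Rightarrow> (nat \<Rightarrow> nat) set) \<Rightarrow> bool" where
  "direct_decomp p d t V \<longleftrightarrow>
     (\<forall>i<t. subspace_Fp p d (V i) \<and> V i \<noteq> {vzero}) \<and>
     (\<forall>v\<in>vecs p d. \<exists>!w. w \<in> Pi\<^sub>E {..<t} V \<and> vsum p w t = v)"

definition irreducible_Fp :: "nat \<Rightarrow> nat \<Rightarrow> ((nat \<Rightarrow> nat) \<Rightarrow> (nat \<Rightarrow> nat)) set \<Rightarrow> bool" where
  "irreducible_Fp p d K \<longleftrightarrow>
     (\<forall>W. subspace_Fp p d W \<and> (\<forall>k\<in>K. k ` W \<subseteq> W) \<longrightarrow> W = {vzero} \<or> W = vecs p d)"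

definition primitive_linear_Fp :: "nat \<Rightarrow> nat \<Rightarrow> ((nat \<Rightarrow> nat) \<Rightarrow> (nat \<Rightarrow> nat)) set \<Rightarrow> bool" where
  "primitive_linear_Fp p d K \<longleftrightarrow>
     \<not> (\<exists>t V. t > 1 \<and> direct_decomp p d t V \<and>
            (\<forall>k\<in>K. \<forall>i<t. \<exists>j<t. k ` V i = V j))"

definition linearly_primitive_scheme :: "'b set \<Rightarrow> ('b \<times> 'b) set set \<Rightarrow> bool" where
  "linearly_primitive_scheme \<Gamma> T \<longleftrightarrow> is_scheme \<Gamma> T \<and>
     (\<exists>H. perm_group \<Gamma> H \<and> finite \<Gamma> \<and> primitive_group \<Gamma> H \<and> solvable_perm_group H \<and>
          T = Inv \<Gamma> H \<and>
          (\<exists>p d \<phi>. prime p \<and> bij_betw \<phi> \<Gamma> (vecs p d) \<and>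
             (let H' = (\<lambda>h. \<lambda>v. \<phi> (h (inv_into \<Gamma> \<phi> v))) ` H;
                  K = {k\<in>H'. k vzero = vzero}
              in (\<forall>h\<in>H'. affine_Fp p d h) \<and>
                 (\<forall>b\<in>vecs p d. \<exists>h\<in>H'. \<forall>v\<in>vecs p d. h v = vadd p v b) \<and>
                 irreducible_Fp p d K \<and> primitive_linear_Fp p d K)))"

definition tensor_rel :: "'b set \<Rightarrow> nat \<Rightarrow> (nat \<Rightarrow> ('b \<times> 'b) set)
    \<Rightarrow> ((nat \<Rightarrow> 'b) \<times> (nat \<Rightarrow> 'b)) set" where
  "tensor_rel \<Gamma> m ts = {(\<alpha>, \<beta>). \<alpha> \<in> Pi\<^sub>E {..<m} (\<lambda>_. \<Gamma>) \<and> \<beta> \<in> Pi\<^sub>E {..<m} (\<lambda>_. \<Gamma>) \<and>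
      (\<forall>i<m. (\<alpha> i, \<beta> i) \<in> ts i)}"

definition coord_perm :: "nat \<Rightarrow> (nat \<Rightarrow> nat) \<Rightarrow> (nat \<Rightarrow> 'b) \<Rightarrow> (nat \<Rightarrow> 'b)" where
  "coord_perm m l \<alpha> = restrict (\<alpha> \<circ> l) {..<m}"

definition rel_perm :: "nat \<Rightarrow> (nat \<Rightarrow> nat) \<Rightarrow> ((nat \<Rightarrow> 'b) \<times> (nat \<Rightarrow> 'b)) set
    \<Rightarrow> ((nat \<Rightarrow> 'b) \<times> (nat \<Rightarrow> 'b)) set" where
  "rel_perm m l t = (\<lambda>(\<alpha>, \<beta>). (coord_perm m l \<alpha>, coord_perm m l \<beta>)) ` t"

definition expo_points :: "'b set \<Rightarrow> nat \<Rightarrow> (nat \<Rightarrow> 'b) set" where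
  "expo_points \<Gamma> m = Pi\<^sub>E {..<m} (\<lambda>_. \<Gamma>)"

definition expo_rels :: "'b set \<Rightarrow> ('b \<times> 'b) set set \<Rightarrow> nat \<Rightarrow> (nat \<Rightarrow> nat) set
    \<Rightarrow> ((nat \<Rightarrow> 'b) \<times> (nat \<Rightarrow> 'b)) set set" where
  "expo_rels \<Gamma> T m L =
     {(\<Union>l\<in>L. rel_perm m l (tensor_rel \<Gamma> m ts)) | ts. \<forall>i<m. ts i \<in> T}"

end

theory Submission
  imports Defs "HOL-Algebra.Multiplicative_Group" "HOL-Algebra.Sylow"
begin

text \<open>The last nontrivial term of the derived series yields an elementary abelian normal subgroup
  of \<open>G\<close>; by primitivity it is regular, so \<open>\<Omega>\<close> itself becomes an abelian group \<open>V\<close> of exponent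
  \<open>p\<close> on which the stabilizer \<open>K\<close> of the identity acts irreducibly by automorphisms.
  Among the direct decompositions of \<open>V\<close> permuted by \<open>K\<close>, take one with the largest number
  of summands. Irreducibility makes \<open>K\<close> transitive on the summands, and maximality makes the group
  induced on a summand \<open>U\<close> by its stabilizer a primitive linear group, since a decomposition
  of \<open>U\<close> could be spread over all summands. Identifying the summands with \<open>U\<close> by elements of \<open>K\<close>
  embeds \<open>G\<close> into the wreath product, in product action, of the affine group induced on \<open>U\<close>
  with the permutation group \<open>L\<close> of the summands; the orbitals of this wreath product are the
  relations of the exponentiation.

  \<open>Inv(G)\<close> is antisymmetric iff no element of \<open>G\<close> swaps two points, which is inherited by
  the group induced on \<open>U\<close>. If \<open>L\<close> had even order, an involution of \<open>L\<close> would come from an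
  element of \<open>K\<close> of even order, a power of which is an involution and swaps two points.\<close>

section \<open>Permutation groups and their orbitals\<close>

text \<open>Enlarging a permutation group fuses its orbitals, so the whole claim comes down to one
  inclusion of permutation groups. The vector space stays an abstract abelian group of prime
  exponent, written multiplicatively: its subgroups are its subspaces and its endomorphisms are the
  linear maps. Coordinates appear only on \<open>U\<close>, where
  \<open>linearly_primitive_scheme\<close> asks for them. A decomposition is a set of subgroups and
  not an indexed family, so that an element of \<open>K\<close> acts on it by taking images. The
  price is that {\<one>} has to be kept out of the sets: two refined summands could share it, and
  the count of summands would break. This is also why the trivial group needs its own case. The
  summands must be identified with \<open>U\<close> by elements of \<open>K\<close> and not by
  arbitrary isomorphisms. Following an identification by \<open>k\<close> and then undoing another
  one then yields an element of \<open>K\<close> that preserves \<open>U\<close>, hence a member of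
  the induced group; this is what makes the embedding possible.\<close>

lemma bij_fixing_outside:
  assumes "bij_betw g \<Omega> \<Omega>" "\<And>x. x \<notin> \<Omega> \<Longrightarrow> g x = x"
  shows "bij g"
proof -
  have "bij_betw g (- \<Omega>) (- \<Omega>)"
    using assms(2) by (auto simp: bij_betw_def inj_on_def image_def)
  from bij_betw_combine[OF assms(1) this] show "bij g" by auto
qed

lemma finite_fixing_outside:
  assumes "finite \<Omega>"
    and b: "\<And>g. g \<in> G \<Longrightarrow> bij_betw g \<Omega> \<Omega>"
    and o: "\<And>g x. g \<in> G \<Longrightarrow> x \<notin> \<Omega> \<Longrightarrow> g x = x"
  shows "finite G"
proof (rule inj_on_finite[where f = "\<lambda>g. restrict g \<Omega>"])
  show "inj_on (\<lambda>g. restrict g \<Omega>) G"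
  proof (rule inj_onI, rule ext)
    fix g h x assume "g \<in> G" "h \<in> G" "restrict g \<Omega> = restrict h \<Omega>"
    then show "g x = h x" using o[of g x] o[of h x] by (cases "x \<in> \<Omega>") (auto dest: fun_cong[of _ _ x])
  qed
  show "(\<lambda>g. restrict g \<Omega>) ` G \<subseteq> \<Omega> \<rightarrow>\<^sub>E \<Omega>"
    by (auto intro: bij_betw_apply[OF b])
  show "finite (\<Omega> \<rightarrow>\<^sub>E \<Omega>)"
    using assms(1) by (simp add: finite_PiE)
qed

context
  fixes \<Omega> :: "'a set" and G :: "('a \<Rightarrow> 'a) set"
  assumes pg: "perm_group \<Omega> G"
begin

lemma perm_group_bij: "g \<in> G \<Longrightarrow> bij g"
  using pg by (intro bij_fixing_outside[of g \<Omega>]) (auto simp: perm_group_def)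

lemma perm_group_bij_betw: "g \<in> G \<Longrightarrow> bij_betw g \<Omega> \<Omega>"
  using pg by (auto simp: perm_group_def)

lemma perm_group_id: "id \<in> G"
  using pg by (auto simp: perm_group_def)

lemma perm_group_comp: "g \<in> G \<Longrightarrow> h \<in> G \<Longrightarrow> g \<circ> h \<in> G"
  using pg by (auto simp: perm_group_def)

lemma perm_group_inv: "g \<in> G \<Longrightarrow> inv_into UNIV g \<in> G"
  using pg by (auto simp: perm_group_def)

lemma perm_group_outside: "g \<in> G \<Longrightarrow> x \<notin> \<Omega> \<Longrightarrow> g x = x"
  using pg by (auto simp: perm_group_def)

lemma perm_group_in: "g \<in> G \<Longrightarrow> x \<in> \<Omega> \<Longrightarrow> g x \<in> \<Omega>"
  using perm_group_bij_betw by (auto simp: bij_betw_def)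

lemma perm_group_inv_f: "g \<in> G \<Longrightarrow> inv_into UNIV g (g x) = x"
  using perm_group_bij by (simp add: bij_is_inj)

lemma perm_group_f_inv: "g \<in> G \<Longrightarrow> g (inv_into UNIV g x) = x"
  using perm_group_bij by (simp add: bij_is_surj surj_f_inv_f)

lemma perm_group_eqI:
  assumes "g \<in> G" "h \<in> G" "\<And>x. x \<in> \<Omega> \<Longrightarrow> g x = h x"
  shows "g = h"
proof
  fix x show "g x = h x"
    using assms perm_group_outside[of g x] perm_group_outside[of h x] by (cases "x \<in> \<Omega>") auto
qed

lemma perm_group_finite: "finite \<Omega> \<Longrightarrow> finite G"
  using pg by (intro finite_fixing_outside[of \<Omega>]) (auto simp: perm_group_def)

lemma perm_group_monoid_group: "group (perm_group_monoid G)"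
proof (rule groupI)
  fix x assume "x \<in> carrier (perm_group_monoid G)"
  then show "\<exists>y\<in>carrier (perm_group_monoid G).
      y \<otimes>\<^bsub>perm_group_monoid G\<^esub> x = \<one>\<^bsub>perm_group_monoid G\<^esub>"
    using perm_group_inv perm_group_bij
    by (intro bexI[of _ "inv_into UNIV x"]) (auto simp: perm_group_monoid_def bij_is_inj)
qed (auto simp: perm_group_monoid_def perm_group_comp perm_group_id o_assoc)

lemma perm_group_monoid_inv:
  assumes "g \<in> G" shows "inv\<^bsub>perm_group_monoid G\<^esub> g = inv_into UNIV g"
proof (rule group.inv_equality[OF perm_group_monoid_group])
  show "inv_into UNIV g \<otimes>\<^bsub>perm_group_monoid G\<^esub> g = \<one>\<^bsub>perm_group_monoid G\<^esub>"
    using perm_group_bij[OF assms] by (auto simp: perm_group_monoid_def bij_is_inj)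
qed (use assms perm_group_inv in \<open>auto simp: perm_group_monoid_def\<close>)

end

lemma perm_group_monoid_pow: "g [^]\<^bsub>perm_group_monoid G\<^esub> (n::nat) = g ^^ n"
  by (induction n) (simp_all add: perm_group_monoid_def funpow_Suc_right nat_pow_def del: funpow.simps(2))

text \<open>Left multiplication by \<open>g\<close> is an injective self-map of the finite set
  \<open>G\<close>, hence reaches \<open>id\<close>; so closure under composition already provides
  inverses. All groups built below are recognized this way.\<close>

lemma perm_group_finiteI:
  assumes "finite \<Omega>"
    and b: "\<And>g. g \<in> G \<Longrightarrow> bij_betw g \<Omega> \<Omega>"
    and o: "\<And>g x. g \<in> G \<Longrightarrow> x \<notin> \<Omega> \<Longrightarrow> g x = x"
    and i: "id \<in> G"
    and c: "\<And>g h. g \<in> G \<Longrightarrow> h \<in> G \<Longrightarrow> g \<circ> h \<in> G"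
  shows "perm_group \<Omega> G"
proof -
  have bij: "bij g" if "g \<in> G" for g using bij_fixing_outside[OF b[OF that] o[OF that]] .
  have fin: "finite G" using assms(1) b o by (rule finite_fixing_outside)
  have "inv_into UNIV g \<in> G" if g: "g \<in> G" for g
  proof -
    have "inj_on (\<lambda>h. g \<circ> h) G"
      using bij[OF g] by (auto simp: inj_on_def bij_def fun_eq_iff)
    moreover have "(\<lambda>h. g \<circ> h) ` G \<subseteq> G" using c g by auto
    ultimately have "(\<lambda>h. g \<circ> h) ` G = G"
      using fin by (simp add: endo_inj_surj)
    then obtain h where h: "h \<in> G" "g \<circ> h = id" using i by (metis imageE)
    have "inv_into UNIV g = h"
      using h(2) bij[OF g] by (metis bij_is_inj comp_id inv_o_cancel o_assoc id_comp)
    with h show ?thesis by simp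
  qed
  with b o i c show ?thesis by (auto simp: perm_group_def)
qed

definition orbital :: "('a \<Rightarrow> 'a) set \<Rightarrow> 'a \<Rightarrow> 'a \<Rightarrow> ('a \<times> 'a) set" where
  "orbital G a b = {(g a, g b) | g. g \<in> G}"

lemma Inv_orbital: "Inv \<Omega> G = {orbital G a b | a b. a \<in> \<Omega> \<and> b \<in> \<Omega>}"
  by (auto simp: Inv_def orbital_def)

context
  fixes \<Omega> :: "'a set" and G :: "('a \<Rightarrow> 'a) set"
  assumes pg: "perm_group \<Omega> G"
begin

lemma orbital_self: "(a, b) \<in> orbital G a b"
  using perm_group_id[OF pg] unfolding orbital_def by (auto intro!: exI[of _ id])

lemma orbital_image: "g \<in> G \<Longrightarrow> (x, y) \<in> orbital G a b \<Longrightarrow> (g x, g y) \<in> orbital G a b"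
  unfolding orbital_def by clarsimp (metis comp_apply perm_group_comp[OF pg])

lemma orbital_eq:
  assumes "(x, y) \<in> orbital G a b" shows "orbital G x y = orbital G a b"
proof -
  obtain g where g: "g \<in> G" "x = g a" "y = g b" using assms by (auto simp: orbital_def)
  have "(a, b) \<in> orbital G x y"
    unfolding orbital_def using g perm_group_inv[OF pg g(1)] perm_group_inv_f[OF pg g(1)]
    by (auto intro!: exI[of _ "inv_into UNIV g"])
  with assms show ?thesis
    by (auto simp: orbital_def) (metis comp_apply perm_group_comp[OF pg])+
qed

lemma coherent_config_Inv:
  assumes "finite \<Omega>" shows "coherent_config \<Omega> (Inv \<Omega> G)"
  unfolding coherent_config_def
proof (intro conjI ballI impI)
  show "\<Union> (Inv \<Omega> G) = \<Omega> \<times> \<Omega>"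
  proof
    show "\<Union> (Inv \<Omega> G) \<subseteq> \<Omega> \<times> \<Omega>"
      by (auto simp: Inv_def perm_group_in[OF pg])
    show "\<Omega> \<times> \<Omega> \<subseteq> \<Union> (Inv \<Omega> G)"
      unfolding Inv_orbital using orbital_self by fast
  qed
  show "\<exists>S0\<subseteq>Inv \<Omega> G. \<Union> S0 = Id_on \<Omega>"
  proof (intro exI conjI)
    show "{orbital G a a | a. a \<in> \<Omega>} \<subseteq> Inv \<Omega> G" unfolding Inv_orbital by blast
    show "\<Union> {orbital G a a | a. a \<in> \<Omega>} = Id_on \<Omega>"
    proof
      show "\<Union> {orbital G a a | a. a \<in> \<Omega>} \<subseteq> Id_on \<Omega>"
        using perm_group_in[OF pg] by (auto simp: orbital_def)
      show "Id_on \<Omega> \<subseteq> \<Union> {orbital G a a | a. a \<in> \<Omega>}"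
        using orbital_self by fast
    qed
  qed
next
  fix s assume s: "s \<in> Inv \<Omega> G"
  then obtain a b where ab: "s = orbital G a b" "a \<in> \<Omega>" "b \<in> \<Omega>" by (auto simp: Inv_orbital)
  show "s \<noteq> {}" using ab orbital_self by auto
  have "converse s = orbital G b a" using ab by (auto simp: orbital_def)
  then show "converse s \<in> Inv \<Omega> G" using ab by (auto simp: Inv_orbital)
next
  fix s s' assume s: "s \<in> Inv \<Omega> G" "s' \<in> Inv \<Omega> G" "s \<noteq> s'"
  then obtain a b c d where "s = orbital G a b" "s' = orbital G c d" by (auto simp: Inv_orbital)
  with s(3) show "s \<inter> s' = {}"
    using orbital_eq by (metis disjoint_iff surj_pair)
next
  fix r s t x y
  assume r: "r \<in> Inv \<Omega> G" and s: "s \<in> Inv \<Omega> G" and t: "t \<in> Inv \<Omega> G" and x: "x \<in> t" and y: "y \<in> t"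
  obtain a b where ab: "t = orbital G a b" using t by (auto simp: Inv_orbital)
  have "orbital G (fst x) (snd x) = t"
    using x ab orbital_eq[of "fst x" "snd x" a b] by simp
  with y obtain g where g: "g \<in> G" "fst y = g (fst x)" "snd y = g (snd x)"
    by (auto simp: orbital_def)
  have im: "(h u, h v) \<in> q" if "q \<in> Inv \<Omega> G" "(u, v) \<in> q" "h \<in> G" for h u v q
    using that orbital_image by (auto simp: Inv_orbital)
  let ?h = "inv_into UNIV g"
  have h: "?h \<in> G" "\<And>x. ?h (g x) = x" "\<And>x. g (?h x) = x"
    using perm_group_inv[OF pg g(1)] perm_group_inv_f[OF pg g(1)] perm_group_f_inv[OF pg g(1)] by auto
  \<comment> \<open>The group element carrying \<open>x\<close> to \<open>y\<close> carries the
    intermediate points of \<open>x\<close> to those of \<open>y\<close>, because \<open>r\<close>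
    and \<open>s\<close> are invariant.\<close>
  have "bij_betw g {c. (fst x, c) \<in> r \<and> (c, snd x) \<in> s} {c. (fst y, c) \<in> r \<and> (c, snd y) \<in> s}"
  proof (rule bij_betw_byWitness[where f' = ?h])
    show "g ` {c. (fst x, c) \<in> r \<and> (c, snd x) \<in> s} \<subseteq> {c. (fst y, c) \<in> r \<and> (c, snd y) \<in> s}"
      using im[OF r _ g(1)] im[OF s _ g(1)] g by auto
    show "?h ` {c. (fst y, c) \<in> r \<and> (c, snd y) \<in> s} \<subseteq> {c. (fst x, c) \<in> r \<and> (c, snd x) \<in> s}"
      using im[OF r _ h(1)] im[OF s _ h(1)] g h by fastforce
  qed (use h in auto)
  then show "card {c. (fst x, c) \<in> r \<and> (c, snd x) \<in> s} = card {c. (fst y, c) \<in> r \<and> (c, snd y) \<in> s}"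
    by (rule bij_betw_same_card)
qed (rule assms)

lemma is_scheme_Inv:
  assumes "finite \<Omega>" "transitive_group \<Omega> G" shows "is_scheme \<Omega> (Inv \<Omega> G)"
proof -
  obtain a where a: "a \<in> \<Omega>" using assms by (auto simp: transitive_group_def)
  have "orbital G a a = Id_on \<Omega>"
    using assms a perm_group_in[OF pg] by (auto simp: orbital_def Id_on_def transitive_group_def) metis
  then have "Id_on \<Omega> \<in> Inv \<Omega> G" using a by (auto simp: Inv_orbital)
  then show ?thesis using coherent_config_Inv assms by (auto simp: is_scheme_def)
qed

text \<open>An orbital through \<open>(a, b)\<close> equals its converse exactly when it also
  contains \<open>(b, a)\<close>, that is, when some element of \<open>G\<close> swaps
  \<open>a\<close> and \<open>b\<close>.\<close>

lemma antisymmetric_Inv_iff: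
  "antisymmetric_cc \<Omega> (Inv \<Omega> G) \<longleftrightarrow>
    (\<forall>a\<in>\<Omega>. \<forall>b\<in>\<Omega>. \<forall>g\<in>G. g a = b \<and> g b = a \<longrightarrow> a = b)"
proof safe
  fix a g assume as: "antisymmetric_cc \<Omega> (Inv \<Omega> G)" and a: "a \<in> \<Omega>" "g a \<in> \<Omega>" "g \<in> G" "g (g a) = a"
  have "(g a, a) \<in> orbital G a (g a)"
    using a by (auto simp: orbital_def intro!: exI[of _ g])
  then have "orbital G (g a) a = orbital G a (g a)" by (rule orbital_eq)
  moreover have "converse (orbital G a (g a)) = orbital G (g a) a" by (auto simp: orbital_def)
  ultimately have "orbital G a (g a) \<subseteq> Id_on \<Omega>"
    using as a unfolding antisymmetric_cc_def Inv_orbital by blast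
  then have "(a, g a) \<in> Id_on \<Omega>" by (rule subsetD[OF _ orbital_self])
  then show "a = g a" by auto
next
  assume sw: "\<forall>a\<in>\<Omega>. \<forall>b\<in>\<Omega>. \<forall>g\<in>G. g a = b \<and> g b = a \<longrightarrow> a = b"
  show "antisymmetric_cc \<Omega> (Inv \<Omega> G)"
    unfolding antisymmetric_cc_def
  proof (intro ballI impI subsetI)
    fix s z assume s: "s \<in> Inv \<Omega> G" "converse s = s" and z: "z \<in> s"
    obtain a b where ab: "s = orbital G a b" "a \<in> \<Omega>" "b \<in> \<Omega>" using s by (auto simp: Inv_orbital)
    have "(b, a) \<in> orbital G a b" using s(2) orbital_self[of a b] unfolding ab by blast
    then obtain g where "g \<in> G" "g a = b" "g b = a" by (auto simp: orbital_def)
    then have "a = b" using sw ab by blast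
    then show "z \<in> Id_on \<Omega>" using z ab perm_group_in[OF pg] by (auto simp: orbital_def)
  qed
qed

end

text \<open>An orbital of the larger group is invariant under the smaller one, hence is the union of
  the smaller orbitals of its pairs.\<close>

lemma is_fusion_Inv:
  assumes "finite \<Omega>" "perm_group \<Omega> G" "perm_group \<Omega> H" "G \<subseteq> H"
  shows "is_fusion \<Omega> (Inv \<Omega> H) (Inv \<Omega> G)"
  unfolding is_fusion_def
proof (intro conjI ballI)
  show "coherent_config \<Omega> (Inv \<Omega> H)" using assms by (intro coherent_config_Inv)
  fix s assume s: "s \<in> Inv \<Omega> H"
  then obtain a b where ab: "s = orbital H a b" "a \<in> \<Omega>" "b \<in> \<Omega>" by (auto simp: Inv_orbital)
  have sub: "s \<subseteq> \<Omega> \<times> \<Omega>" using ab perm_group_in[OF assms(3)] by (auto simp: orbital_def)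
  have "\<Union> {orbital G x y | x y. (x, y) \<in> s} = s"
  proof
    show "\<Union> {orbital G x y | x y. (x, y) \<in> s} \<subseteq> s"
      using assms(4) orbital_image[OF assms(3)] by (fastforce simp: ab orbital_def[of G])
    show "s \<subseteq> \<Union> {orbital G x y | x y. (x, y) \<in> s}"
      using orbital_self[OF assms(2)] by fast
  qed
  moreover have "{orbital G x y | x y. (x, y) \<in> s} \<subseteq> Inv \<Omega> G"
    using sub by (auto simp: Inv_orbital)
  ultimately show "\<exists>S0\<subseteq>Inv \<Omega> G. \<Union> S0 = s" by blast
qed

section \<open>Transport of permutation groups along bijections\<close>

definition transport :: "'a set \<Rightarrow> ('a \<Rightarrow> 'b) \<Rightarrow> ('a \<Rightarrow> 'a) \<Rightarrow> 'b \<Rightarrow> 'b" where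
  "transport A f g = (\<lambda>y. if y \<in> f ` A then f (g (inv_into A f y)) else y)"

lemma transport_apply: "inj_on f A \<Longrightarrow> x \<in> A \<Longrightarrow> transport A f g (f x) = f (g x)"
  by (auto simp: transport_def)

lemma transport_comp:
  assumes "inj_on f A" "h ` A \<subseteq> A"
  shows "transport A f g \<circ> transport A f h = transport A f (g \<circ> h)"
proof
  fix y show "(transport A f g \<circ> transport A f h) y = transport A f (g \<circ> h) y"
  proof (cases "y \<in> f ` A")
    case True
    then obtain x where "x \<in> A" "y = f x" by blast
    then show ?thesis using assms by (auto simp: transport_apply image_subset_iff)
  qed (auto simp: transport_def)
qed

context
  fixes A :: "'a set" and G :: "('a \<Rightarrow> 'a) set" and f :: "'a \<Rightarrow> 'b" and B :: "'b set"
  assumes fin: "finite A" and pg: "perm_group A G" and bij: "bij_betw f A B"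
begin

lemma transport_inj: "inj_on f A" and transport_img: "f ` A = B"
  using bij by (auto simp: bij_betw_def)

lemma perm_group_transport: "perm_group B (transport A f ` G)"
proof (rule perm_group_finiteI)
  show "finite B" using fin bij by (metis bij_betw_finite)
  show "bij_betw g B B" if gG: "g \<in> transport A f ` G" for g
  proof -
    obtain h where h: "h \<in> G" "g = transport A f h" using gG by blast
    have "bij_betw (f \<circ> h \<circ> inv_into A f) B B"
      by (rule bij_betw_trans[OF bij_betw_inv_into[OF bij]
            bij_betw_trans[OF perm_group_bij_betw[OF pg h(1)] bij], unfolded o_assoc])
    then show ?thesis
      by (rule bij_betw_cong[THEN iffD1, rotated]) (auto simp: h transport_def transport_img)
  qed
  show "g x = x" if "g \<in> transport A f ` G" "x \<notin> B" for g x
    using that by (auto simp: transport_def transport_img)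
  have "transport A f id = id"
    using transport_inj by (auto simp: transport_def fun_eq_iff f_inv_into_f)
  then show "id \<in> transport A f ` G" using perm_group_id[OF pg] by force
  fix g h assume "g \<in> transport A f ` G" "h \<in> transport A f ` G"
  then obtain g' h' where "g' \<in> G" "h' \<in> G" "g = transport A f g'" "h = transport A f h'" by blast
  then show "g \<circ> h \<in> transport A f ` G"
    using transport_comp[OF transport_inj, of h' g'] perm_group_in[OF pg] perm_group_comp[OF pg]
    by (auto simp: image_subset_iff)
qed

lemma Inv_transport:
  "Inv B (transport A f ` G) = (\<lambda>s. (\<lambda>(a, b). (f a, f b)) ` s) ` Inv A G"
proof -
  have *: "orbital (transport A f ` G) (f a) (f b) = (\<lambda>(a, b). (f a, f b)) ` orbital G a b"
    if "a \<in> A" "b \<in> A" for a b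
  proof -
    have "orbital (transport A f ` G) (f a) (f b) = (\<lambda>g. (transport A f g (f a), transport A f g (f b))) ` G"
      by (auto simp: orbital_def)
    also have "\<dots> = (\<lambda>g. (f (g a), f (g b))) ` G"
      using that by (simp add: transport_apply[OF transport_inj])
    also have "\<dots> = (\<lambda>(a, b). (f a, f b)) ` orbital G a b"
      by (auto simp: orbital_def image_iff)
    finally show ?thesis .
  qed
  show ?thesis
    unfolding Inv_orbital transport_img[symmetric]
    using * by (auto simp: image_iff) (metis, blast)
qed

lemma solvable_transport:
  assumes "solvable_perm_group G" shows "solvable_perm_group (transport A f ` G)"
proof -
  interpret G: group "perm_group_monoid G" by (rule perm_group_monoid_group[OF pg])
  interpret H: group "perm_group_monoid (transport A f ` G)"
    by (rule perm_group_monoid_group[OF perm_group_transport])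
  interpret group_hom "perm_group_monoid G" "perm_group_monoid (transport A f ` G)" "transport A f"
  proof
    show "transport A f \<in> hom (perm_group_monoid G) (perm_group_monoid (transport A f ` G))"
      using perm_group_in[OF pg]
      by (auto simp: hom_def perm_group_monoid_def transport_comp[OF transport_inj] image_subset_iff)
  qed
  show ?thesis
    using assms surj_hom_imp_solvable by (auto simp: solvable_perm_group_def perm_group_monoid_def)
qed

lemma primitive_transport:
  assumes "primitive_group A G" shows "primitive_group B (transport A f ` G)"
  unfolding primitive_group_def
proof (intro conjI allI impI)
  note app = transport_apply[OF transport_inj]
  have tr: "transitive_group A G" using assms by (simp add: primitive_group_def)
  show "transitive_group B (transport A f ` G)"
    unfolding transitive_group_def
  proof (intro conjI ballI)
    show "B \<noteq> {}" using tr transport_img by (auto simp: transitive_group_def)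
    fix x y assume "x \<in> B" "y \<in> B"
    then obtain a b where ab: "a \<in> A" "b \<in> A" "x = f a" "y = f b" using transport_img by blast
    then obtain g where "g \<in> G" "g a = b"
      using tr unfolding transitive_group_def by blast
    then show "\<exists>g\<in>transport A f ` G. g x = y" using ab app by auto
  qed
  fix C assume C: "C \<subseteq> B \<and> C \<noteq> {} \<and> (\<forall>g\<in>transport A f ` G. g ` C = C \<or> g ` C \<inter> C = {})"
  define D where "D = inv_into A f ` C"
  have fD: "f ` D = C" 
    using C transport_img inv_into_f_f[OF transport_inj] by (simp add: D_def image_inv_into_cancel)
  have DA: "D \<subseteq> A" using C transport_img by (auto simp: D_def inv_into_into)
  have im: "transport A f g ` C = f ` (g ` D)" if "g \<in> G" for g
  proof -
    have "transport A f g ` f ` D = (\<lambda>x. f (g x)) ` D"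
      unfolding image_image by (rule image_cong[OF refl]) (use DA app in auto)
    then show ?thesis by (simp add: fD image_image)
  qed
  have "g ` D = D \<or> g ` D \<inter> D = {}" if g: "g \<in> G" for g
  proof -
    have gA: "g ` D \<subseteq> A" using DA perm_group_in[OF pg g] by auto
    have "f ` (g ` D) = f ` D \<or> f ` (g ` D) \<inter> f ` D = {}"
      using C im[OF g] g unfolding fD by blast
    then show ?thesis
      using inj_on_image_eq_iff[OF transport_inj gA DA] inj_on_image_Int[OF transport_inj gA DA]
        image_is_empty by metis
  qed
  moreover have "D \<noteq> {}" using C D_def by auto
  ultimately have "card D = 1 \<or> D = A"
    using assms DA by (auto simp: primitive_group_def)
  then show "card C = 1 \<or> C = B"
    using fD transport_img card_image[OF inj_on_subset[OF transport_inj DA]] by auto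
qed

end

lemma antisymmetric_transport:
  assumes "finite A" "perm_group A G" "bij_betw f A B" "antisymmetric_cc A (Inv A G)"
  shows "antisymmetric_cc B (Inv B (transport A f ` G))"
  unfolding antisymmetric_Inv_iff[OF perm_group_transport[OF assms(1-3)]]
proof (intro ballI impI)
  fix x y h assume xy: "x \<in> B" "y \<in> B" and h: "h \<in> transport A f ` G" and sw: "h x = y \<and> h y = x"
  have f: "inj_on f A" "f ` A = B" using assms(3) by (auto simp: bij_betw_def)
  obtain g where g: "g \<in> G" "h = transport A f g" using h by blast
  obtain u v where uv: "u \<in> A" "v \<in> A" "x = f u" "y = f v" using xy f(2) by blast
  have "f (g u) = f v" "f (g v) = f u"
    using sw uv transport_apply[OF f(1)] by (simp_all add: g)
  then have "g u = v \<and> g v = u"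
    using inj_onD[OF f(1)] uv(1,2) perm_group_in[OF assms(2) g(1)] by blast
  then have "u = v"
    using iffD1[OF antisymmetric_Inv_iff[OF assms(2)] assms(4), rule_format, OF uv(1,2) g(1)] by simp
  then show "x = y" using uv by simp
qed

section \<open>Primitive solvable groups are affine\<close>

text \<open>Conjugation respects powers; this is what makes the elements killed by \<open>p\<close>
  in an abelian normal subgroup a normal subgroup again.\<close>

lemma (in group) conj_pow:
  assumes "x \<in> carrier G" "h \<in> carrier G"
  shows "(x \<otimes> h \<otimes> inv x) [^] (n::nat) = x \<otimes> h [^] n \<otimes> inv x"
proof (induction n)
  case (Suc n)
  have "(x \<otimes> h \<otimes> inv x) [^] Suc n = x \<otimes> h [^] n \<otimes> inv x \<otimes> (x \<otimes> h \<otimes> inv x)"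
    using Suc by simp
  also have "\<dots> = x \<otimes> h [^] n \<otimes> (inv x \<otimes> x) \<otimes> h \<otimes> inv x"
    using assms by (simp only: m_assoc inv_closed m_closed nat_pow_closed)
  finally show ?case using assms by (simp add: m_assoc)
qed (use assms in simp)

lemma (in group) solvable_elementary_abelian_normal:
  assumes fin: "finite (carrier G)" and solv: "solvable G" and nt: "carrier G \<noteq> {\<one>}"
  obtains N and p :: nat where "prime p" "N \<lhd> G" "N \<noteq> {\<one>}"
    "\<And>x y. x \<in> N \<Longrightarrow> y \<in> N \<Longrightarrow> x \<otimes> y = y \<otimes> x" "\<And>x. x \<in> N \<Longrightarrow> x [^] p = \<one>"
proof -
  define D where "D n = (derived G ^^ n) (carrier G)" for n
  define n where "n = (LEAST n. D n = {\<one>})"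
  have "\<exists>n. D n = {\<one>}"
    using solvable_imp_trivial_derived_seq solv by (auto simp: D_def solvable_def)
  then have n1: "D n = {\<one>}" unfolding n_def by (rule LeastI_ex)
  with nt have "n \<noteq> 0" by (metis D_def funpow_0)
  then obtain m where m: "n = Suc m" using not0_implies_Suc by blast
  define A where "A = D m"
  have Ant: "A \<noteq> {\<one>}" using not_less_Least[of m "\<lambda>n. D n = {\<one>}"] m by (auto simp: A_def n_def)
  have dA: "derived G A = {\<one>}" using n1 by (simp add: m A_def D_def)
  have "D i \<lhd> G" for i
    by (induction i) (auto simp: D_def normal_self intro: derived_is_normal)
  then have An: "A \<lhd> G" by (simp add: A_def)
  then have As: "subgroup A G" by (rule normal_imp_subgroup)
  have Ac: "\<And>x. x \<in> A \<Longrightarrow> x \<in> carrier G" using As by (rule subgroup.mem_carrier)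
  have comm: "x \<otimes> y = y \<otimes> x" if "x \<in> A" "y \<in> A" for x y
  proof -
    have "x \<otimes> y \<otimes> inv x \<otimes> inv y \<in> derived_set G A" using that by blast
    then have "x \<otimes> y \<otimes> inv x \<otimes> inv y \<in> derived G A" unfolding derived_def by (rule generate.incl)
    then have "x \<otimes> y \<otimes> inv x \<otimes> inv y = \<one>" using dA by simp
    then show ?thesis
      using that Ac by (metis inv_closed inv_equality inv_inv m_closed inv_solve_right)
  qed
  obtain a where a: "a \<in> A" "a \<noteq> \<one>" using Ant subgroup.one_closed[OF As] by blast
  have "ord a \<noteq> 1" using a Ac ord_eq_1 by auto
  then obtain p where p: "prime p" "p dvd ord a" using prime_factor_nat by blast
  \<comment> \<open>A power of \<open>a\<close> of order \<open>p\<close>; it witnesses that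
    \<open>N\<close> below is nontrivial.\<close>
  define c where "c = a [^] (ord a div p)"
  have "ord a > 0" using a Ac fin ord_ge_1 by fastforce
  have c: "c \<in> A" 
  proof -
    have "a [^] i \<in> A" for i :: nat
      by (induction i) (use a As in \<open>auto simp: subgroup.one_closed subgroup.m_closed\<close>)
    then show ?thesis by (simp add: c_def)
  qed
  have cp: "c [^] p = \<one>"
    using a Ac p unfolding c_def by (simp add: nat_pow_pow)
  have c1: "c \<noteq> \<one>"
  proof
    assume "c = \<one>"
    then have "ord a dvd ord a div p" using a Ac by (simp add: c_def pow_eq_id)
    moreover have "ord a div p < ord a" using \<open>ord a > 0\<close> p prime_gt_1_nat by simp
    moreover have "ord a div p > 0" using \<open>ord a > 0\<close> p by (simp add: dvd_div_eq_0_iff dvd_imp_le div_greater_zero_iff prime_gt_0_nat)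
    ultimately show False by (auto dest: dvd_imp_le)
  qed
  \<comment> \<open>Closed under products because \<open>A\<close> is abelian, and stable under
    conjugation because the condition is.\<close>
  define N where "N = {x \<in> A. x [^] p = \<one>}"
  have "subgroup N G"
  proof (rule subgroupI)
    show "N \<subseteq> carrier G" using Ac by (auto simp: N_def)
    show "N \<noteq> {}" using c cp by (auto simp: N_def)
    fix x assume x: "x \<in> N"
    then show "inv x \<in> N" using As Ac by (auto simp: N_def subgroup.m_inv_closed nat_pow_inv)
    fix y assume y: "y \<in> N"
    then have "(x \<otimes> y) [^] p = \<one>"
      using x Ac comm pow_mult_distrib[of x y p] by (auto simp: N_def)
    then show "x \<otimes> y \<in> N" using x y As by (auto simp: N_def subgroup.m_closed)
  qed
  moreover have "x \<otimes> h \<otimes> inv x \<in> N" if "x \<in> carrier G" "h \<in> N" for x h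
    using that Ac normal.inv_op_closed2[OF An] by (auto simp: N_def conj_pow)
  ultimately have "N \<lhd> G" by (auto simp: normal_inv_iff)
  moreover have "N \<noteq> {\<one>}" using c c1 cp by (auto simp: N_def)
  ultimately show thesis using that[OF p(1)] comm by (auto simp: N_def)
qed

text \<open>A coordinate-free form of "\<open>G\<close> lies in AGL(d,p), contains all translations
  and has an irreducible zero stabilizer". Prime exponent makes subgroups and subspaces the same, so
  irreducibility can be stated with subgroups.\<close>

locale affine_perm_group = comm_group V for V :: "'a monoid" (structure) +
  fixes G :: "('a \<Rightarrow> 'a) set" and p :: nat
  assumes finite_carrier: "finite (carrier V)"
    and perm: "perm_group (carrier V) G"
    and prime: "prime p"
    and exponent: "x \<in> carrier V \<Longrightarrow> x [^] p = \<one>"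
    and translation: "x \<in> carrier V \<Longrightarrow> \<exists>g\<in>G. \<forall>y\<in>carrier V. g y = x \<otimes> y"
    and stabilizer_mult: "g \<in> G \<Longrightarrow> g \<one> = \<one> \<Longrightarrow> x \<in> carrier V \<Longrightarrow> y \<in> carrier V \<Longrightarrow>
      g (x \<otimes> y) = g x \<otimes> g y"
    and irreducible: "subgroup W V \<Longrightarrow> (\<And>g. g \<in> G \<Longrightarrow> g \<one> = \<one> \<Longrightarrow> g ` W \<subseteq> W) \<Longrightarrow>
      W = {\<one>} \<or> W = carrier V"

text \<open>The regular normal subgroup \<open>N\<close> is identified with \<Omega> by evaluation
  at a base point \<open>z\<close>. The stabilizer of \<open>z\<close> then acts as it does on
  \<open>N\<close> by conjugation, hence by automorphisms, and its invariant subgroups turn out to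
  be blocks of \<open>G\<close>.\<close>

lemma primitive_solvable_affine:
  fixes \<Omega> :: "'a set" and G :: "('a \<Rightarrow> 'a) set"
  assumes fin: "finite \<Omega>" and pg: "perm_group \<Omega> G" and prim: "primitive_group \<Omega> G"
    and solv: "solvable_perm_group G"
  obtains V p where "carrier V = \<Omega>" "affine_perm_group V G p"
proof (cases "\<exists>x. \<Omega> = {x}")
  case True
  then obtain x where x: "\<Omega> = {x}" by blast
  \<comment> \<open>On one point \<open>G\<close> is trivial and has no nontrivial normal subgroup;
    the trivial group is used, with 2 as an arbitrary prime.\<close>
  let ?V = "\<lparr>carrier = \<Omega>, monoid.mult = (\<lambda>_ _. x), one = x\<rparr>"
  have "affine_perm_group ?V G 2"
  proof (intro affine_perm_group.intro affine_perm_group_axioms.intro)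
    show V: "comm_group ?V" using x by (intro comm_groupI) auto
    interpret V: comm_group ?V by (rule V)
    show "y [^]\<^bsub>?V\<^esub> (2::nat) = \<one>\<^bsub>?V\<^esub>" if "y \<in> carrier ?V" for y
      using V.nat_pow_closed[OF that, of 2] x by simp
    show "\<exists>g\<in>G. \<forall>y\<in>carrier ?V. g y = y' \<otimes>\<^bsub>?V\<^esub> y" if "y' \<in> carrier ?V" for y'
      using perm_group_id[OF pg] x by (intro bexI[of _ id]) auto
    show "W = {\<one>\<^bsub>?V\<^esub>} \<or> W = carrier ?V" if "subgroup W ?V" for W
      using that x by (auto simp: subgroup_def)
  qed (use fin pg x perm_group_in[OF pg] in auto)
  then show ?thesis using that[of ?V 2] by simp
next
  case False
  have tr: "transitive_group \<Omega> G" using prim by (simp add: primitive_group_def)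
  then have "\<Omega> \<noteq> {}" by (simp add: transitive_group_def)
  then obtain z where z: "z \<in> \<Omega>" by blast
  define M where "M = perm_group_monoid G"
  have M: "carrier M = G" "monoid.mult M = (\<circ>)" "one M = id"
    by (auto simp: M_def perm_group_monoid_def)
  interpret M: group M unfolding M_def by (rule perm_group_monoid_group[OF pg])
  have "G \<noteq> {id}"
  proof
    assume "G = {id}"
    then have "\<Omega> = {z}" using tr z by (auto simp: transitive_group_def)
    with False show False by blast
  qed
  then obtain N p where p: "prime (p::nat)" and N: "N \<lhd> M" "N \<noteq> {id}"
    and comm: "\<And>x y. x \<in> N \<Longrightarrow> y \<in> N \<Longrightarrow> x \<circ> y = y \<circ> x"
    and exp: "\<And>x. x \<in> N \<Longrightarrow> x [^]\<^bsub>M\<^esub> p = id"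
    using M.solvable_elementary_abelian_normal perm_group_finite[OF pg fin] solv
    by (metis (full_types) M M_def solvable_perm_group_def)
  have Ns: "subgroup N M" using N(1) by (rule normal_imp_subgroup)
  have NG: "\<And>n. n \<in> N \<Longrightarrow> n \<in> G" using subgroup.subset[OF Ns] M by auto
  have Nid: "id \<in> N" using subgroup.one_closed[OF Ns] M by simp
  have Nc: "\<And>n n'. n \<in> N \<Longrightarrow> n' \<in> N \<Longrightarrow> n \<circ> n' \<in> N" using subgroup.m_closed[OF Ns] M by simp
  have Ninv: "inv_into UNIV n \<in> N" if "n \<in> N" for n
    using subgroup.m_inv_closed[OF Ns that] perm_group_monoid_inv[OF pg NG[OF that]] by (simp add: M_def)
  have conj: "g \<circ> n \<circ> inv_into UNIV g \<in> N" if "g \<in> G" "n \<in> N" for g n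
    using normal.inv_op_closed2[OF N(1), of g n] that M perm_group_monoid_inv[OF pg, of g] by (simp add: M_def)
  have conj': "\<exists>n'\<in>N. \<forall>x. g (n x) = n' (g x)" if "g \<in> G" "n \<in> N" for g n
    by (rule bexI[OF _ conj[OF that]]) (simp add: perm_group_inv_f[OF pg that(1)])
  have conj'': "\<exists>n'\<in>N. \<forall>x. n (g x) = g (n' x)" if gn: "g \<in> G" "n \<in> N" for g n
  proof -
    obtain n' where "n' \<in> N" "\<forall>x. inv_into UNIV g (n x) = n' (inv_into UNIV g x)"
      using conj'[OF perm_group_inv[OF pg gn(1)] gn(2)] by blast
    then show ?thesis
      by (metis perm_group_inv_f[OF pg gn(1)] perm_group_f_inv[OF pg gn(1)])
  qed
  \<comment> \<open>Orbits of a normal subgroup are permuted by \<open>G\<close>, hence are blocks.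
    The orbit of a point moved by \<open>n0\<close> has more than one element, so primitivity makes
    it all of \<Omega>.\<close>
  define orb where "orb x = (\<lambda>n. n x) ` N" for x
  have Oself: "x \<in> orb x" for x unfolding orb_def by (rule image_eqI[OF _ Nid]) simp
  have Oeq: "orb y = orb x" if yO: "y \<in> orb x" for x y
  proof -
    obtain n where n: "n \<in> N" "y = n x" using yO by (auto simp: orb_def)
    show ?thesis
    proof
      show "orb y \<subseteq> orb x"
        using image_eqI[OF _ Nc[OF _ n(1)], of _ "\<lambda>n. n x"] n(2) by (auto simp: orb_def)
      show "orb x \<subseteq> orb y"
      proof
        fix u assume "u \<in> orb x"
        then obtain n' where n': "n' \<in> N" "u = n' x" by (auto simp: orb_def)
        then have "u = (n' \<circ> inv_into UNIV n) y" using n perm_group_inv_f[OF pg NG[OF n(1)]] by simp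
        then show "u \<in> orb y" using Nc[OF n'(1) Ninv[OF n(1)]] unfolding orb_def by blast
      qed
    qed
  qed
  obtain n0 where n0: "n0 \<in> N" "n0 \<noteq> id" using N(2) Nid by blast
  then obtain x0 where x0: "n0 x0 \<noteq> x0" by (auto simp: fun_eq_iff)
  then have x0\<Omega>: "x0 \<in> \<Omega>" using perm_group_outside[OF pg NG[OF n0(1)]] by blast
  have O\<Omega>: "orb x0 \<subseteq> \<Omega>" using x0\<Omega> perm_group_in[OF pg] NG by (auto simp: orb_def)
  have gO: "g ` orb x = orb (g x)" if "g \<in> G" for g x
    using conj'[OF that] conj''[OF that] unfolding orb_def by (fastforce simp: image_iff)
  have "card (orb x0) = 1 \<or> orb x0 = \<Omega>"
  proof -
    have "g ` orb x0 = orb x0 \<or> g ` orb x0 \<inter> orb x0 = {}" if "g \<in> G" for g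
      using gO[OF that] Oeq by (metis disjoint_iff)
    moreover have "orb x0 \<noteq> {}" using Oself by blast
    ultimately show ?thesis using prim O\<Omega> unfolding primitive_group_def by blast
  qed
  moreover have "card (orb x0) \<noteq> 1"
  proof
    assume "card (orb x0) = 1"
    moreover have "n0 x0 \<in> orb x0" using n0(1) by (auto simp: orb_def)
    ultimately show False using Oself[of x0] x0 by (auto simp: card_1_singleton_iff)
  qed
  ultimately have "orb x0 = \<Omega>" by blast
  then have Oz: "orb z = \<Omega>" using Oeq z by blast
  \<comment> \<open>A transitive abelian group is regular: agreement at \<open>z\<close> spreads to
    \<open>k z\<close> because both maps commute with \<open>k\<close>.\<close>
  have reg: "n = n'" if n: "n \<in> N" "n' \<in> N" "n z = n' z" for n n'
  proof (rule perm_group_eqI[OF pg NG[OF n(1)] NG[OF n(2)]])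
    fix x assume "x \<in> \<Omega>"
    then obtain k where k: "k \<in> N" "x = k z" using Oz unfolding orb_def by blast
    have "n (k z) = k (n z)" "n' (k z) = k (n' z)" using comm[OF _ k(1)] n by (metis comp_apply)+
    then show "n x = n' x" using k n by simp
  qed
  define \<tau> where "\<tau> x = (THE n. n \<in> N \<and> n z = x)" for x
  have \<tau>: "\<tau> x \<in> N \<and> \<tau> x z = x" if x: "x \<in> \<Omega>" for x
  proof -
    obtain k where "k \<in> N" "x = k z" using Oz x unfolding orb_def by blast
    then have "\<exists>!n. n \<in> N \<and> n z = x" using reg by (intro ex1I[of _ k]) auto
    then show ?thesis unfolding \<tau>_def by (rule theI')
  qed
  have \<tau>eq: "\<tau> (n z) = n" if "n \<in> N" for n
    using \<tau>[OF perm_group_in[OF pg NG[OF that] z]] reg[OF _ that] by blast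
  have cl: "\<tau> x y \<in> \<Omega>" if "x \<in> \<Omega>" "y \<in> \<Omega>" for x y
    using perm_group_in[OF pg NG] \<tau> that by blast
  have \<tau>\<tau>: "\<tau> (\<tau> x y) = \<tau> x \<circ> \<tau> y" if "x \<in> \<Omega>" "y \<in> \<Omega>" for x y
    using \<tau>eq[OF Nc[of "\<tau> x" "\<tau> y"]] \<tau> that by simp
  \<comment> \<open>As \<open>\<tau> x y\<close> is the image of \<open>z\<close> under
    \<open>\<tau> x \<circ> \<tau> y\<close>, evaluation at \<open>z\<close> is an isomorphism from
    \<open>N\<close> onto \<open>V\<close>.\<close>
  define V where "V = \<lparr>carrier = \<Omega>, monoid.mult = \<tau>, one = z\<rparr>"
  have V: "carrier V = \<Omega>" "monoid.mult V = \<tau>" "one V = z" by (auto simp: V_def)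
  have \<tau>z: "\<tau> z = id" using \<tau>eq[OF Nid] by simp
  have \<tau>comm: "\<tau> x y = \<tau> y x" if "x \<in> \<Omega>" "y \<in> \<Omega>" for x y
    using comm[of "\<tau> x" "\<tau> y"] \<tau> that by (metis comp_apply)
  interpret V: comm_group V
  proof (rule comm_groupI, unfold V)
    fix x assume x: "x \<in> \<Omega>"
    have "inv_into UNIV (\<tau> x) \<in> N" using Ninv \<tau> x by blast
    then have "\<tau> (inv_into UNIV (\<tau> x) z) x = z" using \<tau>eq \<tau>[OF x] perm_group_inv_f[OF pg NG] by metis
    moreover have "inv_into UNIV (\<tau> x) z \<in> \<Omega>"
      using \<open>inv_into UNIV (\<tau> x) \<in> N\<close> NG perm_group_in[OF pg] z by blast
    ultimately show "\<exists>y\<in>\<Omega>. \<tau> y x = z" by blast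
  qed (use cl z \<tau>\<tau> \<tau>z \<tau>comm in auto)
  have "affine_perm_group V G p"
  proof (intro affine_perm_group.intro affine_perm_group_axioms.intro, unfold V)
    show "comm_group V" by (rule V.comm_group_axioms)
    fix x assume x: "x \<in> \<Omega>"
    have "x [^]\<^bsub>V\<^esub> n = (\<tau> x ^^ n) z \<and> x [^]\<^bsub>V\<^esub> n \<in> \<Omega>" for n :: nat
      by (induction n) (use V x cl \<tau>comm z in \<open>auto\<close>)
    then show "x [^]\<^bsub>V\<^esub> p = z"
      using exp[of "\<tau> x"] \<tau>[OF x] by (simp add: M_def perm_group_monoid_pow)
    show "\<exists>g\<in>G. \<forall>y\<in>\<Omega>. g y = \<tau> x y" using NG \<tau>[OF x] by blast
    fix g y assume g: "g \<in> G" "g z = z" and y: "y \<in> \<Omega>"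
    \<comment> \<open>The conjugate of \<open>\<tau> x\<close> by \<open>g\<close>. Since
      \<open>g\<close> fixes \<open>z\<close>, it sends \<open>z\<close> to \<open>g x\<close> and
      so must be \<open>\<tau> (g x)\<close>.\<close>
    obtain n' where n': "n' \<in> N" "\<And>u. g (\<tau> x u) = n' (g u)" using conj'[OF g(1)] \<tau>[OF x] by blast
    have "n' z = g x" using n'(2)[of z] g \<tau>[OF x] by simp
    then have "n' = \<tau> (g x)" using \<tau>eq[OF n'(1)] by simp
    then show "g (\<tau> x y) = \<tau> (g x) (g y)" using n' by simp
  next
    fix W assume W: "subgroup W V" and inv: "\<And>g. g \<in> G \<Longrightarrow> g z = z \<Longrightarrow> g ` W \<subseteq> W"
    have W\<Omega>: "W \<subseteq> \<Omega>" using subgroup.subset[OF W] V by simp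
    have finW: "finite W" using W\<Omega> fin finite_subset by blast
    have Wm: "\<tau> x y \<in> W" if "x \<in> W" "y \<in> W" for x y using subgroup.m_closed[OF W that] V by simp
    \<comment> \<open>Write \<open>g\<close> as the translation by \<open>a\<close> after an element
      of the stabilizer. If \<open>g\<close> takes some element of \<open>W\<close> into
      \<open>W\<close>, then \<open>a\<close> lies in \<open>W\<close>, and so \<open>g\<close>
      preserves \<open>W\<close>.\<close>
    have "g ` W = W \<or> g ` W \<inter> W = {}" if g: "g \<in> G" for g
    proof (rule disjCI)
      assume "\<not> g ` W \<inter> W = {}"
      then obtain w where w: "w \<in> W" "g w \<in> W" by blast
      define a where "a = g z"
      have a: "a \<in> \<Omega>" using perm_group_in[OF pg g z] by (simp add: a_def)
      let ?t = "inv_into UNIV (\<tau> a)"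
      have t: "\<tau> a \<in> G" "\<tau> a z = a" using \<tau>[OF a] NG by auto
      have k: "?t \<circ> g \<in> G" using perm_group_comp[OF pg perm_group_inv[OF pg t(1)] g] .
      have kz: "(?t \<circ> g) z = z" using t perm_group_inv_f[OF pg t(1), of z] by (simp add: a_def)
      have gk: "g u = \<tau> a ((?t \<circ> g) u)" for u using perm_group_f_inv[OF pg t(1)] by simp
      have kw: "(?t \<circ> g) u \<in> W" if "u \<in> W" for u using inv[OF k kz] that by blast
      have "a \<otimes>\<^bsub>V\<^esub> (?t \<circ> g) w \<in> W" by (metis V(2) gk w(2))
      then have "a \<otimes>\<^bsub>V\<^esub> (?t \<circ> g) w \<otimes>\<^bsub>V\<^esub> inv\<^bsub>V\<^esub> ((?t \<circ> g) w) \<in> W"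
        by (rule subgroup.m_closed[OF W _ subgroup.m_inv_closed[OF W kw[OF w(1)]]])
      moreover have "(?t \<circ> g) w \<in> carrier V" using kw[OF w(1)] W\<Omega> V by auto
      moreover have "a \<in> carrier V" using a V(1) by simp
      ultimately have aW: "a \<in> W" by (simp add: V.m_assoc del: comp_apply)
      have "g u \<in> W" if "u \<in> W" for u using Wm[OF aW kw[OF that]] by (metis gk)
      then have "g ` W \<subseteq> W" by blast
      then show "g ` W = W"
        using finW perm_group_bij[OF pg g] by (metis bij_is_inj endo_inj_surj inj_on_subset subset_UNIV)
    qed
    moreover have zW: "z \<in> W" using subgroup.one_closed[OF W] V by simp
    ultimately have "card W = 1 \<or> W = \<Omega>" using prim W\<Omega> unfolding primitive_group_def by blast
    then show "W = {z} \<or> W = \<Omega>" using zW by (auto simp: card_1_singleton_iff)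
  qed (use fin pg p in auto)
  then show ?thesis using that V by blast
qed

section \<open>Direct decompositions of abelian groups\<close>

text \<open>Independence is required at the identity only; uniqueness of components in general is
  \<open>direct_sum_inj\<close>. Families are constrained on \<open>D\<close> alone, so uniqueness
  is always meant on \<open>D\<close>.\<close>

definition direct_sum :: "('a, 'b) monoid_scheme \<Rightarrow> 'a set \<Rightarrow> 'a set set \<Rightarrow> bool" where
  "direct_sum V X D \<longleftrightarrow> finite D \<and> (\<forall>U\<in>D. subgroup U V \<and> U \<subseteq> X) \<and>
     (\<forall>w\<in>Pi D (\<lambda>U. U). finprod V w D = \<one>\<^bsub>V\<^esub> \<longrightarrow> (\<forall>U\<in>D. w U = \<one>\<^bsub>V\<^esub>)) \<and>
     (\<forall>x\<in>X. \<exists>w\<in>Pi D (\<lambda>U. U). finprod V w D = x)"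

text \<open>The internal sum of the subgroups \<open>F U\<close>. The index set remains the set of
  summands while \<open>F\<close> may choose a smaller subgroup in each of them.\<close>

definition sum_set :: "('a, 'm) monoid_scheme \<Rightarrow> 'b set \<Rightarrow> ('b \<Rightarrow> 'a set) \<Rightarrow> 'a set" where
  "sum_set V D F = (\<lambda>w. finprod V w D) ` Pi D F"

context comm_group
begin

lemma finprod_inverse:
  assumes "finite D" "w \<in> D \<rightarrow> carrier G"
  shows "finprod G (\<lambda>U. inv (w U)) D = inv (finprod G w D)"
proof (rule inv_equality[symmetric])
  have w: "(\<lambda>U. inv (w U)) \<in> D \<rightarrow> carrier G" using assms by auto
  have "finprod G (\<lambda>U. inv (w U)) D \<otimes> finprod G w D = finprod G (\<lambda>U. inv (w U) \<otimes> w U) D"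
    using w assms by (simp add: finprod_multf)
  also have "\<dots> = \<one>" using assms by (intro finprod_one_eqI) (auto simp: Pi_def)
  finally show "finprod G (\<lambda>U. inv (w U)) D \<otimes> finprod G w D = \<one>" .
qed (use assms in \<open>auto intro!: finprod_closed\<close>)

text \<open>Multiplicativity is asked on \<open>X\<close> alone, since the maps in question are
  homomorphisms only on a subgroup of the type. The second conclusion is needed to keep the
  induction inside \<open>X\<close>, and with \<open>k\<close> the identity it is used on its
  own.\<close>

lemma hom_finprod_restrict:
  assumes "finite D" "w \<in> D \<rightarrow> X" "subgroup X G" "\<And>x. x \<in> X \<Longrightarrow> k x \<in> carrier G"
    and "\<And>x y. x \<in> X \<Longrightarrow> y \<in> X \<Longrightarrow> k (x \<otimes> y) = k x \<otimes> k y"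
  shows "k (finprod G w D) = finprod G (\<lambda>U. k (w U)) D \<and> finprod G w D \<in> X"
  using assms(1,2)
proof (induction D rule: finite_induct)
  case empty
  have "k \<one> \<otimes> k \<one> = k \<one>" using assms(4,5)[of \<one>] subgroup.one_closed[OF assms(3)] by (metis l_one one_closed)
  then have "k \<one> = \<one>" using assms(4) subgroup.one_closed[OF assms(3)] by (metis l_cancel_one')
  then show ?case using subgroup.one_closed[OF assms(3)] by simp
next
  case (insert U D)
  have "w \<in> D \<rightarrow> carrier G" "w U \<in> carrier G" "w U \<in> X"
    using insert.prems subgroup.subset[OF assms(3)] by auto
  moreover have "(\<lambda>U. k (w U)) \<in> D \<rightarrow> carrier G" "k (w U) \<in> carrier G" using insert.prems assms(4) by auto
  ultimately show ?case
    using insert assms(5) subgroup.m_closed[OF assms(3)] by simp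
qed

lemma sum_set_subgroup:
  assumes "finite D" "\<And>U. U \<in> D \<Longrightarrow> subgroup (F U) G"
  shows "subgroup (sum_set G D F) G"
proof (rule subgroupI)
  have c: "w \<in> D \<rightarrow> carrier G" if "w \<in> Pi D F" for w
    using that assms(2) subgroup.mem_carrier by (fastforce simp: Pi_def)
  show "sum_set G D F \<subseteq> carrier G" using c by (auto simp: sum_set_def)
  have "(\<lambda>_. \<one>) \<in> Pi D F" using assms(2) subgroup.one_closed by fastforce
  then show "sum_set G D F \<noteq> {}" by (auto simp: sum_set_def)
  fix a assume "a \<in> sum_set G D F"
  then obtain w where w: "w \<in> Pi D F" "a = finprod G w D" by (auto simp: sum_set_def)
  have "(\<lambda>U. inv (w U)) \<in> Pi D F" using w assms(2) by (auto simp: Pi_def subgroup.m_inv_closed)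
  then show "inv a \<in> sum_set G D F"
    using finprod_inverse[OF assms(1) c[OF w(1)]] w(2) by (force simp: sum_set_def)
  fix b assume "b \<in> sum_set G D F"
  then obtain w' where w': "w' \<in> Pi D F" "b = finprod G w' D" by (auto simp: sum_set_def)
  have "(\<lambda>U. w U \<otimes> w' U) \<in> Pi D F" using w w' assms(2) by (auto simp: Pi_def subgroup.m_closed)
  moreover have "finprod G (\<lambda>U. w U \<otimes> w' U) D = a \<otimes> b"
    using c[OF w(1)] c[OF w'(1)] w w' by (simp add: finprod_multf)
  ultimately show "a \<otimes> b \<in> sum_set G D F" by (force simp: sum_set_def)
qed

lemma sum_set_single:
  assumes "finite D" "U \<in> D" "\<And>U. U \<in> D \<Longrightarrow> subgroup (F U) G"
  shows "F U \<subseteq> sum_set G D F"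
proof
  fix x assume x: "x \<in> F U"
  have "(\<lambda>E. if E = U then x else \<one>) \<in> Pi D F" using x assms subgroup.one_closed by fastforce
  moreover have "finprod G (\<lambda>E. if E = U then x else \<one>) D = x"
    using finprod_singleton_swap[OF assms(2,1), of "\<lambda>_. x"] x assms subgroup.mem_carrier by fastforce
  ultimately show "x \<in> sum_set G D F" by (force simp: sum_set_def)
qed

text \<open>Apply independence to the quotient of the two families.\<close>

lemma direct_sum_inj:
  assumes D: "direct_sum G X D" and w: "w \<in> Pi D (\<lambda>U. U)" "w' \<in> Pi D (\<lambda>U. U)"
    and eq: "finprod G w D = finprod G w' D" and U: "U \<in> D"
  shows "w U = w' U"
proof -
  have s: "\<And>U. U \<in> D \<Longrightarrow> subgroup U G" and fin: "finite D" using D by (auto simp: direct_sum_def)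
  have c: "w \<in> D \<rightarrow> carrier G" "w' \<in> D \<rightarrow> carrier G"
    using w s subgroup.mem_carrier by (fastforce simp: Pi_def)+
  have ci: "(\<lambda>U. inv (w' U)) \<in> D \<rightarrow> carrier G" using c by auto
  have "finprod G (\<lambda>U. w U \<otimes> inv (w' U)) D = finprod G w D \<otimes> finprod G (\<lambda>U. inv (w' U)) D"
    using c ci by (simp add: finprod_multf)
  also have "\<dots> = \<one>" using c eq by (simp add: finprod_inverse[OF fin])
  finally have "finprod G (\<lambda>U. w U \<otimes> inv (w' U)) D = \<one>" .
  moreover have "(\<lambda>U. w U \<otimes> inv (w' U)) \<in> Pi D (\<lambda>U. U)"
    using w s by (auto simp: Pi_def subgroup.m_closed subgroup.m_inv_closed)
  ultimately have "w U \<otimes> inv (w' U) = \<one>" using D U by (auto simp: direct_sum_def)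
  moreover have "w U \<in> carrier G" "w' U \<in> carrier G" using c U by auto
  ultimately show ?thesis by (metis inv_equality inv_inv inv_closed)
qed

text \<open>The family with \<open>x\<close> at \<open>U\<close> and \<one> elsewhere has the same
  product, so uniqueness fixes every component.\<close>

lemma direct_sum_component:
  assumes D: "direct_sum G X D" and w: "w \<in> Pi D (\<lambda>U. U)" and x: "finprod G w D = x"
    and U: "U \<in> D" "x \<in> U" and E: "E \<in> D"
  shows "w E = (if E = U then x else \<one>)"
proof -
  have s: "\<And>U. U \<in> D \<Longrightarrow> subgroup U G" and fin: "finite D" using D by (auto simp: direct_sum_def)
  have "(\<lambda>E. if E = U then x else \<one>) \<in> Pi D (\<lambda>U. U)" using U s subgroup.one_closed by fastforce
  moreover have "finprod G (\<lambda>E. if E = U then x else \<one>) D = x"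
    using finprod_singleton_swap[OF U(1) fin, of "\<lambda>_. x"] U s subgroup.mem_carrier by fastforce
  ultimately show ?thesis using direct_sum_inj[OF D w _ _ E] x by auto
qed

lemma direct_sum_Int:
  assumes D: "direct_sum G X D" and U: "U \<in> D" "U' \<in> D" "U \<noteq> U'" and x: "x \<in> U" "x \<in> U'"
  shows "x = \<one>"
proof -
  have "x \<in> X" using D U x by (auto simp: direct_sum_def)
  then obtain w where w: "w \<in> Pi D (\<lambda>U. U)" "finprod G w D = x" using D by (auto simp: direct_sum_def)
  show ?thesis
    using direct_sum_component[OF D w U(1) x(1) U(1)] direct_sum_component[OF D w U(2) x(2) U(1)] U(3)
    by auto
qed

text \<open>A product over all small summands is an iterated product, first within each
  \<open>E U\<close> and then over \<open>D\<close>. This needs the sets \<open>E U\<close> to be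
  disjoint: a common member would lie in two distinct summands of \<open>D\<close>, hence be
  {\<one>}, which is excluded.\<close>

lemma direct_sum_refine:
  assumes D: "direct_sum G X D" and E: "\<And>U. U \<in> D \<Longrightarrow> direct_sum G U (E U)"
    and nt: "\<And>U. U \<in> D \<Longrightarrow> {\<one>} \<notin> E U"
  shows "direct_sum G X (\<Union>U\<in>D. E U)" "pairwise (\<lambda>U U'. disjnt (E U) (E U')) D"
proof -
  have fin: "finite D" "\<And>U. U \<in> D \<Longrightarrow> finite (E U)" using D E by (auto simp: direct_sum_def)
  have sub: "subgroup W G" "W \<subseteq> U" if "U \<in> D" "W \<in> E U" for U W
    using that E by (auto simp: direct_sum_def)
  show disj: "pairwise (\<lambda>U U'. disjnt (E U) (E U')) D"
  proof (rule pairwiseI)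
    fix U U' assume U: "U \<in> D" "U' \<in> D" "U \<noteq> U'"
    have False if W: "W \<in> E U" "W \<in> E U'" for W
    proof -
      have "W \<subseteq> {\<one>}" using direct_sum_Int[OF D U] sub(2) U W by blast
      moreover have "\<one> \<in> W" using sub(1)[OF U(1) W(1)] by (rule subgroup.one_closed)
      ultimately have "W = {\<one>}" by blast
      with nt U W show False by blast
    qed
    then show "disjnt (E U) (E U')" by (auto simp: disjnt_def)
  qed
  have cl: "w W \<in> carrier G" if "w \<in> Pi (\<Union>U\<in>D. E U) (\<lambda>U. U)" "U \<in> D" "W \<in> E U" for w U W
    using that sub(1) subgroup.mem_carrier by (fastforce simp: Pi_def)
  have fp: "finprod G w (\<Union>U\<in>D. E U) = finprod G (\<lambda>U. finprod G w (E U)) D"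
    if "w \<in> Pi (\<Union>U\<in>D. E U) (\<lambda>U. U)" for w
    using fin disj cl[OF that] by (intro finprod_UN_disjoint) auto
  have inU: "finprod G w (E U) \<in> U" if "w \<in> Pi (E U) (\<lambda>U. U)" "U \<in> D" for w U
  proof -
    have "w \<in> E U \<rightarrow> U" using that sub(2)[OF that(2)] by auto
    moreover have "subgroup U G" using D that by (auto simp: direct_sum_def)
    moreover have "U \<subseteq> carrier G" using \<open>subgroup U G\<close> by (rule subgroup.subset)
    ultimately show ?thesis
      using hom_finprod_restrict[of "E U" w U "\<lambda>x. x"] fin that by auto
  qed
  show "direct_sum G X (\<Union>U\<in>D. E U)"
    unfolding direct_sum_def
  proof (intro conjI ballI impI)
    show "finite (\<Union>U\<in>D. E U)" using fin by blast
    fix W assume "W \<in> (\<Union>U\<in>D. E U)"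
    then obtain U where U: "U \<in> D" "W \<in> E U" by blast
    show "subgroup W G" using sub U by blast
    show "W \<subseteq> X" using sub(2)[OF U] D U by (auto simp: direct_sum_def)
  next
    fix w W assume w: "w \<in> Pi (\<Union>U\<in>D. E U) (\<lambda>U. U)" "finprod G w (\<Union>U\<in>D. E U) = \<one>"
      and "W \<in> (\<Union>U\<in>D. E U)"
    then obtain U where U: "U \<in> D" "W \<in> E U" by blast
    have wE: "w \<in> Pi (E U) (\<lambda>U. U)" if "U \<in> D" for U using w(1) that by (auto simp: Pi_def)
    have "(\<lambda>U. finprod G w (E U)) \<in> Pi D (\<lambda>U. U)" using inU wE by auto
    moreover have "finprod G (\<lambda>U. finprod G w (E U)) D = \<one>" using w fp by simp
    ultimately have "finprod G w (E U) = \<one>" using D U unfolding direct_sum_def by auto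
    then show "w W = \<one>" using E[OF U(1)] wE[OF U(1)] U unfolding direct_sum_def by auto
  next
    fix x assume "x \<in> X"
    then obtain w where w: "w \<in> Pi D (\<lambda>U. U)" "finprod G w D = x" using D by (auto simp: direct_sum_def)
    have "\<forall>U\<in>D. \<exists>w'\<in>Pi (E U) (\<lambda>U. U). finprod G w' (E U) = w U"
      using E w(1) unfolding direct_sum_def by (auto simp: Pi_def)
    then obtain f where f: "\<And>U. U \<in> D \<Longrightarrow> f U \<in> Pi (E U) (\<lambda>U. U) \<and> finprod G (f U) (E U) = w U"
      by metis
    \<comment> \<open>The families chosen for the single \<open>U\<close> glue to one function,
      since disjointness gives each \<open>W\<close> a unique \<open>U\<close> with
      \<open>W \<in> E U\<close>.\<close>
    define v where "v W = f (THE U. U \<in> D \<and> W \<in> E U) W" for W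
    have the: "(THE U. U \<in> D \<and> W \<in> E U) = U" if "U \<in> D" "W \<in> E U" for U W
      using that disj by (intro the_equality) (auto simp: pairwise_def disjnt_def)
    have v: "v W = f U W" if "U \<in> D" "W \<in> E U" for U W using the[OF that] by (simp add: v_def)
    have vPi: "v \<in> Pi (\<Union>U\<in>D. E U) (\<lambda>U. U)" using f v by (auto simp: Pi_def)
    have "finprod G v (E U) = w U" if U: "U \<in> D" for U
    proof -
      have "f U \<in> E U \<rightarrow> carrier G" using f[OF U] sub(1)[OF U] subgroup.mem_carrier by (fastforce simp: Pi_def)
      then have "finprod G v (E U) = finprod G (f U) (E U)" using v[OF U] by (intro finprod_cong') auto
      then show ?thesis using f[OF U] by simp
    qed
    moreover have "w \<in> D \<rightarrow> carrier G" using w(1) D subgroup.mem_carrier by (fastforce simp: Pi_def direct_sum_def)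
    ultimately have "finprod G (\<lambda>U. finprod G v (E U)) D = finprod G w D" by (intro finprod_cong') auto
    then show "\<exists>w\<in>Pi (\<Union>U\<in>D. E U) (\<lambda>U. U). finprod G w (\<Union>U\<in>D. E U) = x"
      using vPi fp[OF vPi] w(2) by auto
  qed
qed

text \<open>Because summands are not indexed, products over the image family have to be reindexed by
  \<open>E\<close>; injectivity of \<open>k\<close> on \<open>X\<close> keeps images of distinct
  summands distinct.\<close>

lemma direct_sum_image:
  assumes E: "direct_sum G X E" and X: "subgroup X G"
    and k: "inj_on k X" "\<And>x. x \<in> X \<Longrightarrow> k x \<in> carrier G"
      "\<And>x y. x \<in> X \<Longrightarrow> y \<in> X \<Longrightarrow> k (x \<otimes> y) = k x \<otimes> k y"
  shows "direct_sum G (k ` X) ((`) k ` E)"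
proof -
  have s: "\<And>U. U \<in> E \<Longrightarrow> subgroup U G" and sX: "\<And>U. U \<in> E \<Longrightarrow> U \<subseteq> X" and fin: "finite E"
    using E by (auto simp: direct_sum_def)
  have XG: "X \<subseteq> carrier G" using X by (rule subgroup.subset)
  have k1: "k \<one> = \<one>"
    using hom_finprod_restrict[of "{}" undefined X k] X k by simp
  have kinv: "k (inv x) = inv (k x)" if "x \<in> X" for x
    using that k(2,3) k1 X XG
    by (intro inv_equality[symmetric]) (auto simp: subgroup.m_inv_closed simp flip: k(3))
  have inj: "inj_on ((`) k) E"
    using k(1) sX by (intro inj_onI) (metis inj_on_image_eq_iff)
  have fp: "finprod G w ((`) k ` E) = finprod G (\<lambda>U. w (k ` U)) E"
    if w: "w \<in> Pi ((`) k ` E) (\<lambda>U. U)" for w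
  proof (rule finprod_reindex[OF _ inj], rule Pi_I)
    fix W assume W: "W \<in> (`) k ` E"
    then have "W \<subseteq> carrier G" using k(2) sX by auto
    with Pi_mem[OF w W] show "w W \<in> carrier G" by blast
  qed
  have kf: "k (finprod G w E) = finprod G (\<lambda>U. k (w U)) E" "finprod G w E \<in> X"
    if w: "w \<in> Pi E (\<lambda>U. U)" for w
  proof -
    have "w \<in> E \<rightarrow> X" by (rule Pi_I) (rule subsetD[OF sX Pi_mem[OF w]])
    from hom_finprod_restrict[OF fin this X k(2,3)]
    show "k (finprod G w E) = finprod G (\<lambda>U. k (w U)) E" "finprod G w E \<in> X" by auto
  qed
  show ?thesis
    unfolding direct_sum_def
  proof (intro conjI ballI impI)
    show "finite ((`) k ` E)" using fin by simp
    fix W assume "W \<in> (`) k ` E"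
    then obtain U where U: "U \<in> E" "W = k ` U" by blast
    show "W \<subseteq> k ` X" using U sX by blast
    have Us: "subgroup U G" "\<And>x. x \<in> U \<Longrightarrow> x \<in> X" using U s sX by auto
    show "subgroup W G"
    proof (rule subgroupI)
      show "W \<subseteq> carrier G" using U Us k(2) by auto
      show "W \<noteq> {}" using U subgroup.one_closed[OF Us(1)] by auto
      fix a assume a: "a \<in> W"
      then obtain x where x: "x \<in> U" "a = k x" using U by blast
      then show "inv a \<in> W" using kinv[of x] Us subgroup.m_inv_closed[OF Us(1)] U by force
      fix b assume "b \<in> W"
      then obtain y where y: "y \<in> U" "b = k y" using U by blast
      show "a \<otimes> b \<in> W" using x y k(3)[of x y] Us subgroup.m_closed[OF Us(1)] U by force
    qed
  next
    fix w W assume w: "w \<in> Pi ((`) k ` E) (\<lambda>U. U)" "finprod G w ((`) k ` E) = \<one>" and "W \<in> (`) k ` E"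
    then obtain U where U: "U \<in> E" "W = k ` U" by blast
    have "\<forall>U\<in>E. \<exists>x\<in>U. w (k ` U) = k x" using w(1) by (auto simp: Pi_def)
    then obtain v where v: "\<And>U. U \<in> E \<Longrightarrow> v U \<in> U \<and> w (k ` U) = k (v U)" by metis
    have vPi: "v \<in> Pi E (\<lambda>U. U)" using v by auto
    have "k (finprod G v E) = finprod G (\<lambda>U. w (k ` U)) E"
      unfolding kf(1)[OF vPi]
      using v k(2) sX by (intro finprod_cong') (auto simp: Pi_def)
    then have "k (finprod G v E) = k \<one>" using fp[OF w(1)] w(2) k1 by simp
    then have "finprod G v E = \<one>"
      using k(1) kf(2)[OF vPi] subgroup.one_closed[OF X] by (auto dest: inj_onD)
    then have "v U = \<one>" using E vPi U by (auto simp: direct_sum_def)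
    then show "w W = \<one>" using v U k1 by auto
  next
    fix y assume "y \<in> k ` X"
    then obtain x where x: "x \<in> X" "y = k x" by blast
    then obtain v where v: "v \<in> Pi E (\<lambda>U. U)" "finprod G v E = x" using E by (auto simp: direct_sum_def)
    define w where "w W = k (v (inv_into E ((`) k) W))" for W
    have wv: "w (k ` U) = k (v U)" if "U \<in> E" for U
      using that inv_into_f_f[OF inj that] by (simp add: w_def)
    have wPi: "w \<in> Pi ((`) k ` E) (\<lambda>U. U)" using wv v by (auto simp: Pi_def)
    have "finprod G w ((`) k ` E) = finprod G (\<lambda>U. k (v U)) E"
      unfolding fp[OF wPi] using wv k(2) subsetD[OF sX Pi_mem[OF v(1)]] by (intro finprod_cong') auto
    then have "finprod G w ((`) k ` E) = y" using kf(1)[OF v(1)] v(2) x by simp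
    then show "\<exists>w\<in>Pi ((`) k ` E) (\<lambda>U. U). finprod G w ((`) k ` E) = y" using wPi by blast
  qed
qed

lemma direct_sum_self:
  assumes "subgroup X G" shows "direct_sum G X {X}"
proof -
  have X: "X \<subseteq> carrier G" using assms by (rule subgroup.subset)
  have "finprod G w {X} = w X" if "w X \<in> X" for w using that X by auto
  then show ?thesis using assms by (auto simp: direct_sum_def Pi_def intro!: exI[of _ "\<lambda>_. _"])
qed

end


section \<open>Decompositions permuted by the point stabilizer\<close>

context affine_perm_group
begin

definition K :: "('a \<Rightarrow> 'a) set" where
  "K = {g \<in> G. g \<one> = \<one>}"

lemma K_G: "k \<in> K \<Longrightarrow> k \<in> G"
  by (simp add: K_def)

lemma K_one: "k \<in> K \<Longrightarrow> k \<one> = \<one>"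
  by (simp add: K_def)

lemma K_mult: "k \<in> K \<Longrightarrow> x \<in> carrier V \<Longrightarrow> y \<in> carrier V \<Longrightarrow> k (x \<otimes> y) = k x \<otimes> k y"
  by (simp add: K_def stabilizer_mult)

lemma K_in: "k \<in> K \<Longrightarrow> x \<in> carrier V \<Longrightarrow> k x \<in> carrier V"
  by (simp add: K_def perm_group_in[OF perm])

lemma K_inj: "k \<in> K \<Longrightarrow> inj k"
  using perm_group_bij[OF perm] by (simp add: K_def bij_is_inj)

lemma K_id: "id \<in> K"
  using perm_group_id[OF perm] by (simp add: K_def)

lemma K_comp: "k \<in> K \<Longrightarrow> k' \<in> K \<Longrightarrow> k \<circ> k' \<in> K"
  using perm_group_comp[OF perm] by (simp add: K_def)

lemma K_inv: "k \<in> K \<Longrightarrow> inv_into UNIV k \<in> K"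
  using perm_group_inv[OF perm] perm_group_inv_f[OF perm, of k "\<one>"] by (auto simp: K_def)

lemma K_inv_f: "k \<in> K \<Longrightarrow> inv_into UNIV k (k x) = x"
  using perm_group_inv_f[OF perm] K_G by blast

lemma K_f_inv: "k \<in> K \<Longrightarrow> k (inv_into UNIV k x) = x"
  using perm_group_f_inv[OF perm] K_G by blast

lemma K_inv_image: "k \<in> K \<Longrightarrow> inv_into UNIV k ` k ` U = U" "k \<in> K \<Longrightarrow> k ` inv_into UNIV k ` U = U"
  by (simp_all add: image_image K_inv_f K_f_inv)

lemma K_finprod:
  assumes "k \<in> K" "finite D" "w \<in> D \<rightarrow> carrier V"
  shows "k (finprod V w D) = finprod V (\<lambda>U. k (w U)) D"
  using hom_finprod_restrict[OF assms(2,3) subgroup_self, of k] K_in[OF assms(1)] K_mult[OF assms(1)]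
  by blast

definition permuted :: "'a set set \<Rightarrow> bool" where
  "permuted D \<longleftrightarrow> (\<forall>k\<in>K. \<forall>U\<in>D. k ` U \<in> D)"

lemma permuted_bij:
  assumes "permuted D" "k \<in> K" shows "bij_betw ((`) k) D D"
  by (rule bij_betw_byWitness[where f' = "(`) (inv_into UNIV k)"])
    (use assms K_inv K_inv_image in \<open>auto simp: permuted_def\<close>)

text \<open>If \<open>K\<close> moves the subgroups \<open>F U\<close> along with the summands,
  their internal sum is an invariant subgroup. This is the form in which irreducibility is used:
  with \<open>F U = U\<close> over an orbit of summands, and with smaller subgroups spread over all
  summands.\<close>

lemma invariant_sum_set:
  assumes D: "finite D" "permuted D" and F: "\<And>U. U \<in> D \<Longrightarrow> subgroup (F U) V"
    and kF: "\<And>k U. k \<in> K \<Longrightarrow> U \<in> D \<Longrightarrow> k ` F U \<subseteq> F (k ` U)"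
  shows "sum_set V D F = {\<one>} \<or> sum_set V D F = carrier V"
proof (rule irreducible)
  show "subgroup (sum_set V D F) V" using D(1) F by (rule sum_set_subgroup)
  fix k assume "k \<in> G" "k \<one> = \<one>"
  then have k: "k \<in> K" by (simp add: K_def)
  show "k ` sum_set V D F \<subseteq> sum_set V D F"
  proof
    fix y assume "y \<in> k ` sum_set V D F"
    then obtain w where w: "w \<in> Pi D F" "y = k (finprod V w D)" by (auto simp: sum_set_def)
    have c: "w U \<in> carrier V" if "U \<in> D" for U
      using subgroup.mem_carrier[OF F[OF that] Pi_mem[OF w(1) that]] .
    let ?k = "inv_into UNIV k"
    \<comment> \<open>The component in \<open>U\<close> of the image under \<open>k\<close> comes
      from the summand that \<open>k\<close> carries onto \<open>U\<close>.\<close>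
    define v where "v U = k (w (?k ` U))" for U
    have kD: "?k ` U \<in> D" if "U \<in> D" for U using D(2) K_inv[OF k] that by (simp add: permuted_def)
    have vF: "v \<in> Pi D F"
    proof (rule Pi_I)
      fix U assume U: "U \<in> D"
      have "k (w (?k ` U)) \<in> F (k ` ?k ` U)" using kF[OF k kD[OF U]] Pi_mem[OF w(1) kD[OF U]] by blast
      then show "v U \<in> F U" by (simp add: v_def K_inv_image k)
    qed
    have vc: "v \<in> D \<rightarrow> carrier V" using c kD K_in[OF k] by (auto simp: v_def)
    have b: "(`) k ` D = D" "inj_on ((`) k) D" using permuted_bij[OF D(2) k] by (auto simp: bij_betw_def)
    have "y = finprod V (\<lambda>U. k (w U)) D" using w(2) K_finprod[OF k D(1), of w] c by auto
    also have "\<dots> = finprod V (\<lambda>U. v (k ` U)) D" by (simp add: v_def K_inv_image k)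
    also have "\<dots> = finprod V v ((`) k ` D)" using finprod_reindex[of v "(`) k" D] b vc by simp
    finally show "y \<in> sum_set V D F" using b vF by (auto simp: sum_set_def)
  qed
qed

text \<open>The sum over the orbit of \<open>U\<close> is invariant and nontrivial, hence
  everything; a summand outside the orbit would then be trivial by independence.\<close>

lemma permuted_transitive:
  assumes D: "direct_sum V (carrier V) D" "permuted D" "{\<one>} \<notin> D" and U: "U \<in> D" "U' \<in> D"
  shows "\<exists>k\<in>K. k ` U = U'"
proof (rule ccontr)
  assume no: "\<not> (\<exists>k\<in>K. k ` U = U')"
  have fin: "finite D" and s: "\<And>U. U \<in> D \<Longrightarrow> subgroup U V" using D(1) by (auto simp: direct_sum_def)
  define D' where "D' = {E \<in> D. \<exists>k\<in>K. k ` U = E}"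
  have D': "finite D'" "D' \<subseteq> D" "U \<in> D'" "U' \<notin> D'"
    using fin U no K_id by (auto simp: D'_def intro: bexI[of _ id])
  have "permuted D'"
    unfolding permuted_def
  proof (intro ballI)
    fix k E assume k: "k \<in> K" and "E \<in> D'"
    then obtain k' where k': "k' \<in> K" "E = k' ` U" "E \<in> D" by (auto simp: D'_def)
    have "k ` E \<in> D" using D(2) k k' by (simp add: permuted_def)
    moreover have "(k \<circ> k') ` U = k ` E" by (simp add: k' image_comp)
    ultimately show "k ` E \<in> D'" using K_comp[OF k k'(1)] unfolding D'_def by blast
  qed
  then have "sum_set V D' (\<lambda>U. U) = {\<one>} \<or> sum_set V D' (\<lambda>U. U) = carrier V"
    using s D' by (intro invariant_sum_set) auto
  moreover have "U \<subseteq> sum_set V D' (\<lambda>U. U)" using sum_set_single[of D' U "\<lambda>U. U"] s D' by auto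
  moreover have "U \<noteq> {\<one>}" "\<one> \<in> U" using D(3) U s subgroup.one_closed by auto
  ultimately have full: "sum_set V D' (\<lambda>U. U) = carrier V" by blast
  have "x = \<one>" if x: "x \<in> U'" for x
  proof -
    have "x \<in> carrier V" using s U x subgroup.mem_carrier by fastforce
    then obtain w where w: "w \<in> Pi D' (\<lambda>U. U)" "finprod V w D' = x"
      using full[unfolded sum_set_def] by (metis imageE)
    \<comment> \<open>Extended by \<one> outside the orbit, the expression of \<open>x\<close>
      becomes one over \<open>D\<close>. Its component at \<open>U'\<close> is \<one>, yet must be
      \<open>x\<close>.\<close>
    let ?w = "\<lambda>E. if E \<in> D' then w E else \<one>"
    have wD: "?w \<in> Pi D (\<lambda>U. U)"
      by (rule Pi_I) (simp add: Pi_mem[OF w(1)] subgroup.one_closed[OF s])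
    have wc: "?w \<in> D \<rightarrow> carrier V"
      by (rule Pi_I) (rule subgroup.mem_carrier[OF s Pi_mem[OF wD]])
    have "finprod V w D' = finprod V ?w D"
      by (rule finprod_mono_neutral_cong_left[OF fin D'(2) _ _ wc]) auto
    then have "?w U' = x" using direct_sum_component[OF D(1) wD _ U(2) x U(2)] w(2) by auto
    then show "x = \<one>" using D'(4) by simp
  qed
  moreover have "\<one> \<in> U'" using s U subgroup.one_closed by auto
  ultimately have "U' = {\<one>}" by blast
  with D(3) U show False by blast
qed

text \<open>Spreading \<open>W\<close> over all summands by elements of \<open>K\<close> gives an
  invariant sum, which is trivial or everything. Comparing components at \<open>U\<close> turns
  these two cases into \<open>W = {\<one>}\<close> and \<open>W = U\<close>.\<close>

lemma component_irreducible:
  assumes D: "direct_sum V (carrier V) D" "permuted D" and U: "U \<in> D"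
    and W: "subgroup W V" "W \<subseteq> U" and inv: "\<And>k. k \<in> K \<Longrightarrow> k ` U = U \<Longrightarrow> k ` W \<subseteq> W"
    and tr: "\<And>U'. U' \<in> D \<Longrightarrow> \<exists>k\<in>K. k ` U = U'"
  shows "W = {\<one>} \<or> W = U"
proof -
  have fin: "finite D" and s: "\<And>U. U \<in> D \<Longrightarrow> subgroup U V" using D(1) by (auto simp: direct_sum_def)
  \<comment> \<open>The union over all suitable \<open>k\<close> avoids a choice; by invariance of
    \<open>W\<close> all these images coincide, which is \<open>Feq\<close>.\<close>
  define F where "F E = (\<Union>k\<in>{k \<in> K. k ` U = E}. k ` W)" for E
  have Feq: "F (k ` U) = k ` W" if k: "k \<in> K" for k
  proof
    show "k ` W \<subseteq> F (k ` U)" using k by (auto simp: F_def)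
    show "F (k ` U) \<subseteq> k ` W"
    proof
      fix x assume "x \<in> F (k ` U)"
      then obtain k' u where k': "k' \<in> K" "k' ` U = k ` U" "u \<in> W" "x = k' u" by (auto simp: F_def)
      have "(inv_into UNIV k \<circ> k') ` U = U" by (metis image_comp k'(2) K_inv_image(1)[OF k])
      then have "(inv_into UNIV k \<circ> k') u \<in> W" using inv K_comp[OF K_inv[OF k] k'(1)] k'(3) by blast
      then have "k (inv_into UNIV k (k' u)) \<in> k ` W" by auto
      then show "x \<in> k ` W" using k k' by (simp add: K_f_inv)
    qed
  qed
  have FU: "F U = W" using Feq[OF K_id] by simp
  have Fsub: "F E \<subseteq> E" if "E \<in> D" for E using W(2) by (auto simp: F_def)
  have img: "subgroup (k ` W) V" if k: "k \<in> K" for k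
  proof -
    \<comment> \<open>For the decomposition into the single summand \<open>W\<close>, the image
      lemma just says that the image of \<open>W\<close> is a subgroup.\<close>
    have "direct_sum V (k ` W) ((`) k ` {W})"
      using K_in[OF k] K_mult[OF k] subgroup.mem_carrier[OF W(1)] inj_on_subset[OF K_inj[OF k] subset_UNIV]
      by (intro direct_sum_image[OF direct_sum_self[OF W(1)] W(1)]) auto
    then show ?thesis by (auto simp: direct_sum_def)
  qed
  have Fs: "subgroup (F E) V" if E: "E \<in> D" for E using tr[OF E] Feq img by metis
  have "sum_set V D F = {\<one>} \<or> sum_set V D F = carrier V"
  proof (rule invariant_sum_set[OF fin D(2) Fs])
    fix k E assume k: "k \<in> K" and "E \<in> D"
    then obtain k' where k': "k' \<in> K" "E = k' ` U" using tr by blast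
    show "k ` F E \<subseteq> F (k ` E)"
      using Feq[OF k'(1)] Feq[OF K_comp[OF k k'(1)]] k' by (simp add: image_comp)
  qed
  then show ?thesis
  proof
    assume "sum_set V D F = {\<one>}"
    then have "W \<subseteq> {\<one>}" using sum_set_single[OF fin U, of F] Fs FU by auto
    then show ?thesis using subgroup.one_closed[OF W(1)] by auto
  next
    assume full: "sum_set V D F = carrier V"
    have "u \<in> W" if u: "u \<in> U" for u
    proof -
      have "u \<in> carrier V" using s[OF U] u by (rule subgroup.mem_carrier)
      then obtain w where w: "w \<in> Pi D F" "finprod V w D = u"
        using full[unfolded sum_set_def] by (metis imageE)
      have "w \<in> Pi D (\<lambda>U. U)" by (rule Pi_I) (use Pi_mem[OF w(1)] Fsub in blast)
      then have "w U = u" using direct_sum_component[OF D(1) _ w(2) U u U] by simp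
      then show ?thesis using Pi_mem[OF w(1) U] FU by simp
    qed
    then show ?thesis using W(2) by blast
  qed
qed

text \<open>Elements of \<open>K\<close> carry the decomposition \<open>E\<close> of
  \<open>U\<close> to every summand; invariance of \<open>E\<close> makes the result independent of
  the element chosen. The number of summands is multiplied by \<open>card E\<close>, contradicting
  maximality in the application.\<close>

lemma component_refine:
  assumes D: "direct_sum V (carrier V) D" "permuted D" "{\<one>} \<notin> D" and U: "U \<in> D"
    and E: "direct_sum V U E" "{\<one>} \<notin> E" "card E > 1"
    and inv: "\<And>k W. k \<in> K \<Longrightarrow> k ` U = U \<Longrightarrow> W \<in> E \<Longrightarrow> k ` W \<in> E"
  shows "\<exists>D'. direct_sum V (carrier V) D' \<and> permuted D' \<and> {\<one>} \<notin> D' \<and> card D' > card D"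
proof -
  have fin: "finite D" and s: "\<And>U. U \<in> D \<Longrightarrow> subgroup U V" using D(1) by (auto simp: direct_sum_def)
  have tr: "\<exists>k\<in>K. k ` U = U'" if "U' \<in> D" for U' using permuted_transitive[OF D U that] .
  define F where "F E' = (\<Union>k\<in>{k \<in> K. k ` U = E'}. (`) k ` E)" for E'
  have Feq: "F (k ` U) = (`) k ` E" if k: "k \<in> K" for k
  proof
    show "(`) k ` E \<subseteq> F (k ` U)" using k by (auto simp: F_def)
    show "F (k ` U) \<subseteq> (`) k ` E"
    proof
      fix x assume "x \<in> F (k ` U)"
      then obtain k' W where k': "k' \<in> K" "k' ` U = k ` U" "W \<in> E" "x = k' ` W" by (auto simp: F_def)
      have "(inv_into UNIV k \<circ> k') ` U = U" by (metis image_comp k'(2) K_inv_image(1)[OF k])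
      then have "(inv_into UNIV k \<circ> k') ` W \<in> E" using inv K_comp[OF K_inv[OF k] k'(1)] k'(3) by blast
      then have "k ` (inv_into UNIV k \<circ> k') ` W \<in> (`) k ` E" by auto
      then show "x \<in> (`) k ` E" by (metis image_comp k'(4) K_inv_image(2)[OF k])
    qed
  qed
  have ds: "direct_sum V U' (F U')" if U': "U' \<in> D" for U'
  proof -
    obtain k where k: "k \<in> K" "U' = k ` U" using tr[OF U'] by blast
    have "direct_sum V (k ` U) ((`) k ` E)"
      using K_in[OF k(1)] K_mult[OF k(1)] subgroup.mem_carrier[OF s[OF U]] inj_on_subset[OF K_inj[OF k(1)] subset_UNIV]
      by (intro direct_sum_image[OF E(1) s[OF U]]) auto
    then show ?thesis using k Feq by simp
  qed
  have nt: "{\<one>} \<notin> F U'" if U': "U' \<in> D" for U'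
  proof
    assume "{\<one>} \<in> F U'"
    then obtain k W where k: "k \<in> K" "W \<in> E" "k ` W = {\<one>}" by (auto simp: F_def)
    then have "W = inv_into UNIV k ` {\<one>}" using K_inv_image(1)[OF k(1), of W] by simp
    then have "W = {\<one>}" using K_one[OF K_inv[OF k(1)]] by simp
    with E(2) k show False by simp
  qed
  define D' where "D' = (\<Union>U'\<in>D. F U')"
  have 1: "direct_sum V (carrier V) D'" and disj: "pairwise (\<lambda>U U'. disjnt (F U) (F U')) D"
    unfolding D'_def using direct_sum_refine[OF D(1) ds nt] by auto
  have 2: "permuted D'"
    unfolding permuted_def
  proof (intro ballI)
    fix k W assume k: "k \<in> K" and "W \<in> D'"
    then obtain U' k' W' where U': "U' \<in> D" "k' \<in> K" "U' = k' ` U" "W' \<in> E" "W = k' ` W'"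
      by (auto simp: D'_def F_def)
    have "k ` U' \<in> D" using D(2) k U' by (simp add: permuted_def)
    moreover have "k ` W \<in> F (k ` U')" using Feq[OF K_comp[OF k U'(2)]] U' by (auto simp: image_comp)
    ultimately show "k ` W \<in> D'" by (auto simp: D'_def)
  qed
  have 3: "{\<one>} \<notin> D'" using nt by (auto simp: D'_def)
  have cardF: "card (F U') = card E" if U': "U' \<in> D" for U'
  proof -
    obtain k where k: "k \<in> K" "U' = k ` U" using tr[OF U'] by blast
    have "inj_on ((`) k) E" using K_inj[OF k(1)] by (simp add: inj_on_def inj_image_eq_iff)
    then show ?thesis using k Feq card_image by force
  qed
  have finF: "finite (F U')" if "U' \<in> D" for U' using ds[OF that] by (simp add: direct_sum_def)
  have "card D' = (\<Sum>U'\<in>D. card (F U'))" unfolding D'_def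
    using fin finF disj by (intro card_UN_disjoint) (auto simp: pairwise_def disjnt_def)
  also have "\<dots> = card D * card E" using cardF by simp
  also have "\<dots> > card D"
    using mult_strict_left_mono[of 1 "card E" "card D"] E(3) fin U card_gt_0_iff[of D] by auto
  finally show ?thesis using 1 2 3 by blast
qed

lemma primitive_component_exists:
  obtains D U where "direct_sum V (carrier V) D" "permuted D" "U \<in> D"
    "\<And>U'. U' \<in> D \<Longrightarrow> \<exists>k\<in>K. k ` U = U'"
    "\<And>W. subgroup W V \<Longrightarrow> W \<subseteq> U \<Longrightarrow> (\<And>k. k \<in> K \<Longrightarrow> k ` U = U \<Longrightarrow> k ` W \<subseteq> W) \<Longrightarrow> W = {\<one>} \<or> W = U"
    "\<And>E. direct_sum V U E \<Longrightarrow> {\<one>} \<notin> E \<Longrightarrow>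
        (\<And>k W. k \<in> K \<Longrightarrow> k ` U = U \<Longrightarrow> W \<in> E \<Longrightarrow> k ` W \<in> E) \<Longrightarrow> card E \<le> 1"
proof -
  have whole: "direct_sum V (carrier V) {carrier V}" by (rule direct_sum_self[OF subgroup_self])
  have wp: "permuted {carrier V}"
    using perm_group_bij_betw[OF perm K_G] by (auto simp: permuted_def bij_betw_def)
  have "\<exists>D U. direct_sum V (carrier V) D \<and> permuted D \<and> U \<in> D \<and>
    (\<forall>U'\<in>D. \<exists>k\<in>K. k ` U = U') \<and>
    (\<forall>E. direct_sum V U E \<and> {\<one>} \<notin> E \<and> (\<forall>k\<in>K. \<forall>W\<in>E. k ` U = U \<longrightarrow> k ` W \<in> E) \<longrightarrow> card E \<le> 1)"
  proof (cases "carrier V = {\<one>}")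
    \<comment> \<open>For trivial \<open>V\<close> every decomposition avoiding {\<one>} is empty
      and offers no \<open>U\<close>. The decomposition into the single summand
      \<open>carrier V\<close> serves instead.\<close>
    case True
    have "card E \<le> 1" if E: "direct_sum V (carrier V) E" "{\<one>} \<notin> E" for E
    proof -
      have "W = {\<one>}" if "W \<in> E" for W
        using that E True subgroup.one_closed[of W V] by (auto simp: direct_sum_def)
      then have "E = {}" using E(2) by blast
      then show ?thesis by simp
    qed
    moreover have "\<exists>k\<in>K. k ` carrier V = carrier V" using K_id by (intro bexI[of _ id]) auto
    ultimately show ?thesis using whole wp by (intro exI[of _ "{carrier V}"] exI[of _ "carrier V"]) auto
  next
    case False
    define P where "P D \<longleftrightarrow> direct_sum V (carrier V) D \<and> permuted D \<and> {\<one>} \<notin> D" for D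
    have "P {carrier V}" using whole wp False by (auto simp: P_def)
    \<comment> \<open>A bound for the number of summands, so that a largest one exists.\<close>
    moreover have "card D < Suc (2 ^ card (carrier V))" if "P D" for D
    proof -
      have "D \<subseteq> Pow (carrier V)" using that by (auto simp: P_def direct_sum_def)
      then have "card D \<le> card (Pow (carrier V))" using finite_carrier by (intro card_mono) auto
      then show ?thesis using finite_carrier by (simp add: card_Pow)
    qed
    ultimately obtain D where D: "P D" "\<And>D'. P D' \<Longrightarrow> card D' \<le> card D"
      using ex_has_greatest_nat[of P "{carrier V}" card] by metis
    have "D \<noteq> {}"
    proof
      assume "D = {}"
      then have "carrier V \<subseteq> {\<one>}" using D(1) by (auto simp: P_def direct_sum_def)
      with False show False by auto
    qed
    then obtain U where U: "U \<in> D" by blast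
    have "card E \<le> 1" if "direct_sum V U E" "{\<one>} \<notin> E" "\<forall>k\<in>K. \<forall>W\<in>E. k ` U = U \<longrightarrow> k ` W \<in> E" for E
      using component_refine[of D U E] D U that unfolding P_def by (meson leD leI)
    then show ?thesis using D(1) U permuted_transitive unfolding P_def by blast
  qed
  then obtain D U where D: "direct_sum V (carrier V) D" "permuted D" "U \<in> D"
    and tr: "\<forall>U'\<in>D. \<exists>k\<in>K. k ` U = U'"
    and pr: "\<forall>E. direct_sum V U E \<and> {\<one>} \<notin> E \<and>
      (\<forall>k\<in>K. \<forall>W\<in>E. k ` U = U \<longrightarrow> k ` W \<in> E) \<longrightarrow> card E \<le> 1"
    by auto
  show thesis
  proof (rule that[OF D])
    show "\<exists>k\<in>K. k ` U = U'" if "U' \<in> D" for U' using tr that by blast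
    show "W = {\<one>} \<or> W = U" if "subgroup W V" "W \<subseteq> U" "\<And>k. k \<in> K \<Longrightarrow> k ` U = U \<Longrightarrow> k ` W \<subseteq> W" for W
      by (rule component_irreducible[OF D that]) (use tr in auto)
    show "card E \<le> 1" if "direct_sum V U E" "{\<one>} \<notin> E"
      "\<And>k W. k \<in> K \<Longrightarrow> k ` U = U \<Longrightarrow> W \<in> E \<Longrightarrow> k ` W \<in> E" for E
      using pr that by blast
  qed
qed

end

section \<open>Coordinates on elementary abelian groups\<close>

lemma vadd_vecs: "p > 0 \<Longrightarrow> u \<in> vecs p d \<Longrightarrow> v \<in> vecs p d \<Longrightarrow> vadd p u v \<in> vecs p d"
  by (auto simp: vecs_def vadd_def)

lemma vzero_vecs: "p > 0 \<Longrightarrow> vzero \<in> vecs p d"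
  by (auto simp: vecs_def vzero_def)

text \<open>An entry below \<open>p\<close> that equals its own double modulo \<open>p\<close> is 0.
  This replaces cancellation when additive maps into \<open>vecs\<close> are shown to hit
  \<open>vzero\<close> at the neutral element.\<close>

lemma vadd_idem_zero:
  assumes "v \<in> vecs p d" "vadd p v v = v" shows "v = vzero"
proof
  fix i
  have *: "(v i + v i) mod p = v i" using assms(2) by (auto simp: vadd_def dest: fun_cong)
  show "v i = vzero i"
  proof (cases "i < d")
    case True
    then have "v i < p" using assms(1) by (auto simp: vecs_def)
    with * show ?thesis
      by (cases "v i + v i < p") (auto simp: vzero_def mod_if split: if_splits)
  qed (use assms(1) in \<open>auto simp: vecs_def vzero_def\<close>)
qed

lemma vadd_vzero: "v \<in> vecs p d \<Longrightarrow> vadd p v vzero = v" "v \<in> vecs p d \<Longrightarrow> vadd p vzero v = v"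
  by (auto simp: vadd_def vzero_def vecs_def fun_eq_iff) (metis mod_less not_le mod_0)+

lemma vsmul_Suc: "vsmul p (Suc c) v = vadd p (vsmul p c v) v"
  by (auto simp: vsmul_def vadd_def fun_eq_iff mod_simps add.commute)

lemma vsmul_vecs: "p > 0 \<Longrightarrow> v \<in> vecs p d \<Longrightarrow> vsmul p c v \<in> vecs p d"
  by (auto simp: vecs_def vsmul_def)

text \<open>Multiplication by the scalar \<open>c\<close> is \<open>c\<close>-fold addition, so
  homogeneity follows by induction on \<open>c\<close>.\<close>

lemma additive_imp_linear_Fp:
  assumes "p > 0" "A ` vecs p d \<subseteq> vecs p d"
    and add: "\<And>u v. u \<in> vecs p d \<Longrightarrow> v \<in> vecs p d \<Longrightarrow> A (vadd p u v) = vadd p (A u) (A v)"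
  shows "linear_Fp p d A"
proof -
  have z: "vadd p vzero vzero = vzero" by (auto simp: vadd_def vzero_def)
  have A0: "A vzero = vzero"
    using vadd_idem_zero[of "A vzero" p d] add[of vzero vzero] vzero_vecs assms(1,2) z by auto
  have "A (vsmul p c v) = vsmul p c (A v)" if v: "v \<in> vecs p d" for c v
  proof (induction c)
    case 0
    then show ?case using A0 by (simp add: vsmul_def vzero_def)
  next
    case (Suc c)
    then show ?case using v add vsmul_vecs[OF assms(1) v] by (simp add: vsmul_Suc)
  qed
  then show ?thesis using assms by (auto simp: linear_Fp_def)
qed

lemma vsum_cong: "(\<And>i. i < t \<Longrightarrow> w i = w' i) \<Longrightarrow> vsum p w t = vsum p w' t"
  by (induction t) auto

context comm_group
begin

text \<open>Inverses are powers: \<open>inv x\<close> is \<open>x [^] (p - 1)\<close>, so closure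
  under products suffices.\<close>

lemma subgroup_of_exponent:
  assumes S: "S \<subseteq> carrier G" "\<one> \<in> S" "\<And>x y. x \<in> S \<Longrightarrow> y \<in> S \<Longrightarrow> x \<otimes> y \<in> S"
    and p: "p > (0::nat)" "\<And>x. x \<in> S \<Longrightarrow> x [^] p = \<one>"
  shows "subgroup S G"
proof (rule subgroupI)
  fix x assume x: "x \<in> S"
  have pow: "x [^] n \<in> S" for n :: nat by (induction n) (use x S in auto)
  have "x [^] (p - 1) \<otimes> x = x [^] p" using p(1) by (metis Suc_pred' nat_pow_Suc)
  then have "inv x = x [^] (p - 1)" using p(2)[OF x] x S(1) by (intro inv_equality) auto
  then show "inv x \<in> S" using pow by simp
qed (use S in auto)

lemma pow_mod:
  assumes "x \<in> carrier G" "x [^] (p::nat) = \<one>" shows "x [^] (n mod p) = x [^] n"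
proof -
  have "x [^] n = x [^] (p * (n div p) + n mod p)" by simp
  also have "\<dots> = (x [^] p) [^] (n div p) \<otimes> x [^] (n mod p)"
    using assms(1) by (simp add: nat_pow_mult nat_pow_pow)
  finally show ?thesis using assms by simp
qed

text \<open>An injective additive map from some \<open>vecs p d\<close> into \<open>X\<close> with
  image of largest size is onto, because an element outside the image could serve as one more
  coordinate.\<close>

lemma coordinates_exist:
  assumes X: "subgroup X G" "finite X" and p: "prime (p::nat)" "\<And>x. x \<in> X \<Longrightarrow> x [^] p = \<one>"
  obtains d \<iota> where "bij_betw \<iota> X (vecs p d)"
    "\<And>x y. x \<in> X \<Longrightarrow> y \<in> X \<Longrightarrow> \<iota> (x \<otimes> y) = vadd p (\<iota> x) (\<iota> y)"
proof -
  have p0: "p > 0" using p(1) prime_gt_0_nat by blast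
  have Xc: "\<And>x. x \<in> X \<Longrightarrow> x \<in> carrier G" using X(1) by (rule subgroup.mem_carrier)
  define P where "P = (\<lambda>(d, \<psi>). \<psi> ` vecs p d \<subseteq> X \<and> inj_on \<psi> (vecs p d) \<and>
    (\<forall>u\<in>vecs p d. \<forall>v\<in>vecs p d. \<psi> (vadd p u v) = \<psi> u \<otimes> \<psi> v))"
  define sz where "sz = (\<lambda>(d, \<psi> :: (nat \<Rightarrow> nat) \<Rightarrow> 'a). card (\<psi> ` vecs p d))"
  \<comment> \<open>The search starts in dimension 0, where the zero vector is the only one.\<close>
  have "P (0, \<lambda>_. \<one>)"
    using subgroup.one_closed[OF X(1)] by (auto simp: P_def inj_on_def vecs_def)
  moreover have "sz z < Suc (card X)" if "P z" for z
    using that card_mono[OF X(2)] by (auto simp: P_def sz_def less_Suc_eq_le)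
  ultimately obtain z where z: "P z" "\<And>z'. P z' \<Longrightarrow> sz z' \<le> sz z"
    using ex_has_greatest_nat[of P "(0, \<lambda>_. \<one>)" sz "Suc (card X)"] by metis
  obtain d \<psi> where dp: "z = (d, \<psi>)" by fastforce
  have im: "\<And>v. v \<in> vecs p d \<Longrightarrow> \<psi> v \<in> X" and inj: "inj_on \<psi> (vecs p d)"
    and add: "\<And>u v. u \<in> vecs p d \<Longrightarrow> v \<in> vecs p d \<Longrightarrow> \<psi> (vadd p u v) = \<psi> u \<otimes> \<psi> v"
    using z(1) by (auto simp: P_def dp)
  define I where "I = \<psi> ` vecs p d"
  have IX: "I \<subseteq> X" using im by (auto simp: I_def)
  have \<psi>0: "\<psi> vzero = \<one>"
    using add[of vzero vzero] vadd_vzero(1)[of vzero p d] vzero_vecs[OF p0, of d] im[of vzero] Xc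
    by (metis l_cancel_one')
  have I: "subgroup I G"
  proof (rule subgroup_of_exponent[OF _ _ _ p0])
    show "\<one> \<in> I" using \<psi>0 vzero_vecs[OF p0, of d] by (force simp: I_def)
    show "x \<otimes> y \<in> I" if "x \<in> I" "y \<in> I" for x y
      using that add vadd_vecs[OF p0] unfolding I_def by (smt (verit) image_iff)
  qed (use IX Xc p(2) in auto)
  have "I = X"
  proof (rule ccontr)
    assume "I \<noteq> X"
    then obtain x where x: "x \<in> X" "x \<notin> I" using IX by blast
    have xG: "x \<in> carrier G" using x Xc by blast
    \<comment> \<open>Entry \<open>d\<close> becomes the exponent of \<open>x\<close>; resetting it
      to 0 leaves a vector of length \<open>d\<close>, on which \<psi> is available.\<close>
    define \<psi>' where "\<psi>' v = \<psi> (v(d := 0)) \<otimes> x [^] v d" for v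
    have v0: "v(d := 0) \<in> vecs p d" "v d < p" if "v \<in> vecs p (Suc d)" for v
      using that by (auto simp: vecs_def)
    have pow: "y [^] n \<in> S" if "subgroup S G" "y \<in> S" for y S and n :: nat
      by (induction n) (use that in \<open>auto simp: subgroup.one_closed subgroup.m_closed\<close>)
    \<comment> \<open>Equal images with different last entries would put \<open>x [^] c\<close> into
      \<open>I\<close> for some \<open>c\<close> strictly between 0 and \<open>p\<close>. As
      \<open>c\<close> is invertible modulo \<open>p\<close>, a further power is \<open>x\<close>
      itself, which lies outside \<open>I\<close>.\<close>
    have neq: False if u: "u \<in> vecs p (Suc d)" and v: "v \<in> vecs p (Suc d)" and e: "\<psi>' u = \<psi>' v"
      and lt: "u d < v d" for u v
    proof -
      let ?a = "\<psi> (u(d := 0))" and ?b = "\<psi> (v(d := 0))"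
      have ab: "?a \<in> I" "?b \<in> I" using v0 u v by (auto simp: I_def)
      then have abG: "?a \<in> carrier G" "?b \<in> carrier G" using IX Xc by auto
      define c where "c = v d - u d"
      have c: "0 < c" "c < p" "v d = c + u d" using lt v0(2)[OF v] by (auto simp: c_def)
      have "?a \<otimes> x [^] u d = (?b \<otimes> x [^] c) \<otimes> x [^] u d"
        using e abG xG by (simp add: \<psi>'_def c(3) nat_pow_mult[symmetric] m_assoc)
      then have "?a = ?b \<otimes> x [^] c" using abG xG by simp
      then have "x [^] c = inv ?b \<otimes> ?a" using abG xG by (metis inv_solve_left nat_pow_closed)
      then have xc: "x [^] c \<in> I" using ab by (simp add: subgroup.m_closed[OF I] subgroup.m_inv_closed[OF I])
      obtain e f where ef: "c * e = p * f + gcd c p" using bezout_nat[of c p] c by auto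
      have "coprime c p" using c p(1) by (metis coprime_commute nat_dvd_not_less prime_imp_coprime)
      then have "(x [^] c) [^] e = x [^] (p * f + 1)" using ef xG by (simp add: nat_pow_pow)
      also have "\<dots> = x" using xG p(2)[OF x(1)] by (simp add: nat_pow_mult[symmetric] nat_pow_pow[symmetric])
      finally show False using pow[OF I xc, of e] x(2) by simp
    qed
    have "P (Suc d, \<psi>')"
      unfolding P_def prod.case
    proof (intro conjI ballI)
      show "\<psi>' ` vecs p (Suc d) \<subseteq> X"
        using im v0 pow[OF X(1) x(1)] by (auto simp: \<psi>'_def subgroup.m_closed[OF X(1)])
      show "inj_on \<psi>' (vecs p (Suc d))"
      proof (rule inj_onI)
        fix u v assume u: "u \<in> vecs p (Suc d)" and v: "v \<in> vecs p (Suc d)" and e: "\<psi>' u = \<psi>' v"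
        have d: "u d = v d" using neq[OF u v e] neq[OF v u e[symmetric]] nat_neq_iff by blast
        have "\<psi> (u(d := 0)) = \<psi> (v(d := 0))"
          using e d im v0[OF u] v0[OF v] Xc xG by (simp add: \<psi>'_def)
        then have "u(d := 0) = v(d := 0)" using inj v0[OF u] v0[OF v] by (auto dest: inj_onD)
        then have "(u(d := 0))(d := u d) = (v(d := 0))(d := v d)" using d by simp
        then show "u = v" by simp
      qed
      fix u v assume u: "u \<in> vecs p (Suc d)" and v: "v \<in> vecs p (Suc d)"
      have 1: "(vadd p u v)(d := 0) = vadd p (u(d := 0)) (v(d := 0))" by (auto simp: vadd_def)
      have 2: "vadd p u v d = (u d + v d) mod p" by (simp add: vadd_def)
      have "\<psi>' (vadd p u v) = \<psi> (u(d := 0)) \<otimes> \<psi> (v(d := 0)) \<otimes> (x [^] u d \<otimes> x [^] v d)"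
        using add v0 u v xG p(2)[OF x(1)] by (simp add: \<psi>'_def 1 2 pow_mod nat_pow_mult)
      then show "\<psi>' (vadd p u v) = \<psi>' u \<otimes> \<psi>' v"
        using im v0 u v Xc xG by (simp add: \<psi>'_def m_ac)
    qed
    then have le: "card (\<psi>' ` vecs p (Suc d)) \<le> card I" using z(2) by (auto simp: sz_def dp I_def)
    have "I \<subseteq> \<psi>' ` vecs p (Suc d)"
    proof
      fix y assume "y \<in> I"
      then obtain v where v: "v \<in> vecs p d" "y = \<psi> v" by (auto simp: I_def)
      have "v \<in> vecs p (Suc d)" "v d = 0" "v(d := 0) = v" using v p0 by (auto simp: vecs_def less_Suc_eq)
      moreover from this have "\<psi>' v = y" using v im Xc by (simp add: \<psi>'_def)
      ultimately show "y \<in> \<psi>' ` vecs p (Suc d)" by blast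
    qed
    moreover have "x \<in> \<psi>' ` vecs p (Suc d)"
    proof
      show "vzero(d := 1) \<in> vecs p (Suc d)" using prime_gt_1_nat[OF p(1)] by (auto simp: vecs_def vzero_def)
      have "vzero(d := 0) = vzero" by (auto simp: vzero_def)
      then show "x = \<psi>' (vzero(d := 1))" using \<psi>0 xG by (simp add: \<psi>'_def)
    qed
    ultimately have "I \<subset> \<psi>' ` vecs p (Suc d)" using x(2) by blast
    moreover have "finite (\<psi>' ` vecs p (Suc d))"
      using \<open>P (Suc d, \<psi>')\<close> X(2) by (auto simp: P_def intro: finite_subset)
    ultimately have "card I < card (\<psi>' ` vecs p (Suc d))" by (intro psubset_card_mono)
    with le show False by simp
  qed
  then have bij: "bij_betw \<psi> (vecs p d) X" using inj by (simp add: bij_betw_def I_def)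
  define \<iota> where "\<iota> = inv_into (vecs p d) \<psi>"
  have b\<iota>: "bij_betw \<iota> X (vecs p d)" unfolding \<iota>_def by (rule bij_betw_inv_into[OF bij])
  have "\<iota> (x \<otimes> y) = vadd p (\<iota> x) (\<iota> y)" if xy: "x \<in> X" "y \<in> X" for x y
  proof -
    have m: "\<iota> x \<in> vecs p d" "\<iota> y \<in> vecs p d" using b\<iota> xy by (auto dest: bij_betw_apply)
    have "\<psi> (\<iota> x) = x" "\<psi> (\<iota> y) = y"
      unfolding \<iota>_def using bij_betw_inv_into_right[OF bij] xy by auto
    then have "x \<otimes> y = \<psi> (vadd p (\<iota> x) (\<iota> y))" using add m by simp
    then show ?thesis
      unfolding \<iota>_def using bij_betw_inv_into_left[OF bij] vadd_vecs[OF p0 m] by (simp add: \<iota>_def)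
  qed
  with b\<iota> show thesis by (rule that)
qed

end

section \<open>The group induced on a component\<close>

context affine_perm_group
begin

definition induced :: "'a set \<Rightarrow> ('a \<Rightarrow> 'a) \<Rightarrow> 'a \<Rightarrow> 'a" where
  "induced U g = (\<lambda>x. if x \<in> U then g x else x)"

text \<open>The setwise stabilizer is taken in all of \<open>G\<close> and not in \<open>K\<close>,
  so that the translations by elements of \<open>U\<close> survive and the induced group is again
  affine.\<close>

definition induced_group :: "'a set \<Rightarrow> ('a \<Rightarrow> 'a) set" where
  "induced_group U = induced U ` {g \<in> G. g ` U = U}"

lemma affine_decomposition:
  assumes g: "g \<in> G"
  obtains k where "k \<in> K" "\<And>x. x \<in> carrier V \<Longrightarrow> g x = g \<one> \<otimes> k x"
proof -
  have a: "g \<one> \<in> carrier V" using perm_group_in[OF perm g] by simp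
  obtain t where t: "t \<in> G" "\<And>y. y \<in> carrier V \<Longrightarrow> t y = g \<one> \<otimes> y" using translation[OF a] by blast
  let ?k = "inv_into UNIV t \<circ> g"
  have kG: "?k \<in> G" using perm_group_comp[OF perm perm_group_inv[OF perm t(1)] g] .
  have "t \<one> = g \<one>" using t(2) a by simp
  then have "?k \<one> = \<one>" using perm_group_inv_f[OF perm t(1), of \<one>] by simp
  then have "?k \<in> K" using kG by (simp add: K_def)
  moreover have "g x = g \<one> \<otimes> ?k x" if "x \<in> carrier V" for x
    using t(2)[OF perm_group_in[OF perm kG that]] perm_group_f_inv[OF perm t(1)] by simp
  ultimately show thesis by (rule that)
qed

lemma stabilized_translate:
  assumes a: "a \<in> carrier V" and k: "k \<in> K"
  obtains g where "g \<in> G" "\<And>x. x \<in> carrier V \<Longrightarrow> g x = a \<otimes> k x"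
proof -
  obtain t where t: "t \<in> G" "\<And>y. y \<in> carrier V \<Longrightarrow> t y = a \<otimes> y" using translation[OF a] by blast
  have "t \<circ> k \<in> G" using perm_group_comp[OF perm t(1) K_G[OF k]] .
  moreover have "(t \<circ> k) x = a \<otimes> k x" if "x \<in> carrier V" for x using t(2) K_in[OF k that] by simp
  ultimately show thesis by (rule that)
qed

context
  fixes U assumes U: "subgroup U V"
begin

lemma U_carrier: "x \<in> U \<Longrightarrow> x \<in> carrier V"
  using U by (rule subgroup.mem_carrier)

lemma finite_U: "finite U"
  using finite_subset[OF subgroup.subset[OF U] finite_carrier] .

lemma translate_image: "a \<in> U \<Longrightarrow> (\<lambda>x. a \<otimes> x) ` U = U"
proof
  assume a: "a \<in> U"
  show "(\<lambda>x. a \<otimes> x) ` U \<subseteq> U" using a subgroup.m_closed[OF U] by auto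
  show "U \<subseteq> (\<lambda>x. a \<otimes> x) ` U"
  proof
    fix x assume x: "x \<in> U"
    have "x = a \<otimes> (inv a \<otimes> x)" using a x U_carrier by (simp flip: m_assoc)
    moreover have "inv a \<otimes> x \<in> U" using a x subgroup.m_closed[OF U] subgroup.m_inv_closed[OF U] by auto
    ultimately show "x \<in> (\<lambda>x. a \<otimes> x) ` U" by blast
  qed
qed

text \<open>If \<open>g\<close> preserves \<open>U\<close>, then \<open>g \<one>\<close> lies in
  \<open>U\<close>, so undoing this translation shows that the linear part preserves
  \<open>U\<close> too. Together with \<open>induced_group_member\<close> this describes the induced
  group completely.\<close>

lemma induced_group_affine:
  assumes "h \<in> induced_group U"
  obtains a k where "a \<in> U" "k \<in> K" "k ` U = U" "\<And>x. x \<in> U \<Longrightarrow> h x = a \<otimes> k x"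
proof -
  obtain g where g: "g \<in> G" "g ` U = U" "h = induced U g" using assms by (auto simp: induced_group_def)
  obtain k where k: "k \<in> K" "\<And>x. x \<in> carrier V \<Longrightarrow> g x = g \<one> \<otimes> k x"
    by (rule affine_decomposition[OF g(1)]) blast
  have a: "g \<one> \<in> U" using g(2) subgroup.one_closed[OF U] by blast
  have "k x \<in> U" if x: "x \<in> U" for x
  proof -
    have "k x = inv (g \<one>) \<otimes> g x"
      using k(2)[OF U_carrier[OF x]] K_in[OF k(1) U_carrier[OF x]] U_carrier[OF a] by (simp flip: m_assoc)
    moreover have "g x \<in> U" using g(2) x by blast
    ultimately show ?thesis using a subgroup.m_closed[OF U] subgroup.m_inv_closed[OF U] by simp
  qed
  then have "k ` U = U"
    using finite_U inj_on_subset[OF K_inj[OF k(1)]] by (intro endo_inj_surj) auto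
  moreover have "h x = g \<one> \<otimes> k x" if "x \<in> U" for x 
    using that g(3) k(2)[OF U_carrier[OF that]] by (simp add: induced_def)
  ultimately show thesis using that a k(1) by blast
qed

lemma induced_group_member:
  assumes a: "a \<in> U" and k: "k \<in> K" "k ` U = U"
  obtains h where "h \<in> induced_group U" "\<And>x. x \<in> U \<Longrightarrow> h x = a \<otimes> k x"
proof -
  obtain g where g: "g \<in> G" "\<And>x. x \<in> carrier V \<Longrightarrow> g x = a \<otimes> k x"
    using stabilized_translate[OF U_carrier[OF a] k(1)] by blast
  have "g ` U = (\<lambda>x. a \<otimes> k x) ` U" using g(2) U_carrier by (intro image_cong) auto
  also have "\<dots> = (\<lambda>x. a \<otimes> x) ` (k ` U)" by (simp add: image_image)
  finally have "g ` U = U" using k(2) translate_image[OF a] by simp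
  then have "induced U g \<in> induced_group U" using g(1) by (simp add: induced_group_def)
  moreover have "induced U g x = a \<otimes> k x" if "x \<in> U" for x using that g(2) U_carrier by (simp add: induced_def)
  ultimately show thesis by (rule that)
qed

lemma induced_comp: "h ` U = U \<Longrightarrow> induced U g \<circ> induced U h = induced U (g \<circ> h)"
  by (auto simp: induced_def fun_eq_iff)

lemma perm_group_induced: "perm_group U (induced_group U)"
proof (rule perm_group_finiteI[OF finite_U])
  fix g assume "g \<in> induced_group U"
  then obtain g' where g': "g' \<in> G" "g' ` U = U" "g = induced U g'" by (auto simp: induced_group_def)
  have "inj_on g' U" using perm_group_bij[OF perm g'(1)] by (meson bij_is_inj inj_on_subset subset_UNIV)
  then have "bij_betw g' U U" using g' by (simp add: bij_betw_def)
  then show "bij_betw g U U"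
    by (rule bij_betw_cong[THEN iffD1, rotated]) (auto simp: g' induced_def)
  show "g x = x" if "x \<notin> U" for x using that by (simp add: g' induced_def)
  fix h assume "h \<in> induced_group U"
  then obtain h' where h': "h' \<in> G" "h' ` U = U" "h = induced U h'" by (auto simp: induced_group_def)
  have "(g' \<circ> h') ` U = U" using g' h' by (simp only: image_comp[symmetric])
  then show "g \<circ> h \<in> induced_group U"
    using g' h' perm_group_comp[OF perm g'(1) h'(1)] by (simp add: induced_comp induced_group_def)
next
  have "induced U id = id" by (auto simp: induced_def)
  then show "id \<in> induced_group U"
    unfolding induced_group_def using perm_group_id[OF perm] by (intro image_eqI[of _ _ id]) auto
qed

text \<open>Restriction to \<open>U\<close> is a homomorphism onto the induced group from the
  setwise stabilizer of \<open>U\<close>, a subgroup of a solvable group.\<close>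

lemma solvable_induced:
  assumes "solvable_perm_group G" shows "solvable_perm_group (induced_group U)"
proof -
  let ?M = "perm_group_monoid G" and ?S = "{g \<in> G. g ` U = U}"
  interpret M: group ?M by (rule perm_group_monoid_group[OF perm])
  have S: "subgroup ?S ?M"
  proof (rule M.subgroupI)
    show "?S \<subseteq> carrier ?M" by (auto simp: perm_group_monoid_def)
    show "?S \<noteq> {}" using perm_group_id[OF perm] by (auto intro: exI[of _ id])
    fix g assume g: "g \<in> ?S"
    then have "(\<lambda>x. inv_into UNIV g (g x)) ` U = U" by (simp add: perm_group_inv_f[OF perm])
    then have "inv_into UNIV g ` (g ` U) = U" by (simp only: image_image)
    then have "inv_into UNIV g ` U = U" using g by simp
    then show "inv\<^bsub>?M\<^esub> g \<in> ?S"
      using g perm_group_inv[OF perm] perm_group_monoid_inv[OF perm, of g] by simp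
    fix h assume h: "h \<in> ?S"
    have "(g \<circ> h) ` U = U" using g h by (simp only: image_comp[symmetric] mem_Collect_eq)
    then show "g \<otimes>\<^bsub>?M\<^esub> h \<in> ?S" using g h perm_group_comp[OF perm] by (simp add: perm_group_monoid_def)
  qed
  interpret S: group "?M\<lparr>carrier := ?S\<rparr>" by (rule M.subgroup_imp_group[OF S])
  interpret H: group "perm_group_monoid (induced_group U)"
    by (rule perm_group_monoid_group[OF perm_group_induced])
  interpret group_hom "?M\<lparr>carrier := ?S\<rparr>" "perm_group_monoid (induced_group U)" "induced U"
  proof
    show "induced U \<in> hom (?M\<lparr>carrier := ?S\<rparr>) (perm_group_monoid (induced_group U))"
      by (auto simp: hom_def perm_group_monoid_def induced_comp induced_group_def)
  qed
  interpret incl: group_hom "?M\<lparr>carrier := ?S\<rparr>" ?M id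
    by unfold_locales (auto simp: hom_def perm_group_monoid_def)
  have "solvable (?M\<lparr>carrier := ?S\<rparr>)"
    using assms incl.inj_hom_imp_solvable by (simp add: solvable_perm_group_def)
  then show ?thesis
    using surj_hom_imp_solvable unfolding solvable_perm_group_def
    by (simp add: perm_group_monoid_def induced_group_def)
qed

lemma antisymmetric_induced:
  assumes "antisymmetric_cc (carrier V) (Inv (carrier V) G)"
  shows "antisymmetric_cc U (Inv U (induced_group U))"
  unfolding antisymmetric_Inv_iff[OF perm_group_induced]
proof (intro ballI impI)
  fix a b h assume a: "a \<in> U" "b \<in> U" and "h \<in> induced_group U" and h: "h a = b \<and> h b = a"
  then obtain g where "g \<in> G" "h = induced U g" by (auto simp: induced_group_def)
  then have "g \<in> G" "g a = b" "g b = a" using a h by (auto simp: induced_def)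
  then show "a = b" using assms a U_carrier unfolding antisymmetric_Inv_iff[OF perm] by blast
qed

section \<open>Primitivity of the group induced on an irreducible component\<close>

context
  assumes irr: "\<And>W. subgroup W V \<Longrightarrow> W \<subseteq> U \<Longrightarrow> (\<And>k. k \<in> K \<Longrightarrow> k ` U = U \<Longrightarrow> k ` W \<subseteq> W) \<Longrightarrow>
      W = {\<one>} \<or> W = U"
begin

text \<open>A block is moved by a translation to a set \<open>W\<close> containing \<one>, and the
  closure property \<open>step\<close> does the rest: with \<open>k\<close> the identity it makes
  \<open>W\<close> a subgroup, with \<open>a\<close> equal to \<one> it makes \<open>W\<close>
  invariant. Irreducibility of \<open>U\<close> then decides \<open>W\<close>, and \<open>B\<close>
  has the same size.\<close>

lemma primitive_induced: "primitive_group U (induced_group U)"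
  unfolding primitive_group_def
proof (intro conjI allI impI)
  have tr: "\<exists>h\<in>induced_group U. \<forall>x\<in>U. h x = a \<otimes> x" if a: "a \<in> U" for a
    using induced_group_member[OF a K_id] by (metis id_apply image_id)
  show "transitive_group U (induced_group U)"
    unfolding transitive_group_def
  proof (intro conjI ballI)
    show "U \<noteq> {}" using subgroup.one_closed[OF U] by blast
    fix x y assume xy: "x \<in> U" "y \<in> U"
    have "y \<otimes> inv x \<in> U" using xy subgroup.m_closed[OF U] subgroup.m_inv_closed[OF U] by simp
    then obtain h where "h \<in> induced_group U" "h x = y \<otimes> inv x \<otimes> x" using tr xy by blast
    moreover have "y \<otimes> inv x \<otimes> x = y" using xy U_carrier by (simp add: m_assoc)
    ultimately show "\<exists>g\<in>induced_group U. g x = y" by auto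
  qed
  fix B assume "B \<subseteq> U \<and> B \<noteq> {} \<and> (\<forall>g\<in>induced_group U. g ` B = B \<or> g ` B \<inter> B = {})"
  then have BU: "B \<subseteq> U" and Bne: "B \<noteq> {}"
    and blk: "\<And>h x. h \<in> induced_group U \<Longrightarrow> x \<in> B \<Longrightarrow> h x \<in> B \<Longrightarrow> h ` B = B" by blast+
  obtain b where b: "b \<in> B" using Bne by blast
  have bU: "b \<in> U" using b BU by blast
  define W where "W = (\<lambda>x. inv b \<otimes> x) ` B"
  have ibU: "inv b \<in> U" using bU subgroup.m_inv_closed[OF U] by simp
  have WU: "W \<subseteq> U" using BU subgroup.m_closed[OF U ibU] by (auto simp: W_def)
  have oneW: "\<one> \<in> W" using b U_carrier[OF bU] unfolding W_def by (intro image_eqI[of _ _ b]) auto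
  have Wb: "x \<in> W \<longleftrightarrow> b \<otimes> x \<in> B" if x: "x \<in> U" for x
  proof
    assume "x \<in> W"
    then obtain y where "y \<in> B" "x = inv b \<otimes> y" by (auto simp: W_def)
    then show "b \<otimes> x \<in> B" using U_carrier[OF bU] U_carrier BU by (auto simp flip: m_assoc)
  next
    assume "b \<otimes> x \<in> B"
    moreover have "x = inv b \<otimes> (b \<otimes> x)" using U_carrier[OF bU] U_carrier[OF x] by (simp flip: m_assoc)
    ultimately show "x \<in> W" unfolding W_def by blast
  qed
  text \<open>The map constructed next sends the point \<open>b\<close> of the block \<open>B\<close> to
    \<open>b \<otimes> a\<close>, which also lies in \<open>B\<close>; hence it preserves \<open>B\<close>.\<close>
  have step: "a \<otimes> k x \<in> W" if a: "a \<in> W" and k: "k \<in> K" "k ` U = U" and x: "x \<in> W" for a k x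
  proof -
    have aU: "a \<in> U" and xU: "x \<in> U" using a x WU by auto
    \<comment> \<open>Chosen so that the affine map with linear part \<open>k\<close> and
      translation part \<open>c\<close> becomes \<open>y \<mapsto> a \<otimes> k y\<close> when the
      origin is moved to \<open>b\<close>.\<close>
    define c where "c = b \<otimes> a \<otimes> inv (k b)"
    have kU: "k y \<in> U" if "y \<in> U" for y using k(2) that by blast
    have cU: "c \<in> U" unfolding c_def
      using bU aU kU[OF bU] by (simp add: subgroup.m_closed[OF U] subgroup.m_inv_closed[OF U])
    obtain h where h: "h \<in> induced_group U" "\<And>x. x \<in> U \<Longrightarrow> h x = c \<otimes> k x"
      using induced_group_member[OF cU k] by blast
    have hb: "h (b \<otimes> y) = b \<otimes> (a \<otimes> k y)" if y: "y \<in> U" for y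
    proof -
      have "h (b \<otimes> y) = c \<otimes> (k b \<otimes> k y)"
        using h(2) bU y subgroup.m_closed[OF U] K_mult[OF k(1)] U_carrier by simp
      also have "\<dots> = b \<otimes> (a \<otimes> ((inv (k b) \<otimes> k b) \<otimes> k y))"
        using U_carrier[OF kU[OF bU]] U_carrier[OF kU[OF y]] U_carrier[OF bU] U_carrier[OF aU]
        by (simp only: c_def m_assoc m_closed inv_closed)
      finally show ?thesis using U_carrier[OF kU[OF bU]] U_carrier[OF kU[OF y]] by simp
    qed
    have "h (b \<otimes> \<one>) = b \<otimes> (a \<otimes> k \<one>)" using hb subgroup.one_closed[OF U] by blast
    then have "h b = b \<otimes> a" using U_carrier[OF bU] U_carrier[OF aU] K_one[OF k(1)] by simp
    then have "h b \<in> B" using Wb[OF aU] a by simp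
    then have "h ` B = B" using blk[OF h(1) b] by blast
    then have "h (b \<otimes> x) \<in> B" using Wb[OF xU] x by blast
    then have "b \<otimes> (a \<otimes> k x) \<in> B" using hb[OF xU] by simp
    then show ?thesis using Wb subgroup.m_closed[OF U aU kU[OF xU]] by blast
  qed
  have Ws: "subgroup W V"
  proof (rule subgroup_of_exponent[OF _ oneW _ prime_gt_0_nat[OF prime]])
    show "W \<subseteq> carrier V" using WU U_carrier by blast
    show "x \<otimes> y \<in> W" if "x \<in> W" "y \<in> W" for x y using step[OF that(1) K_id _ that(2)] by simp
    show "x [^] p = \<one>" if "x \<in> W" for x using that WU U_carrier exponent by blast
  qed
  have Wk: "k ` W \<subseteq> W" if k: "k \<in> K" "k ` U = U" for k
  proof
    fix y assume "y \<in> k ` W"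
    then obtain x where x: "x \<in> W" "y = k x" by blast
    then have "\<one> \<otimes> k x \<in> W" using step[OF oneW k] by blast
    then show "y \<in> W" using x WU U_carrier K_in[OF k(1)] by (metis l_one subsetD)
  qed
  have "inj_on (\<lambda>x. inv b \<otimes> x) B"
    using U_carrier BU ibU by (intro inj_onI) (metis Units_eq Units_l_cancel subsetD)
  then have cW: "card W = card B" unfolding W_def by (rule card_image)
  have "W = {\<one>} \<or> W = U" using irr[OF Ws WU] Wk by blast
  then show "card B = 1 \<or> B = U"
  proof
    assume "W = U"
    then have "B = U" using card_subset_eq[OF finite_U BU] cW by simp
    then show ?thesis ..
  qed (use cW in auto)
qed

text \<open>In coordinates the elements of \<open>H'\<close> are the maps
  \<open>v \<mapsto> \<iota> (a \<otimes> k (\<kappa> v))\<close>. A subspace or decomposition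
  respected by \<open>K'\<close> is pulled back along \<iota>; since each \<open>k\<close>
  preserving \<open>U\<close> shows up in \<open>K'\<close> (\<open>K'I\<close>), the pulled-back
  object is respected by these \<open>k\<close>, and \<open>irr\<close> or \<open>prim\<close>
  applies.\<close>

lemma linearly_primitive_induced:
  assumes solv: "solvable_perm_group G"
    and prim: "\<And>E. direct_sum V U E \<Longrightarrow> {\<one>} \<notin> E \<Longrightarrow>
        (\<And>k W. k \<in> K \<Longrightarrow> k ` U = U \<Longrightarrow> W \<in> E \<Longrightarrow> k ` W \<in> E) \<Longrightarrow> card E \<le> 1"
    and b: "bij_betw b U \<Gamma>"
  shows "linearly_primitive_scheme \<Gamma> (Inv \<Gamma> (transport U b ` induced_group U))"
proof -
  let ?H = "transport U b ` induced_group U"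
  note tp = finite_U perm_group_induced b
  have pH: "perm_group \<Gamma> ?H" by (rule perm_group_transport[OF tp])
  have prH: "primitive_group \<Gamma> ?H" by (rule primitive_transport[OF tp primitive_induced])
  have sH: "solvable_perm_group ?H" by (rule solvable_transport[OF tp solvable_induced[OF solv]])
  have fin: "finite \<Gamma>" using b finite_U by (metis bij_betw_finite)
  have sch: "is_scheme \<Gamma> (Inv \<Gamma> ?H)"
    using is_scheme_Inv[OF pH fin] prH by (simp add: primitive_group_def)
  have p0: "p > 0" using prime prime_gt_0_nat by blast
  obtain d \<iota> where \<iota>: "bij_betw \<iota> U (vecs p d)"
    and \<iota>add: "\<And>x y. x \<in> U \<Longrightarrow> y \<in> U \<Longrightarrow> \<iota> (x \<otimes> y) = vadd p (\<iota> x) (\<iota> y)"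
    using coordinates_exist[OF U finite_U prime] exponent U_carrier by metis
  define \<kappa> where "\<kappa> = inv_into U \<iota>"
  have \<kappa>: "\<kappa> v \<in> U" "\<iota> (\<kappa> v) = v" if "v \<in> vecs p d" for v
    using that \<iota> bij_betw_inv_into_right[OF \<iota>] bij_betw_apply[OF bij_betw_inv_into[OF \<iota>]]
    by (auto simp: \<kappa>_def)
  have \<kappa>\<iota>: "\<kappa> (\<iota> x) = x" if "x \<in> U" for x using bij_betw_inv_into_left[OF \<iota> that] by (simp add: \<kappa>_def)
  have \<iota>v: "\<iota> x \<in> vecs p d" if "x \<in> U" for x using bij_betw_apply[OF \<iota> that] .
  have \<iota>inj: "x = y" if "\<iota> x = \<iota> y" "x \<in> U" "y \<in> U" for x y using that \<kappa>\<iota> by metis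
  have oneU: "\<one> \<in> U" using subgroup.one_closed[OF U] .
  have \<iota>1: "\<iota> \<one> = vzero" using vadd_idem_zero[OF \<iota>v[OF oneU]] \<iota>add[OF oneU oneU] by simp
  have \<kappa>add: "\<kappa> (vadd p u v) = \<kappa> u \<otimes> \<kappa> v" if "u \<in> vecs p d" "v \<in> vecs p d" for u v
    using \<iota>add[of "\<kappa> u" "\<kappa> v"] \<kappa> that \<kappa>\<iota>[of "\<kappa> u \<otimes> \<kappa> v"] subgroup.m_closed[OF U] by simp
  \<comment> \<open>Coordinates are demanded on \<Gamma>, so those of \<open>U\<close> are pulled
    back along the coding \<open>b\<close>; the coding cancels in \<open>H'app\<close>.\<close>
  define \<phi> where "\<phi> = \<iota> \<circ> inv_into U b"
  have \<phi>: "bij_betw \<phi> \<Gamma> (vecs p d)"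
    unfolding \<phi>_def by (rule bij_betw_trans[OF bij_betw_inv_into[OF b] \<iota>])
  define H' where "H' = (\<lambda>h v. \<phi> (h (inv_into \<Gamma> \<phi> v))) ` ?H"
  have H'app: "\<phi> (transport U b h (inv_into \<Gamma> \<phi> v)) = \<iota> (h (\<kappa> v))"
    if h: "h \<in> induced_group U" and v: "v \<in> vecs p d" for h v
  proof -
    have "b (\<kappa> v) \<in> \<Gamma>" using bij_betw_apply[OF b \<kappa>(1)[OF v]] .
    moreover have ib: "inv_into U b (b x) = x" if "x \<in> U" for x using bij_betw_inv_into_left[OF b that] .
    moreover have "\<phi> (b (\<kappa> v)) = v" using ib[OF \<kappa>(1)[OF v]] \<kappa>(2)[OF v] by (simp add: \<phi>_def)
    ultimately have "inv_into \<Gamma> \<phi> v = b (\<kappa> v)" using bij_betw_inv_into_left[OF \<phi>] by metis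
    moreover have "transport U b h (b (\<kappa> v)) = b (h (\<kappa> v))"
      using transport_apply b \<kappa>(1)[OF v] by (metis bij_betw_def)
    moreover have "h (\<kappa> v) \<in> U" using perm_group_in[OF perm_group_induced h \<kappa>(1)[OF v]] .
    ultimately show ?thesis using ib by (simp add: \<phi>_def)
  qed
  have H'E: "\<exists>a k. a \<in> U \<and> k \<in> K \<and> k ` U = U \<and> (\<forall>v\<in>vecs p d. h v = \<iota> (a \<otimes> k (\<kappa> v)))"
    if "h \<in> H'" for h
  proof -
    obtain h' where h': "h' \<in> induced_group U" "h = (\<lambda>v. \<phi> (transport U b h' (inv_into \<Gamma> \<phi> v)))"
      using \<open>h \<in> H'\<close> by (auto simp: H'_def)
    obtain a k where "a \<in> U" "k \<in> K" "k ` U = U" "\<And>x. x \<in> U \<Longrightarrow> h' x = a \<otimes> k x"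
      using induced_group_affine[OF h'(1)] by blast
    then show ?thesis using H'app[OF h'(1)] h'(2) \<kappa> by auto
  qed
  have H'I: "\<exists>h\<in>H'. \<forall>v\<in>vecs p d. h v = \<iota> (a \<otimes> k (\<kappa> v))" if a: "a \<in> U" "k \<in> K" "k ` U = U" for a k
  proof -
    obtain h where h: "h \<in> induced_group U" "\<And>x. x \<in> U \<Longrightarrow> h x = a \<otimes> k x"
      using induced_group_member[OF a] by blast
    then have "(\<lambda>v. \<phi> (transport U b h (inv_into \<Gamma> \<phi> v))) \<in> H'" by (auto simp: H'_def)
    then show ?thesis using H'app[OF h(1)] h(2) \<kappa> by (metis (no_types, lifting))
  qed
  define K' where "K' = {k \<in> H'. k vzero = vzero}"
  have kU: "k x \<in> U" if "k ` U = U" "x \<in> U" for k x using that by blast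
  have K'I: "\<exists>h\<in>K'. \<forall>x\<in>U. h (\<iota> x) = \<iota> (k x)" if k: "k \<in> K" "k ` U = U" for k
  proof -
    obtain h where h: "h \<in> H'" "\<And>v. v \<in> vecs p d \<Longrightarrow> h v = \<iota> (\<one> \<otimes> k (\<kappa> v))"
      using H'I[OF oneU k] by blast
    have hx: "h (\<iota> x) = \<iota> (k x)" if "x \<in> U" for x
      using h(2)[OF \<iota>v[OF that]] \<kappa>\<iota>[OF that] K_in[OF k(1) U_carrier[OF that]] by simp
    then have "h vzero = vzero" using oneU \<iota>1 K_one[OF k(1)] by metis
    then show ?thesis using h(1) hx by (auto simp: K'_def)
  qed
  have A1: "affine_Fp p d h" if h: "h \<in> H'" for h
  proof -
    obtain a k where ak: "a \<in> U" "k \<in> K" "k ` U = U" "\<And>v. v \<in> vecs p d \<Longrightarrow> h v = \<iota> (a \<otimes> k (\<kappa> v))"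
      using H'E[OF h] by blast
    let ?A = "\<lambda>v. \<iota> (k (\<kappa> v))"
    have "linear_Fp p d ?A"
    proof (rule additive_imp_linear_Fp[OF p0])
      show "?A ` vecs p d \<subseteq> vecs p d" using \<iota>v kU[OF ak(3)] \<kappa> by auto
      show "?A (vadd p u v) = vadd p (?A u) (?A v)" if "u \<in> vecs p d" "v \<in> vecs p d" for u v
        using that \<kappa>add K_mult[OF ak(2)] \<kappa> U_carrier \<iota>add kU[OF ak(3)] by simp
    qed
    moreover have "bij_betw ?A (vecs p d) (vecs p d)"
    proof -
      have "bij_betw k U U" using ak(3) inj_on_subset[OF K_inj[OF ak(2)]] by (auto simp: bij_betw_def)
      then have "bij_betw (\<iota> \<circ> (k \<circ> \<kappa>)) (vecs p d) (vecs p d)"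
        unfolding \<kappa>_def using bij_betw_inv_into[OF \<iota>] \<iota> by (meson bij_betw_trans)
      then show ?thesis by (simp add: o_def)
    qed
    moreover have "h v = vadd p (?A v) (\<iota> a)" if v: "v \<in> vecs p d" for v
    proof -
      have "h v = \<iota> (k (\<kappa> v) \<otimes> a)"
        using ak(4)[OF v] m_comm[OF U_carrier[OF ak(1)] U_carrier[OF kU[OF ak(3) \<kappa>(1)[OF v]]]] by simp
      then show ?thesis using \<iota>add[OF kU[OF ak(3) \<kappa>(1)[OF v]] ak(1)] by simp
    qed
    ultimately show ?thesis unfolding affine_Fp_def using \<iota>v[OF ak(1)] by blast
  qed
  have A2: "\<exists>h\<in>H'. \<forall>v\<in>vecs p d. h v = vadd p v c" if c: "c \<in> vecs p d" for c
  proof -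
    obtain h where h: "h \<in> H'" "\<And>v. v \<in> vecs p d \<Longrightarrow> h v = \<iota> (\<kappa> c \<otimes> id (\<kappa> v))"
      using H'I[OF \<kappa>(1)[OF c] K_id] by auto
    have "h v = vadd p v c" if v: "v \<in> vecs p d" for v
      using h(2)[OF v] m_comm[OF U_carrier[OF \<kappa>(1)[OF c]] U_carrier[OF \<kappa>(1)[OF v]]]
        \<iota>add[OF \<kappa>(1)[OF v] \<kappa>(1)[OF c]] \<kappa> c v by simp
    then show ?thesis using h(1) by blast
  qed
  have sub: "subgroup {x \<in> U. \<iota> x \<in> W} V" if W: "subspace_Fp p d W" for W
  proof (rule subgroup_of_exponent[OF _ _ _ p0])
    show "x \<otimes> y \<in> {x \<in> U. \<iota> x \<in> W}" if "x \<in> {x \<in> U. \<iota> x \<in> W}" "y \<in> {x \<in> U. \<iota> x \<in> W}" for x y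
      using that W subgroup.m_closed[OF U] \<iota>add by (auto simp: subspace_Fp_def)
    show "\<one> \<in> {x \<in> U. \<iota> x \<in> W}" using oneU \<iota>1 W by (auto simp: subspace_Fp_def)
  qed (use U_carrier exponent in auto)
  have A3: "irreducible_Fp p d K'"
    unfolding irreducible_Fp_def
  proof (intro allI impI)
    fix W assume W: "subspace_Fp p d W \<and> (\<forall>k\<in>K'. k ` W \<subseteq> W)"
    let ?W = "{x \<in> U. \<iota> x \<in> W}"
    have WV: "W \<subseteq> vecs p d" using W by (auto simp: subspace_Fp_def)
    have "k ` ?W \<subseteq> ?W" if k: "k \<in> K" "k ` U = U" for k
    proof -
      obtain h where h: "h \<in> K'" "\<And>x. x \<in> U \<Longrightarrow> h (\<iota> x) = \<iota> (k x)" using K'I[OF k] by blast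
      show ?thesis
      proof
        fix y assume "y \<in> k ` ?W"
        then obtain x where x: "x \<in> U" "\<iota> x \<in> W" "y = k x" by blast
        then have "h (\<iota> x) \<in> W" using W h(1) by blast
        then show "y \<in> ?W" using x h(2)[OF x(1)] kU[OF k(2) x(1)] by simp
      qed
    qed
    then have "?W = {\<one>} \<or> ?W = U" using irr[OF sub, of W] W by blast
    moreover have "W = \<iota> ` ?W"
    proof
      show "W \<subseteq> \<iota> ` ?W"
      proof
        fix v assume v: "v \<in> W"
        then have "v \<in> vecs p d" using WV by blast
        then show "v \<in> \<iota> ` ?W" using v \<kappa>[of v] by (intro image_eqI[of _ _ "\<kappa> v"]) auto
      qed
    qed auto
    moreover have "\<iota> ` U = vecs p d" using \<iota> by (simp add: bij_betw_def)
    ultimately show "W = {vzero} \<or> W = vecs p d" using \<iota>1 by auto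
  qed
  have A4: "primitive_linear_Fp p d K'"
    unfolding primitive_linear_Fp_def
  proof
    assume "\<exists>t V. t > 1 \<and> direct_decomp p d t V \<and> (\<forall>k\<in>K'. \<forall>i<t. \<exists>j<t. k ` V i = V j)"
    then obtain t Vs where t: "t > 1" and dd: "direct_decomp p d t Vs"
      and kV: "\<And>k i. k \<in> K' \<Longrightarrow> i < t \<Longrightarrow> \<exists>j<t. k ` Vs i = Vs j" by blast
    have sV: "subspace_Fp p d (Vs i)" "Vs i \<noteq> {vzero}" if "i < t" for i
      using dd that by (auto simp: direct_decomp_def)
    define e where "e i = {x \<in> U. \<iota> x \<in> Vs i}" for i
    have es: "subgroup (e i) V" if "i < t" for i unfolding e_def by (rule sub[OF sV(1)[OF that]])
    have eU: "e i \<subseteq> U" for i by (auto simp: e_def)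
    have Ve: "Vs i = \<iota> ` e i" if i: "i < t" for i
    proof
      show "Vs i \<subseteq> \<iota> ` e i"
      proof
        fix v assume v: "v \<in> Vs i"
        then have "v \<in> vecs p d" using sV(1)[OF i] by (auto simp: subspace_Fp_def)
        then show "v \<in> \<iota> ` e i" using v \<kappa>[of v] by (intro image_eqI[of _ _ "\<kappa> v"]) (auto simp: e_def)
      qed
    qed (auto simp: e_def)
    have fs: "finprod V w {..<n} \<in> U \<and> \<iota> (finprod V w {..<n}) = vsum p (\<lambda>i. \<iota> (w i)) n"
      if "\<And>i. i < n \<Longrightarrow> w i \<in> U" for w and n :: nat
      using that
    proof (induction n)
      case 0
      then show ?case using oneU \<iota>1 by simp
    next
      case (Suc n)
      have IH: "finprod V w {..<n} \<in> U" "\<iota> (finprod V w {..<n}) = vsum p (\<lambda>i. \<iota> (w i)) n"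
        using Suc by auto
      have wn: "w n \<in> U" using Suc.prems by simp
      have "finprod V w {..<Suc n} = w n \<otimes> finprod V w {..<n}"
        unfolding lessThan_Suc using Suc.prems U_carrier by (intro finprod_insert) auto
      also have "\<dots> = finprod V w {..<n} \<otimes> w n" using m_comm U_carrier wn IH(1) by simp
      finally show ?case using IH wn \<iota>add subgroup.m_closed[OF U] by simp
    qed
    have ex: "\<exists>w. (\<forall>i<t. w i \<in> e i) \<and> finprod V w {..<t} = x" if x: "x \<in> U" for x
    proof -
      obtain w where w: "w \<in> Pi\<^sub>E {..<t} Vs" "vsum p w t = \<iota> x"
        using dd \<iota>v[OF x] unfolding direct_decomp_def by blast
      have wi: "w i \<in> vecs p d" "w i \<in> Vs i" if "i < t" for i
        using w(1) sV(1)[OF that] that by (auto simp: subspace_Fp_def PiE_iff)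
      have ke: "\<kappa> (w i) \<in> e i" if "i < t" for i using wi[OF that] \<kappa> by (auto simp: e_def)
      then have "finprod V (\<lambda>i. \<kappa> (w i)) {..<t} \<in> U"
        "\<iota> (finprod V (\<lambda>i. \<kappa> (w i)) {..<t}) = vsum p (\<lambda>i. \<iota> (\<kappa> (w i))) t"
        using fs[of t "\<lambda>i. \<kappa> (w i)"] eU by blast+
      moreover have "vsum p (\<lambda>i. \<iota> (\<kappa> (w i))) t = vsum p w t" using wi \<kappa> by (intro vsum_cong) auto
      ultimately have "finprod V (\<lambda>i. \<kappa> (w i)) {..<t} = x" using w(2) x by (intro \<iota>inj) auto
      then show ?thesis using ke by (intro exI[of _ "\<lambda>i. \<kappa> (w i)"]) auto
    qed
    have uniq: "w i = w' i" if w: "\<And>i. i < t \<Longrightarrow> w i \<in> e i" and w': "\<And>i. i < t \<Longrightarrow> w' i \<in> e i"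
      and eq: "finprod V w {..<t} = finprod V w' {..<t}" and i: "i < t" for w w' i
    proof -
      \<comment> \<open>Restriction makes the families extensional, as required to use the unique
        existence over \<open>Pi\<^sub>E\<close> in \<open>direct_decomp\<close>.\<close>
      let ?r = "\<lambda>w. restrict (\<lambda>i. \<iota> (w i)) {..<t}"
      have r: "?r w \<in> Pi\<^sub>E {..<t} Vs \<and> vsum p (?r w) t = \<iota> (finprod V w {..<t}) \<and> finprod V w {..<t} \<in> U"
        if "\<And>i. i < t \<Longrightarrow> w i \<in> e i" for w
      proof -
        have "vsum p (?r w) t = vsum p (\<lambda>i. \<iota> (w i)) t" by (intro vsum_cong) auto
        moreover have "\<And>i. i < t \<Longrightarrow> w i \<in> U" using that eU by blast
        ultimately show ?thesis using fs[of t w] that by (auto simp: e_def)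
      qed
      have "\<exists>!v. v \<in> Pi\<^sub>E {..<t} Vs \<and> vsum p v t = \<iota> (finprod V w {..<t})"
        using dd \<iota>v r[OF w] unfolding direct_decomp_def by blast
      then have "?r w = ?r w'" using r[OF w] r[OF w'] eq by metis
      then have "\<iota> (w i) = \<iota> (w' i)" using i by (metis lessThan_iff restrict_apply')
      then show ?thesis using \<iota>inj w[OF i] w'[OF i] eU by blast
    qed
    have ent: "e i \<noteq> {\<one>}" if "i < t" for i using Ve[OF that] sV(2)[OF that] \<iota>1 by auto
    \<comment> \<open>Passing from an indexed family to a set must not merge summands. If
      \<open>e i = e j\<close>, a nontrivial \<open>x\<close> could be placed at \<open>i\<close> or
      at \<open>j\<close> with the same product, against uniqueness.\<close>
    have inj: "inj_on e {..<t}"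
    proof (rule inj_onI)
      fix i j assume i: "i \<in> {..<t}" and j: "j \<in> {..<t}" and eq: "e i = e j"
      have "\<one> \<in> e i" using es i subgroup.one_closed by auto
      then obtain x where x: "x \<in> e i" "x \<noteq> \<one>" using ent i by blast
      let ?w = "\<lambda>i k. if k = i then x else \<one>"
      have xc: "x \<in> carrier V" using x eU U_carrier by blast
      have fp: "finprod V (?w k) {..<t} = x" if "k \<in> {..<t}" for k
        using finprod_singleton_swap[OF that finite_lessThan, of "\<lambda>_. x"] xc by simp
      have we: "?w k l \<in> e l" if "x \<in> e k" "l < t" for k l
        using that es[OF that(2)] subgroup.one_closed by auto
      have "?w i i = ?w j i" using uniq[of "?w i" "?w j" i] we x eq fp i j by auto
      then show "i = j" using x(2) by (auto split: if_splits)
    qed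
    define E where "E = e ` {..<t}"
    have wE: "w \<in> E \<rightarrow> carrier V" "\<And>i. i < t \<Longrightarrow> w (e i) \<in> e i" if w: "w \<in> Pi E (\<lambda>U. U)" for w
    proof -
      show we: "\<And>i. i < t \<Longrightarrow> w (e i) \<in> e i" using w by (auto simp: E_def Pi_def)
      show "w \<in> E \<rightarrow> carrier V" using we eU U_carrier unfolding E_def by blast
    qed
    have fE: "finprod V w E = finprod V (\<lambda>i. w (e i)) {..<t}" if "w \<in> Pi E (\<lambda>U. U)" for w
      unfolding E_def using finprod_reindex[OF wE(1)[OF that, unfolded E_def] inj] .
    have one: "finprod V (\<lambda>i. \<one>) {..<t} = \<one>" by simp
    have "direct_sum V U E"
      unfolding direct_sum_def
    proof (intro conjI ballI impI)
      show "finite E" by (simp add: E_def)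
      show "subgroup W V" "W \<subseteq> U" if "W \<in> E" for W using that es eU by (auto simp: E_def)
    next
      fix w W assume w: "w \<in> Pi E (\<lambda>U. U)" "finprod V w E = \<one>" and "W \<in> E"
      then obtain i where i: "i < t" "W = e i" by (auto simp: E_def)
      have "w (e i) = \<one>"
      proof (rule uniq[of "\<lambda>i. w (e i)" "\<lambda>_. \<one>" i])
        show "w (e l) \<in> e l" if "l < t" for l using wE(2)[OF w(1) that] .
        show "\<one> \<in> e l" if "l < t" for l using subgroup.one_closed[OF es[OF that]] .
        show "finprod V (\<lambda>i. w (e i)) {..<t} = finprod V (\<lambda>_. \<one>) {..<t}"
          using fE[OF w(1)] w(2) one by simp
      qed (rule i(1))
      then show "w W = \<one>" using i by simp
    next
      fix x assume "x \<in> U"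
      then obtain w where w: "\<And>i. i < t \<Longrightarrow> w i \<in> e i" "finprod V w {..<t} = x" using ex by blast
      define v where "v W = w (inv_into {..<t} e W)" for W
      have ve: "v (e i) = w i" if "i < t" for i using inv_into_f_f[OF inj, of i] that by (simp add: v_def)
      have vPi: "v \<in> Pi E (\<lambda>U. U)" using ve w(1) by (auto simp: E_def)
      have "finprod V (\<lambda>i. v (e i)) {..<t} = finprod V w {..<t}"
        using ve U_carrier[OF subsetD[OF eU w(1)]] by (intro finprod_cong') auto
      then have "finprod V v E = x" using fE[OF vPi] w(2) by simp
      then show "\<exists>w\<in>Pi E (\<lambda>U. U). finprod V w E = x" using vPi by blast
    qed
    moreover have "{\<one>} \<notin> E" using ent by (auto simp: E_def)
    moreover have "k ` W \<in> E" if k: "k \<in> K" "k ` U = U" and "W \<in> E" for k W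
    proof -
      obtain i where i: "i < t" "W = e i" using \<open>W \<in> E\<close> by (auto simp: E_def)
      obtain h where h: "h \<in> K'" "\<And>x. x \<in> U \<Longrightarrow> h (\<iota> x) = \<iota> (k x)" using K'I[OF k] by blast
      obtain j where j: "j < t" "h ` Vs i = Vs j" using kV[OF h(1) i(1)] by blast
      have "\<iota> ` e j = h ` \<iota> ` e i" using Ve i(1) j by simp
      also have "\<dots> = \<iota> ` k ` e i" unfolding image_image using h(2) eU by (intro image_cong) auto
      finally have "\<iota> ` e j = \<iota> ` (k ` e i)" .
      moreover have "k ` e i \<subseteq> U" using eU kU[OF k(2)] by blast
      moreover have "inj_on \<iota> U" using \<iota> by (simp add: bij_betw_def)
      ultimately have "e j = k ` e i" using eU inj_on_image_eq_iff by metis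
      then show ?thesis using i j by (auto simp: E_def)
    qed
    ultimately have "card E \<le> 1" by (rule prim)
    moreover have "card E = t" unfolding E_def using card_image[OF inj] by simp
    ultimately show False using t by simp
  qed
  have "(\<forall>h\<in>H'. affine_Fp p d h) \<and> (\<forall>c\<in>vecs p d. \<exists>h\<in>H'. \<forall>v\<in>vecs p d. h v = vadd p v c) \<and>
      irreducible_Fp p d K' \<and> primitive_linear_Fp p d K'"
    by (intro conjI ballI A1 A2 A3 A4)
  then have "let H' = (\<lambda>h v. \<phi> (h (inv_into \<Gamma> \<phi> v))) ` ?H; K = {k \<in> H'. k vzero = vzero}
     in (\<forall>h\<in>H'. affine_Fp p d h) \<and> (\<forall>c\<in>vecs p d. \<exists>h\<in>H'. \<forall>v\<in>vecs p d. h v = vadd p v c) \<and>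
        irreducible_Fp p d K \<and> primitive_linear_Fp p d K"
    unfolding Let_def K'_def H'_def .
  then show ?thesis
    unfolding linearly_primitive_scheme_def
    by (intro conjI exI[of _ ?H] exI[of _ p] exI[of _ d] exI[of _ \<phi>] sch pH fin prH sH refl prime \<phi>)
qed

end

end

end

section \<open>Exponentiation as the orbitals of a wreath product in product action\<close>

text \<open>An element of the wreath product in product action, with the convention of
  \<open>coord_perm\<close>: coordinate \<open>i\<close> reads coordinate \<open>l i\<close>, and
  then \<open>h i\<close> acts.\<close>

definition wreath_map :: "'b set \<Rightarrow> nat \<Rightarrow> (nat \<Rightarrow> 'b \<Rightarrow> 'b) \<Rightarrow> (nat \<Rightarrow> nat) \<Rightarrow> (nat \<Rightarrow> 'b) \<Rightarrow> nat \<Rightarrow> 'b" where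
  "wreath_map \<Gamma> m h l \<alpha> = (if \<alpha> \<in> expo_points \<Gamma> m then \<lambda>i\<in>{..<m}. h i (\<alpha> (l i)) else \<alpha>)"

definition wreath :: "'b set \<Rightarrow> nat \<Rightarrow> ('b \<Rightarrow> 'b) set \<Rightarrow> (nat \<Rightarrow> nat) set \<Rightarrow> ((nat \<Rightarrow> 'b) \<Rightarrow> nat \<Rightarrow> 'b) set" where
  "wreath \<Gamma> m H L = {wreath_map \<Gamma> m h l | h l. (\<forall>i<m. h i \<in> H) \<and> l \<in> L}"

lemma finite_expo_points: "finite \<Gamma> \<Longrightarrow> finite (expo_points \<Gamma> m)"
  by (simp add: expo_points_def finite_PiE)

lemma expo_points_apply: "\<alpha> \<in> expo_points \<Gamma> m \<Longrightarrow> i < m \<Longrightarrow> \<alpha> i \<in> \<Gamma>"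
  by (auto simp: expo_points_def)

lemma expo_points_restrict: "(\<And>i. i < m \<Longrightarrow> \<alpha> i \<in> \<Gamma>) \<Longrightarrow> restrict \<alpha> {..<m} \<in> expo_points \<Gamma> m"
  by (auto simp: expo_points_def)

lemma expo_points_eqI:
  "\<alpha> \<in> expo_points \<Gamma> m \<Longrightarrow> \<beta> \<in> expo_points \<Gamma> m \<Longrightarrow> (\<And>i. i < m \<Longrightarrow> \<alpha> i = \<beta> i) \<Longrightarrow> \<alpha> = \<beta>"
  unfolding expo_points_def by (rule PiE_ext) auto

context
  fixes \<Gamma> :: "'b set" and H :: "('b \<Rightarrow> 'b) set" and m :: nat and L :: "(nat \<Rightarrow> nat) set"
  assumes fin: "finite \<Gamma>" and H: "perm_group \<Gamma> H" and L: "perm_group {..<m} L"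
begin

lemma L_in: "l \<in> L \<Longrightarrow> i < m \<Longrightarrow> l i < m"
  using perm_group_in[OF L] by simp

lemma wreath_map_in:
  assumes "\<And>i. i < m \<Longrightarrow> h i \<in> H" "l \<in> L" "\<alpha> \<in> expo_points \<Gamma> m"
  shows "wreath_map \<Gamma> m h l \<alpha> \<in> expo_points \<Gamma> m"
proof -
  have "h i (\<alpha> (l i)) \<in> \<Gamma>" if "i < m" for i
    using perm_group_in[OF H assms(1)[OF that] expo_points_apply[OF assms(3) L_in[OF assms(2) that]]] .
  then show ?thesis using assms(3) by (simp add: wreath_map_def expo_points_restrict)
qed

lemma perm_group_wreath: "perm_group (expo_points \<Gamma> m) (wreath \<Gamma> m H L)"
proof (rule perm_group_finiteI[OF finite_expo_points[OF fin]])
  let ?P = "expo_points \<Gamma> m"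
  fix g assume "g \<in> wreath \<Gamma> m H L"
  then obtain h l where g: "g = wreath_map \<Gamma> m h l" "\<And>i. i < m \<Longrightarrow> h i \<in> H" "l \<in> L"
    by (auto simp: wreath_def)
  have "inj_on g ?P"
  proof (rule inj_onI)
    fix \<alpha> \<beta> assume ab: "\<alpha> \<in> ?P" "\<beta> \<in> ?P" "g \<alpha> = g \<beta>"
    have li: "\<alpha> (l i) = \<beta> (l i)" if i: "i < m" for i
    proof -
      have "g \<alpha> i = g \<beta> i" using ab by simp
      then have "h i (\<alpha> (l i)) = h i (\<beta> (l i))" using ab i by (simp add: g wreath_map_def)
      then show ?thesis using perm_group_bij[OF H g(2)[OF i]] by (simp add: bij_is_inj inj_eq)
    qed
    show "\<alpha> = \<beta>"
    proof (rule expo_points_eqI[OF ab(1,2)])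
      fix j assume "j < m"
      then obtain i where "i < m" "j = l i" using perm_group_bij_betw[OF L g(3)] by (auto simp: bij_betw_def)
      then show "\<alpha> j = \<beta> j" using li by simp
    qed
  qed
  moreover have "g ` ?P \<subseteq> ?P" using wreath_map_in[OF g(2,3)] g(1) by auto
  ultimately show "bij_betw g ?P ?P"
    using endo_inj_surj[OF finite_expo_points[OF fin]] by (simp add: bij_betw_def)
  show "g x = x" if "x \<notin> ?P" for x using that g(1) by (simp add: wreath_map_def)
  fix g' assume "g' \<in> wreath \<Gamma> m H L"
  then obtain h' l' where g': "g' = wreath_map \<Gamma> m h' l'" "\<And>i. i < m \<Longrightarrow> h' i \<in> H" "l' \<in> L"
    by (auto simp: wreath_def)
  \<comment> \<open>Precomposing with \<open>l\<close> is a right action, so the index permutations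
    multiply in reverse order and \<open>h'\<close> is read at \<open>l i\<close>.\<close>
  have "g \<circ> g' = wreath_map \<Gamma> m (\<lambda>i. h i \<circ> h' (l i)) (l' \<circ> l)"
  proof
    fix \<alpha>
    show "(g \<circ> g') \<alpha> = wreath_map \<Gamma> m (\<lambda>i. h i \<circ> h' (l i)) (l' \<circ> l) \<alpha>"
    proof (cases "\<alpha> \<in> ?P")
      case True
      have "g' \<alpha> \<in> ?P" using wreath_map_in[OF g'(2,3) True] g'(1) by simp
      then have "g (g' \<alpha>) = (\<lambda>i\<in>{..<m}. h i (g' \<alpha> (l i)))" by (simp add: g(1) wreath_map_def)
      also have "\<dots> = (\<lambda>i\<in>{..<m}. h i (h' (l i) (\<alpha> (l' (l i)))))"
        using True L_in[OF g(3)] by (intro restrict_ext) (simp add: g'(1) wreath_map_def)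
      finally show ?thesis using True by (simp add: wreath_map_def)
    qed (simp add: g g' wreath_map_def)
  qed
  moreover have "h i \<circ> h' (l i) \<in> H" if "i < m" for i
    using perm_group_comp[OF H g(2)[OF that] g'(2)[OF L_in[OF g(3) that]]] .
  moreover have "l' \<circ> l \<in> L" using perm_group_comp[OF L g'(3) g(3)] .
  ultimately show "g \<circ> g' \<in> wreath \<Gamma> m H L" unfolding wreath_def by blast
next
  have "wreath_map \<Gamma> m (\<lambda>_. id) id \<alpha> = \<alpha>" for \<alpha>
    by (simp add: wreath_map_def expo_points_def PiE_def extensional_restrict)
  then have "wreath_map \<Gamma> m (\<lambda>_. id) id = id" by (simp add: fun_eq_iff)
  moreover have "wreath_map \<Gamma> m (\<lambda>_. id) id \<in> wreath \<Gamma> m H L"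
    unfolding wreath_def using perm_group_id[OF H] perm_group_id[OF L] by blast
  ultimately show "id \<in> wreath \<Gamma> m H L" by simp
qed

text \<open>Independent action of \<open>H\<close> in every coordinate sweeps out a tensor relation,
  and \<open>L\<close> contributes the union. \<open>wreath_map\<close> permutes before acting
  whereas \<open>rel_perm\<close> permutes afterwards, so the family \<open>h\<close> is reindexed
  by \<open>l\<close> in one direction and by its inverse in the other.\<close>

lemma wreath_orbital:
  assumes \<alpha>: "\<alpha> \<in> expo_points \<Gamma> m" and \<beta>: "\<beta> \<in> expo_points \<Gamma> m"
    and ts: "\<And>i. i < m \<Longrightarrow> ts i = orbital H (\<alpha> i) (\<beta> i)"
  shows "(\<Union>l\<in>L. rel_perm m l (tensor_rel \<Gamma> m ts)) = orbital (wreath \<Gamma> m H L) \<alpha> \<beta>"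
proof (intro equalityI subsetI)
  fix z assume "z \<in> (\<Union>l\<in>L. rel_perm m l (tensor_rel \<Gamma> m ts))"
  then obtain l \<gamma> \<delta> where l: "l \<in> L" and cd: "(\<gamma>, \<delta>) \<in> tensor_rel \<Gamma> m ts"
    and z: "z = (coord_perm m l \<gamma>, coord_perm m l \<delta>)" by (auto simp: rel_perm_def)
  have "\<forall>i. i < m \<longrightarrow> (\<exists>h. h \<in> H \<and> \<gamma> i = h (\<alpha> i) \<and> \<delta> i = h (\<beta> i))"
    using cd ts by (auto simp: tensor_rel_def orbital_def)
  then obtain h where h: "\<And>i. i < m \<Longrightarrow> h i \<in> H \<and> \<gamma> i = h i (\<alpha> i) \<and> \<delta> i = h i (\<beta> i)" by metis
  have "coord_perm m l \<gamma> = wreath_map \<Gamma> m (\<lambda>i. h (l i)) l \<alpha>"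
    "coord_perm m l \<delta> = wreath_map \<Gamma> m (\<lambda>i. h (l i)) l \<beta>"
    using \<alpha> \<beta> h L_in[OF l] by (auto simp: coord_perm_def wreath_map_def intro!: restrict_ext)
  moreover have "wreath_map \<Gamma> m (\<lambda>i. h (l i)) l \<in> wreath \<Gamma> m H L"
    unfolding wreath_def using h L_in[OF l] l by blast
  ultimately show "z \<in> orbital (wreath \<Gamma> m H L) \<alpha> \<beta>" using z by (auto simp: orbital_def)
next
  fix z assume "z \<in> orbital (wreath \<Gamma> m H L) \<alpha> \<beta>"
  then obtain h l where h: "\<And>i. i < m \<Longrightarrow> h i \<in> H" and l: "l \<in> L"
    and z: "z = (wreath_map \<Gamma> m h l \<alpha>, wreath_map \<Gamma> m h l \<beta>)" by (auto simp: orbital_def wreath_def)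
  let ?l = "inv_into UNIV l"
  have lm: "?l i < m" if "i < m" for i using L_in[OF perm_group_inv[OF L l] that] .
  \<comment> \<open>With \<open>h\<close> reindexed by the inverse of \<open>l\<close>, permuting
    after \<open>act\<close> agrees with \<open>wreath_map\<close>.\<close>
  define act where "act \<xi> = (\<lambda>i\<in>{..<m}. h (?l i) (\<xi> i))" for \<xi>
  have act: "act \<xi> \<in> expo_points \<Gamma> m" "coord_perm m l (act \<xi>) = wreath_map \<Gamma> m h l \<xi>"
    if \<xi>: "\<xi> \<in> expo_points \<Gamma> m" for \<xi>
  proof -
    show "act \<xi> \<in> expo_points \<Gamma> m"
      unfolding act_def using perm_group_in[OF H h[OF lm] expo_points_apply[OF \<xi>]] by (intro expo_points_restrict)
    show "coord_perm m l (act \<xi>) = wreath_map \<Gamma> m h l \<xi>"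
      using \<xi> L_in[OF l] perm_group_inv_f[OF L l]
      by (auto simp: coord_perm_def wreath_map_def act_def intro!: restrict_ext)
  qed
  have "(act \<alpha>, act \<beta>) \<in> tensor_rel \<Gamma> m ts"
    using act(1)[OF \<alpha>] act(1)[OF \<beta>] h lm
    by (auto simp: tensor_rel_def expo_points_def[symmetric] ts orbital_def act_def)
  then have "z \<in> rel_perm m l (tensor_rel \<Gamma> m ts)"
    unfolding rel_perm_def using z act(2)[OF \<alpha>] act(2)[OF \<beta>] by force
  then show "z \<in> (\<Union>l\<in>L. rel_perm m l (tensor_rel \<Gamma> m ts))" using l by blast
qed

text \<open>Representative pairs of the factors \<open>ts i\<close>, collected coordinatewise, form
  a pair of points of the power whose orbital is the exponentiation relation.\<close>

lemma expo_rels_Inv: "expo_rels \<Gamma> (Inv \<Gamma> H) m L = Inv (expo_points \<Gamma> m) (wreath \<Gamma> m H L)"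
proof (intro equalityI subsetI)
  fix s assume "s \<in> expo_rels \<Gamma> (Inv \<Gamma> H) m L"
  then obtain ts where ts: "\<And>i. i < m \<Longrightarrow> ts i \<in> Inv \<Gamma> H"
    and s: "s = (\<Union>l\<in>L. rel_perm m l (tensor_rel \<Gamma> m ts))" by (auto simp: expo_rels_def)
  have "\<forall>i. \<exists>a b. i < m \<longrightarrow> a \<in> \<Gamma> \<and> b \<in> \<Gamma> \<and> ts i = orbital H a b" using ts unfolding Inv_orbital by blast
  then obtain \<alpha> \<beta> where ab: "\<And>i. i < m \<Longrightarrow> \<alpha> i \<in> \<Gamma> \<and> \<beta> i \<in> \<Gamma> \<and> ts i = orbital H (\<alpha> i) (\<beta> i)" by metis
  let ?\<alpha> = "restrict \<alpha> {..<m}" and ?\<beta> = "restrict \<beta> {..<m}"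
  have "?\<alpha> \<in> expo_points \<Gamma> m" "?\<beta> \<in> expo_points \<Gamma> m" using ab by (auto intro: expo_points_restrict)
  moreover from this have "s = orbital (wreath \<Gamma> m H L) ?\<alpha> ?\<beta>"
    unfolding s using ab by (intro wreath_orbital) auto
  ultimately show "s \<in> Inv (expo_points \<Gamma> m) (wreath \<Gamma> m H L)" by (auto simp: Inv_orbital)
next
  fix s assume "s \<in> Inv (expo_points \<Gamma> m) (wreath \<Gamma> m H L)"
  then obtain \<alpha> \<beta> where ab: "\<alpha> \<in> expo_points \<Gamma> m" "\<beta> \<in> expo_points \<Gamma> m"
    "s = orbital (wreath \<Gamma> m H L) \<alpha> \<beta>" by (auto simp: Inv_orbital)
  let ?ts = "\<lambda>i. orbital H (\<alpha> i) (\<beta> i)"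
  have "s = (\<Union>l\<in>L. rel_perm m l (tensor_rel \<Gamma> m ?ts))" using wreath_orbital[OF ab(1,2), of ?ts] ab(3) by simp
  moreover have "?ts i \<in> Inv \<Gamma> H" if "i < m" for i
    using expo_points_apply[OF ab(1) that] expo_points_apply[OF ab(2) that] by (auto simp: Inv_orbital)
  ultimately show "s \<in> expo_rels \<Gamma> (Inv \<Gamma> H) m L" unfolding expo_rels_def by blast
qed

end

section \<open>Embedding into the wreath product\<close>

text \<open>\<open>e\<close> numbers the summands, \<open>ks i\<close> identifies \<open>U\<close>
  with the summand \<open>e i\<close>, and \<open>b\<close> renames the elements of
  \<open>U\<close>.\<close>

locale component_coordinates = affine_perm_group V G p
  for V :: "'a monoid" (structure) and G :: "('a \<Rightarrow> 'a) set" and p :: nat +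
  fixes D :: "'a set set" and U :: "'a set" and m :: nat and e :: "nat \<Rightarrow> 'a set"
    and ks :: "nat \<Rightarrow> 'a \<Rightarrow> 'a" and b :: "'a \<Rightarrow> 'b" and \<Gamma> :: "'b set"
  assumes D: "direct_sum V (carrier V) D" and permD: "permuted D" and U: "subgroup U V"
    and e: "bij_betw e {..<m} D"
    and ks: "\<And>i. i < m \<Longrightarrow> ks i \<in> K" "\<And>i. i < m \<Longrightarrow> ks i ` U = e i"
    and b: "bij_betw b U \<Gamma>"
begin

definition H :: "('b \<Rightarrow> 'b) set" where
  "H = transport U b ` induced_group U"

text \<open>The group that \<open>K\<close> induces on the indices of the summands. Each
  \<open>l\<close> is inverse to the action of its \<open>k\<close>, because in
  \<open>wreath_map\<close> coordinate \<open>i\<close> is computed from coordinate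
  \<open>l i\<close>.\<close>

definition L :: "(nat \<Rightarrow> nat) set" where
  "L = {l. bij_betw l {..<m} {..<m} \<and> (\<forall>i. i \<notin> {..<m} \<longrightarrow> l i = i) \<and>
    (\<exists>k\<in>K. \<forall>i<m. k ` e (l i) = e i)}"

definition decode :: "'b \<Rightarrow> 'a" where
  "decode = inv_into U b"

definition point_of :: "(nat \<Rightarrow> 'b) \<Rightarrow> 'a" where
  "point_of \<alpha> = finprod V (\<lambda>i. ks i (decode (\<alpha> i))) {..<m}"

lemma decode_in: "a \<in> \<Gamma> \<Longrightarrow> decode a \<in> U" and code_decode: "a \<in> \<Gamma> \<Longrightarrow> b (decode a) = a" and decode_code: "x \<in> U \<Longrightarrow> decode (b x) = x"
  unfolding decode_def using bij_betw_apply[OF bij_betw_inv_into[OF b]] bij_betw_inv_into_right[OF b]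
    bij_betw_inv_into_left[OF b] by auto

lemma code_in: "x \<in> U \<Longrightarrow> b x \<in> \<Gamma>"
  using bij_betw_apply[OF b] .

lemma finite_\<Gamma>: "finite \<Gamma>"
  using b finite_U[OF U] by (metis bij_betw_finite)

lemma e_in: "i < m \<Longrightarrow> e i \<in> D"
  using bij_betw_apply[OF e] by simp

lemma e_inj: "i < m \<Longrightarrow> j < m \<Longrightarrow> e i = e j \<Longrightarrow> i = j"
  using e by (auto simp: bij_betw_def dest: inj_onD)

lemma e_surj: "E \<in> D \<Longrightarrow> \<exists>i<m. e i = E"
  using e by (auto simp: bij_betw_def)

lemma ks_U: "i < m \<Longrightarrow> x \<in> U \<Longrightarrow> ks i x \<in> e i" "i < m \<Longrightarrow> x \<in> U \<Longrightarrow> ks i x \<in> carrier V"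
  using ks(2)[of i] K_in[OF ks(1)[of i] U_carrier[OF U, of x]] by auto

lemma perm_group_H: "perm_group \<Gamma> H"
  unfolding H_def by (rule perm_group_transport[OF finite_U[OF U] perm_group_induced[OF U] b])

lemma K_imp_L:
  assumes k: "k \<in> K" obtains l where "l \<in> L" "\<And>i. i < m \<Longrightarrow> k ` e (l i) = e i"
proof -
  have "\<exists>j<m. e j = inv_into UNIV k ` e i" if "i < m" for i
    by (rule e_surj) (use permD K_inv[OF k] e_in[OF that] in \<open>simp add: permuted_def\<close>)
  then obtain j where j: "\<And>i. i < m \<Longrightarrow> j i < m \<and> e (j i) = inv_into UNIV k ` e i" by metis
  define l where "l i = (if i < m then j i else i)" for i
  have ke: "k ` e (l i) = e i" if "i < m" for i using j[OF that] that K_inv_image(2)[OF k] by (simp add: l_def)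
  have "inj_on l {..<m}"
  proof (rule inj_onI)
    fix i i' assume "i \<in> {..<m}" "i' \<in> {..<m}" "l i = l i'"
    then have "e i = e i'" using ke by (metis lessThan_iff)
    then show "i = i'" using e_inj \<open>i \<in> {..<m}\<close> \<open>i' \<in> {..<m}\<close> by simp
  qed
  moreover have "l ` {..<m} \<subseteq> {..<m}" using j by (auto simp: l_def)
  ultimately have "bij_betw l {..<m} {..<m}" by (simp add: bij_betw_def endo_inj_surj)
  then have "l \<in> L" using ke k by (auto simp: L_def l_def)
  then show thesis using ke by (rule that)
qed

lemma perm_group_L: "perm_group {..<m} L"
proof (rule perm_group_finiteI)
  show "id \<in> L" using K_id by (auto simp: L_def intro!: bexI[of _ id])
  fix l l' assume l: "l \<in> L" and l': "l' \<in> L"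
  obtain k k' where k: "k \<in> K" "\<And>i. i < m \<Longrightarrow> k ` e (l i) = e i"
    and k': "k' \<in> K" "\<And>i. i < m \<Longrightarrow> k' ` e (l' i) = e i" using l l' by (auto simp: L_def)
  have bl: "bij_betw l {..<m} {..<m}" "bij_betw l' {..<m} {..<m}" using l l' by (auto simp: L_def)
  \<comment> \<open>Since \<open>l\<close> records an inverse, \<open>l \<circ> l'\<close> is
    induced by the reversed product.\<close>
  have "(k' \<circ> k) ` e ((l \<circ> l') i) = e i" if i: "i < m" for i
  proof -
    have "l' i < m" using bij_betw_apply[OF bl(2)] i by simp
    then show ?thesis using k(2) k'(2)[OF i] by (simp only: comp_apply image_comp[symmetric])
  qed
  moreover have "k' \<circ> k \<in> K" using K_comp k k' by blast
  moreover have "bij_betw (l \<circ> l') {..<m} {..<m}" using bij_betw_trans[OF bl(2,1)] .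
  moreover have "(l \<circ> l') i = i" if "i \<notin> {..<m}" for i using l l' that by (auto simp: L_def)
  ultimately show "l \<circ> l' \<in> L" unfolding L_def by blast
qed (auto simp: L_def)

lemma transitive_L:
  assumes "m > 0" shows "transitive_group {..<m} L"
  unfolding transitive_group_def
proof (intro conjI ballI)
  show "{..<m} \<noteq> {}" using assms by auto
  fix i j assume i: "i \<in> {..<m}" and j: "j \<in> {..<m}"
  \<comment> \<open>It carries \<open>e j\<close> back to \<open>U\<close> and on to
    \<open>e i\<close>, so the index permutation it induces sends \<open>i\<close> to
    \<open>j\<close>.\<close>
  let ?k = "ks i \<circ> inv_into UNIV (ks j)"
  have k: "?k \<in> K" using i j ks K_comp K_inv by simp
  obtain l where l: "l \<in> L" "\<And>i. i < m \<Longrightarrow> ?k ` e (l i) = e i" using K_imp_L[OF k] by blast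
  have "?k ` e j = ks i ` inv_into UNIV (ks j) ` e j" by (rule image_comp[symmetric])
  also have "\<dots> = ks i ` inv_into UNIV (ks j) ` ks j ` U" using j ks(2) by simp
  finally have "?k ` e j = e i" using K_inv_image(1)[OF ks(1), of j U] i j ks(2) by simp
  then have "?k ` e (l i) = ?k ` e j" using l(2) i by simp
  then have "e (l i) = e j" using K_inj[OF k] by (simp only: inj_image_eq_iff)
  moreover have "l i < m" using perm_group_in[OF perm_group_L l(1) i] by simp
  ultimately have "l i = j" using e_inj j by simp
  then show "\<exists>g\<in>L. g i = j" using l(1) by blast
qed

lemma bij_point_of: "bij_betw point_of (expo_points \<Gamma> m) (carrier V)"
proof -
  have einj: "inj_on e {..<m}" and eim: "e ` {..<m} = D" using e by (auto simp: bij_betw_def)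
  have fc: "point_of \<alpha> \<in> carrier V" if "\<alpha> \<in> expo_points \<Gamma> m" for \<alpha>
    unfolding point_of_def using ks_U(2) decode_in expo_points_apply[OF that] by (intro finprod_closed) auto
  have inj: "inj_on point_of (expo_points \<Gamma> m)"
  proof (rule inj_onI)
    fix \<alpha> \<beta> assume \<alpha>: "\<alpha> \<in> expo_points \<Gamma> m" and \<beta>: "\<beta> \<in> expo_points \<Gamma> m" and eq: "point_of \<alpha> = point_of \<beta>"
    \<comment> \<open>Families in \<open>direct_sum\<close> are indexed by the summands themselves,
      so the one over indices is pulled back along the inverse of \<open>e\<close>.\<close>
    define w where "w \<xi> E = (let i = inv_into {..<m} e E in ks i (decode (\<xi> i)))" for \<xi> :: "nat \<Rightarrow> 'b" and E
    have we: "w \<xi> (e i) = ks i (decode (\<xi> i))" if "i < m" for \<xi> i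
      using inv_into_f_f[OF einj, of i] that by (simp add: w_def)
    have w: "w \<xi> \<in> Pi D (\<lambda>U. U)" "finprod V (w \<xi>) D = point_of \<xi>" if \<xi>: "\<xi> \<in> expo_points \<Gamma> m" for \<xi>
    proof -
      show "w \<xi> \<in> Pi D (\<lambda>U. U)"
      proof (rule Pi_I)
        fix E assume "E \<in> D"
        then obtain i where "i < m" "e i = E" using e_surj by blast
        then show "w \<xi> E \<in> E" using we ks_U(1) decode_in expo_points_apply[OF \<xi>] by metis
      qed
      have "w \<xi> \<in> e ` {..<m} \<rightarrow> carrier V" using we ks_U(2) decode_in expo_points_apply[OF \<xi>] by auto
      then have "finprod V (w \<xi>) (e ` {..<m}) = finprod V (\<lambda>i. w \<xi> (e i)) {..<m}"
        using einj by (rule finprod_reindex)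
      also have "\<dots> = point_of \<xi>" unfolding point_of_def
        using we ks_U(2) decode_in expo_points_apply[OF \<xi>] by (intro finprod_cong') auto
      finally show "finprod V (w \<xi>) D = point_of \<xi>" by (simp add: eim)
    qed
    show "\<alpha> = \<beta>"
    proof (rule expo_points_eqI[OF \<alpha> \<beta>])
      fix i assume i: "i < m"
      have "w \<alpha> (e i) = w \<beta> (e i)"
        using direct_sum_inj[OF D w(1)[OF \<alpha>] w(1)[OF \<beta>] _ e_in[OF i]] w(2) \<alpha> \<beta> eq by simp
      then have "decode (\<alpha> i) = decode (\<beta> i)" using we[OF i] K_inj[OF ks(1)[OF i]] by (simp add: inj_eq)
      then show "\<alpha> i = \<beta> i" using code_decode expo_points_apply[OF \<alpha> i] expo_points_apply[OF \<beta> i] by metis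
    qed
  qed
  have surj: "x \<in> point_of ` expo_points \<Gamma> m" if x: "x \<in> carrier V" for x
  proof -
    obtain w where w: "w \<in> Pi D (\<lambda>U. U)" "finprod V w D = x" using D x by (auto simp: direct_sum_def)
    have "\<forall>i. \<exists>u. i < m \<longrightarrow> u \<in> U \<and> w (e i) = ks i u"
      using Pi_mem[OF w(1) e_in] ks(2) by blast
    then obtain u where u: "\<And>i. i < m \<Longrightarrow> u i \<in> U \<and> w (e i) = ks i (u i)" by metis
    let ?\<alpha> = "\<lambda>i\<in>{..<m}. b (u i)"
    have "w \<in> e ` {..<m} \<rightarrow> carrier V" using u ks_U(2) by auto
    then have "finprod V w D = finprod V (\<lambda>i. w (e i)) {..<m}"
      unfolding eim[symmetric] using einj by (rule finprod_reindex)
    also have "\<dots> = point_of ?\<alpha>" unfolding point_of_def using u decode_code ks_U(2) by (intro finprod_cong') auto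
    finally have "x = point_of ?\<alpha>" using w(2) by simp
    moreover have "?\<alpha> \<in> expo_points \<Gamma> m" using u code_in by (intro expo_points_restrict) auto
    ultimately show ?thesis by blast
  qed
  show ?thesis unfolding bij_betw_def using inj fc surj by auto
qed

text \<open>Write \<open>g\<close> as a translation after \<open>k\<close>. In coordinates, position
  \<open>i\<close> reads position \<open>l i\<close>, applies the map \<open>a i\<close> of
  \<open>U\<close>, and translates by the \<open>i\<close>-th coordinate of \<open>g \<one>\<close>;
  the last two together lie in the induced group.\<close>

lemma G_in_wreath: "G \<subseteq> transport (expo_points \<Gamma> m) point_of ` wreath \<Gamma> m H L"
proof
  fix g assume g: "g \<in> G"
  obtain k where k: "k \<in> K" "\<And>x. x \<in> carrier V \<Longrightarrow> g x = g \<one> \<otimes> k x"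
    using affine_decomposition[OF g] by blast
  obtain l where l: "l \<in> L" "\<And>i. i < m \<Longrightarrow> k ` e (l i) = e i" using K_imp_L[OF k(1)] by blast
  have lm: "l i < m" if "i < m" for i using perm_group_in[OF perm_group_L l(1)] that by simp
  have "g \<one> \<in> carrier V" using perm_group_in[OF perm g] by simp
  then obtain \<nu> where \<nu>: "\<nu> \<in> expo_points \<Gamma> m" "g \<one> = point_of \<nu>" using bij_point_of by (auto simp: bij_betw_def)
  have \<nu>U: "decode (\<nu> i) \<in> U" if "i < m" for i using decode_in expo_points_apply[OF \<nu>(1) that] .
  \<comment> \<open>From \<open>U\<close> to the summand \<open>e (l i)\<close>, by \<open>k\<close>
    on to \<open>e i\<close>, and back to \<open>U\<close>. All three factors lie in
    \<open>K\<close>, hence so does \<open>a i\<close>.\<close>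
  define a where "a i = inv_into UNIV (ks i) \<circ> (k \<circ> ks (l i))" for i
  have aK: "a i \<in> K" if "i < m" for i
    using that ks(1) lm k(1) K_comp K_inv unfolding a_def by simp
  have aU: "a i ` U = U" if i: "i < m" for i
  proof -
    have "a i ` U = inv_into UNIV (ks i) ` k ` ks (l i) ` U" by (simp only: a_def image_comp[symmetric])
    also have "\<dots> = inv_into UNIV (ks i) ` ks i ` U" using ks(2)[OF lm[OF i]] ks(2)[OF i] l(2)[OF i] by simp
    finally show ?thesis using K_inv_image(1)[OF ks(1)[OF i]] by simp
  qed
  have ka: "ks i (a i x) = k (ks (l i) x)" if "i < m" for i x
    using K_f_inv[OF ks(1)[OF that]] by (simp add: a_def)
  have "\<forall>i. \<exists>h. i < m \<longrightarrow> h \<in> induced_group U \<and> (\<forall>x\<in>U. h x = decode (\<nu> i) \<otimes> a i x)"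
    using induced_group_member[OF U \<nu>U aK aU] by metis
  then obtain h' where h': "\<And>i. i < m \<Longrightarrow> h' i \<in> induced_group U"
    "\<And>i x. i < m \<Longrightarrow> x \<in> U \<Longrightarrow> h' i x = decode (\<nu> i) \<otimes> a i x" by metis
  define h where "h i = transport U b (h' i)" for i
  have hH: "h i \<in> H" if "i < m" for i using h'(1)[OF that] by (simp add: h_def H_def)
  have ch: "decode (h i y) = decode (\<nu> i) \<otimes> a i (decode y)" if i: "i < m" and y: "y \<in> \<Gamma>" for i y
  proof -
    have "h i (b (decode y)) = b (h' i (decode y))"
      unfolding h_def using transport_apply[of b U "decode y"] b decode_in[OF y] by (simp add: bij_betw_def)
    moreover have "h' i (decode y) \<in> U" using perm_group_in[OF perm_group_induced[OF U] h'(1)[OF i] decode_in[OF y]] .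
    ultimately have "decode (h i y) = h' i (decode y)" using decode_code code_decode[OF y] by simp
    then show ?thesis using h'(2)[OF i decode_in[OF y]] by simp
  qed
  let ?g = "wreath_map \<Gamma> m h l"
  have gW: "?g \<in> wreath \<Gamma> m H L" unfolding wreath_def using hH l(1) by blast
  have gf: "g (point_of \<alpha>) = point_of (?g \<alpha>)" if \<alpha>: "\<alpha> \<in> expo_points \<Gamma> m" for \<alpha>
  proof -
    have cU: "decode (\<alpha> i) \<in> U" if "i < m" for i using decode_in expo_points_apply[OF \<alpha> that] .
    let ?w = "\<lambda>i. k (ks i (decode (\<alpha> i)))"
    have wV: "?w i \<in> carrier V" if "i < m" for i using K_in[OF k(1) ks_U(2)[OF that cU[OF that]]] .
    have lb: "l ` {..<m} = {..<m}" "inj_on l {..<m}"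
      using perm_group_bij_betw[OF perm_group_L l(1)] by (auto simp: bij_betw_def)
    have fV: "point_of \<alpha> \<in> carrier V" using bij_betw_apply[OF bij_point_of \<alpha>] .
    have "k (point_of \<alpha>) = finprod V ?w {..<m}"
      unfolding point_of_def using ks_U(2) cU by (intro K_finprod[OF k(1)]) auto
    \<comment> \<open>Reordering the commutative product by \<open>l\<close> puts the factor that
      lies in \<open>e i\<close> at position \<open>i\<close>.\<close>
    also have "\<dots> = finprod V (\<lambda>i. ?w (l i)) {..<m}"
      using finprod_reindex[of ?w l "{..<m}"] lb wV by auto
    finally have kf: "k (point_of \<alpha>) = finprod V (\<lambda>i. ?w (l i)) {..<m}" .
    have "g (point_of \<alpha>) = point_of \<nu> \<otimes> k (point_of \<alpha>)" using k(2)[OF fV] \<nu>(2) by simp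
    also have "\<dots> = finprod V (\<lambda>i. ks i (decode (\<nu> i)) \<otimes> ?w (l i)) {..<m}"
      unfolding kf unfolding point_of_def using ks_U(2) \<nu>U wV lm by (intro finprod_multf[symmetric]) auto
    also have "\<dots> = finprod V (\<lambda>i. ks i (decode (?g \<alpha> i))) {..<m}"
    proof (rule finprod_cong'[OF refl])
      have eq: "ks i (decode (\<nu> i)) \<otimes> ?w (l i) = ks i (decode (?g \<alpha> i))" if i: "i < m" for i
      proof -
        have "?g \<alpha> i = h i (\<alpha> (l i))" using \<alpha> i by (simp add: wreath_map_def)
        then have "decode (?g \<alpha> i) = decode (\<nu> i) \<otimes> a i (decode (\<alpha> (l i)))"
          using ch[OF i expo_points_apply[OF \<alpha> lm[OF i]]] by simp
        moreover have "a i (decode (\<alpha> (l i))) \<in> carrier V" using K_in[OF aK[OF i] U_carrier[OF U cU[OF lm[OF i]]]] .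
        ultimately show ?thesis
          using K_mult[OF ks(1)[OF i] U_carrier[OF U \<nu>U[OF i]]] ka[OF i] by simp
      qed
      show "ks i (decode (\<nu> i)) \<otimes> ?w (l i) = ks i (decode (?g \<alpha> i))" if "i \<in> {..<m}" for i using eq that by simp
      have "?g \<alpha> \<in> expo_points \<Gamma> m"
        by (rule wreath_map_in[OF finite_\<Gamma> perm_group_H perm_group_L _ l(1) \<alpha>]) (rule hH)
      then have "decode (?g \<alpha> i) \<in> U" if "i < m" for i using decode_in[OF expo_points_apply] that by blast
      then show "(\<lambda>i. ks i (decode (?g \<alpha> i))) \<in> {..<m} \<rightarrow> carrier V" using ks_U(2) by auto
    qed
    finally show ?thesis unfolding point_of_def .
  qed
  have "g = transport (expo_points \<Gamma> m) point_of ?g"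
  proof
    fix x
    have fi: "inj_on point_of (expo_points \<Gamma> m)" "point_of ` expo_points \<Gamma> m = carrier V" using bij_point_of by (auto simp: bij_betw_def)
    show "g x = transport (expo_points \<Gamma> m) point_of ?g x"
    proof (cases "x \<in> carrier V")
      case True
      then obtain \<alpha> where "\<alpha> \<in> expo_points \<Gamma> m" "x = point_of \<alpha>" using fi(2) by blast
      then show ?thesis using gf transport_apply[OF fi(1)] by simp
    next
      case False
      then show ?thesis using perm_group_outside[OF perm g] fi(2) by (simp add: transport_def)
    qed
  qed
  then show "g \<in> transport (expo_points \<Gamma> m) point_of ` wreath \<Gamma> m H L" using gW by blast
qed

text \<open>The fusion consists of the orbitals of the wreath product carried over to
  \<open>V\<close>: it is a fusion by \<open>G_in_wreath\<close>, and the inverse of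
  \<open>point_of\<close> is the isomorphism.\<close>

lemma fusion_expo:
  defines "S' \<equiv> Inv (carrier V) (transport (expo_points \<Gamma> m) point_of ` wreath \<Gamma> m H L)"
  shows "is_fusion (carrier V) S' (Inv (carrier V) G)"
    and "cc_isomorphic (carrier V) S' (expo_points \<Gamma> m) (expo_rels \<Gamma> (Inv \<Gamma> H) m L)"
proof -
  let ?P = "expo_points \<Gamma> m" and ?W = "wreath \<Gamma> m H L"
  have pW: "perm_group ?P ?W" by (rule perm_group_wreath[OF finite_\<Gamma> perm_group_H perm_group_L])
  note tp = finite_expo_points[OF finite_\<Gamma>] pW bij_point_of
  show "is_fusion (carrier V) S' (Inv (carrier V) G)"
    unfolding S'_def by (rule is_fusion_Inv[OF finite_carrier perm perm_group_transport[OF tp] G_in_wreath])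
  let ?coords = "inv_into ?P point_of"
  have S': "S' = (\<lambda>s. (\<lambda>(a, b). (point_of a, point_of b)) ` s) ` Inv ?P ?W" unfolding S'_def by (rule Inv_transport[OF tp])
  have sub: "s \<subseteq> ?P \<times> ?P" if "s \<in> Inv ?P ?W" for s
    using coherent_config_Inv[OF pW finite_expo_points[OF finite_\<Gamma>]] that by (auto simp: coherent_config_def)
  have "(\<lambda>(a, b). (?coords a, ?coords b)) ` (\<lambda>(a, b). (point_of a, point_of b)) ` s = s" if s: "s \<in> Inv ?P ?W" for s
  proof -
    have "(\<lambda>(a, b). (?coords a, ?coords b)) ` (\<lambda>(a, b). (point_of a, point_of b)) ` s = (\<lambda>z. z) ` s"
      unfolding image_image using sub[OF s] bij_betw_inv_into_left[OF bij_point_of]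
      by (intro image_cong) (auto split: prod.splits)
    then show ?thesis by simp
  qed
  then have "(\<lambda>s. (\<lambda>(a, b). (?coords a, ?coords b)) ` s) ` S' = Inv ?P ?W" unfolding S' image_image by simp
  moreover have "bij_betw ?coords (carrier V) ?P" by (rule bij_betw_inv_into[OF bij_point_of])
  ultimately show "cc_isomorphic (carrier V) S' ?P (expo_rels \<Gamma> (Inv \<Gamma> H) m L)"
    unfolding cc_isomorphic_def expo_rels_Inv[OF finite_\<Gamma> perm_group_H perm_group_L] by blast
qed

lemma odd_L:
  assumes anti: "antisymmetric_cc (carrier V) (Inv (carrier V) G)"
  shows "odd (card L)"
proof
  assume "even (card L)"
  define N where "N = perm_group_monoid L"
  have N: "carrier N = L" "monoid.mult N = (\<circ>)" "one N = id" by (auto simp: N_def perm_group_monoid_def)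
  interpret N: group N unfolding N_def by (rule perm_group_monoid_group[OF perm_group_L])
  have finL: "finite L" using perm_group_finite[OF perm_group_L] by simp
  obtain q where "card L = 2 ^ 1 * q" using \<open>even (card L)\<close> by (auto elim: evenE)
  \<comment> \<open>Sylow's theorem for the prime 2 with exponent 1 gives a subgroup of order 2,
    whose element other than \<open>id\<close> is the involution sought.\<close>
  then obtain Q where Q: "subgroup Q N" "card Q = 2"
    using sylow_thm[OF two_is_prime_nat N.is_group, of 1 q] finL N(1) by (auto simp: order_def)
  have idQ: "id \<in> Q" using subgroup.one_closed[OF Q(1)] N by simp
  obtain x y where xy: "Q = {x, y}" "x \<noteq> y" using Q(2) by (meson card_2_iff)
  obtain l where l: "l \<in> Q" "l \<noteq> id" "Q = {id, l}"
  proof (cases "x = id")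
    case True
    then show thesis using that[of y] xy by auto
  next
    case False
    then have "y = id" using idQ xy by auto
    then show thesis using that[of x] xy False by auto
  qed
  have lL: "l \<in> L" using subgroup.mem_carrier[OF Q(1) l(1)] N by simp
  have "l \<circ> l \<in> Q" using subgroup.m_closed[OF Q(1) l(1) l(1)] N by simp
  moreover have "l \<circ> l \<noteq> l"
  proof
    assume "l \<circ> l = l"
    then have "l (l x) = l x" for x by (metis comp_apply)
    then have "l x = x" for x using perm_group_bij[OF perm_group_L lL] by (metis bij_is_inj injD)
    with l(2) show False by auto
  qed
  ultimately have ll: "l (l x) = x" for x using l(3) by (metis comp_apply id_apply insertE singletonD)
  obtain k where k: "k \<in> K" "\<And>i. i < m \<Longrightarrow> k ` e (l i) = e i" using lL by (auto simp: L_def)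
  have lm: "l i < m" if "i < m" for i using perm_group_in[OF perm_group_L lL] that by simp
  \<comment> \<open>The relation between \<open>k\<close> and \<open>l\<close> passes to powers, so
    \<open>l ^^ n\<close> fixes all indices as soon as \<open>k ^^ n\<close> is the
    identity.\<close>
  have kn: "(k ^^ n) ` e ((l ^^ n) i) = e i \<and> (l ^^ n) i < m" if "i < m" for n i
    using that
  proof (induction n arbitrary: i)
    case (Suc n)
    have l: "(l ^^ Suc n) i = (l ^^ n) (l i)" by (simp only: funpow_Suc_right comp_apply)
    have "(k ^^ Suc n) ` e ((l ^^ Suc n) i) = k ` (k ^^ n) ` e ((l ^^ n) (l i))"
      unfolding l by (simp only: funpow.simps(2) image_comp)
    also have "\<dots> = e i" using Suc.IH[OF lm[OF Suc.prems]] k(2)[OF Suc.prems] by simp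
    finally show ?case using Suc.IH[OF lm[OF Suc.prems]] l by simp
  qed simp
  define M where "M = perm_group_monoid G"
  have M: "carrier M = G" "one M = id" by (auto simp: M_def perm_group_monoid_def)
  interpret M: group M unfolding M_def by (rule perm_group_monoid_group[OF perm])
  have Mpow: "x [^]\<^bsub>M\<^esub> (n::nat) = x ^^ n" for x n by (simp add: M_def perm_group_monoid_pow)
  have kG: "k \<in> carrier M" using K_G[OF k(1)] M by simp
  let ?n = "M.ord k"
  have n0: "?n > 0"
    using M.ord_ge_1[OF _ kG] perm_group_finite[OF perm finite_carrier] M by simp
  have kid: "k ^^ ?n = id" using M.pow_ord_eq_1[OF kG] Mpow M by simp
  \<comment> \<open>For odd \<open>?n\<close> the power \<open>l ^^ ?n\<close> would be
    \<open>l\<close>, and yet trivial because \<open>k ^^ ?n\<close> is.\<close>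
  have "even ?n"
  proof (rule ccontr)
    assume "odd ?n"
    have "l ^^ (2 * r) = id" for r by (induction r) (auto simp: fun_eq_iff ll)
    moreover obtain r where "?n = Suc (2 * r)" using \<open>odd ?n\<close> by (auto elim: oddE)
    ultimately have ln: "l ^^ ?n = l" by simp
    have "l i = i" for i
    proof (cases "i < m")
      case True
      then have "e (l i) = e i" using kn[OF True, of ?n] kid ln by simp
      then show ?thesis using e_inj lm True by blast
    next
      case False
      then show ?thesis using perm_group_outside[OF perm_group_L lL] by simp
    qed
    with l(2) show False by auto
  qed
  then obtain r where r: "?n = 2 * r" by (auto elim: evenE)
  \<comment> \<open>An involution of \<open>G\<close>; a point that it moves is swapped with its
    image, which antisymmetry forbids.\<close>
  let ?t = "k ^^ r"
  have tG: "?t \<in> G" using M.nat_pow_closed[OF kG, of r] Mpow M by simp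
  have "\<not> ?n dvd r" using r n0 by (auto dest: dvd_imp_le)
  then have "?t \<noteq> id" using M.pow_eq_id[OF kG, of r] Mpow M by simp
  then obtain x where x: "?t x \<noteq> x" by (auto simp: fun_eq_iff)
  have xV: "x \<in> carrier V" using x perm_group_outside[OF perm tG] by blast
  have "?t (?t x) = (k ^^ (r + r)) x" by (simp add: funpow_add)
  then have "?t (?t x) = x" using kid r by (simp add: mult_2)
  then show False
    using anti xV perm_group_in[OF perm tG xV] tG x unfolding antisymmetric_Inv_iff[OF perm] by metis
qed

end

theorem theorem6p1:
  fixes \<Omega> :: "'a set" and G :: "('a \<Rightarrow> 'a) set"
  assumes "finite \<Omega>"
    and "perm_group \<Omega> G"
    and "primitive_group \<Omega> G"
    and "solvable_perm_group G"
  shows "\<exists>S' (\<Gamma> :: nat set) T m L.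
           is_fusion \<Omega> S' (Inv \<Omega> G) \<and>
           cc_isomorphic \<Omega> S' (expo_points \<Gamma> m) (expo_rels \<Gamma> T m L) \<and>
           linearly_primitive_scheme \<Gamma> T \<and>
           perm_group {..<m} L \<and> transitive_group {..<m} L \<and>
           (antisymmetric_cc \<Omega> (Inv \<Omega> G) \<longrightarrow> antisymmetric_cc \<Gamma> T \<and> odd (card L))"
proof -
  obtain V p where V: "carrier V = \<Omega>" "affine_perm_group V G p"
    using primitive_solvable_affine[OF assms] by blast
  interpret affine_perm_group V G p by (rule V(2))
  obtain D U where D: "direct_sum V (carrier V) D" "permuted D" "U \<in> D"
    and tr: "\<And>U'. U' \<in> D \<Longrightarrow> \<exists>k\<in>K. k ` U = U'"
    and irr: "\<And>W. subgroup W V \<Longrightarrow> W \<subseteq> U \<Longrightarrow>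
      (\<And>k. k \<in> K \<Longrightarrow> k ` U = U \<Longrightarrow> k ` W \<subseteq> W) \<Longrightarrow> W = {\<one>\<^bsub>V\<^esub>} \<or> W = U"
    and prim: "\<And>E. direct_sum V U E \<Longrightarrow> {\<one>\<^bsub>V\<^esub>} \<notin> E \<Longrightarrow>
      (\<And>k W. k \<in> K \<Longrightarrow> k ` U = U \<Longrightarrow> W \<in> E \<Longrightarrow> k ` W \<in> E) \<Longrightarrow> card E \<le> 1"
    by (rule primitive_component_exists) blast
  have U: "subgroup U V" and finD: "finite D" using D by (auto simp: direct_sum_def)
  define m where "m = card D"
  have m: "m > 0" using D(3) finD by (auto simp: m_def card_gt_0_iff)
  obtain e where e: "bij_betw e {..<m} D"
    using ex_bij_betw_nat_finite[OF finD] by (auto simp: m_def atLeast0LessThan)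
  have "\<forall>i. \<exists>k. i < m \<longrightarrow> k \<in> K \<and> k ` U = e i" using tr bij_betw_apply[OF e] by (metis lessThan_iff)
  then obtain ks where ks: "\<And>i. i < m \<Longrightarrow> ks i \<in> K" "\<And>i. i < m \<Longrightarrow> ks i ` U = e i" by metis
  \<comment> \<open>The base set \<Gamma> has to consist of natural numbers, so \<open>U\<close> is
    renamed by an initial segment.\<close>
  obtain b where b: "bij_betw b U {0..<card U}" using ex_bij_betw_finite_nat[OF finite_U[OF U]] by blast
  interpret component_coordinates V G p D U m e ks b "{0..<card U}"
    by (intro component_coordinates.intro component_coordinates_axioms.intro V(2) D(1,2) U e ks b)
  have lp: "linearly_primitive_scheme {0..<card U} (Inv {0..<card U} H)"
    unfolding H_def by (rule linearly_primitive_induced[OF U irr assms(4) prim b])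
  have anti: "antisymmetric_cc {0..<card U} (Inv {0..<card U} H)"
    if "antisymmetric_cc \<Omega> (Inv \<Omega> G)"
    unfolding H_def using that V(1)
    by (intro antisymmetric_transport[OF finite_U[OF U] perm_group_induced[OF U] b] antisymmetric_induced[OF U]) simp
  show ?thesis
    using fusion_expo lp perm_group_L transitive_L[OF m] anti odd_L unfolding V(1) by blast
qed

end
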